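(* Let $r_*$ satisfy $\frac{3}{5-a}<r_*<1$ and $r_*\ge\frac1{2-a}$, and let $\alpha\ge\frac{2r_*}{1-r_*}$ with $\alpha>\frac{3r_*(4-3a)}{r_*(5-a)-3}$. Let $u\ge0$ be a sufficiently regular solution of the problem below, $\bar u=u-\Psi$, $\bar u_0=u_0-\Psi(\cdot,0)$, and set $$V_0=1+\int_U|\bar u_0|^\alpha dx,\qquad V(t)=1+\int_U|\bar u(x,t)|^\alpha dx,$$ $$\mathcal E(t)=\chi_*^{\bar\mu}\Big(1+\|\Psi(\cdot,t)\|_{L^{\frac{2r_*}{1-r_*}}}^{\frac{2\theta}{1-\theta}}\Big)+\chi_*^{3-2a}\int_U|\Psi(x,t)|^{\alpha+4(1-a)}dx+\chi_*^{1-a}\int_U|\nabla\Psi(x,t)|^{\frac{\alpha+4(1-a)}2}dx+\chi_*^{-\frac{(3-2a)(\alpha-1)}{5-4a}}\int_U|\Psi_t(x,t)|^{\frac{\alpha+4(1-a)}{5-4a}}dx,$$ $$C_*=C_0\Big(1+2^{\frac{2\theta}{1-\theta}}+2^{\alpha+4(1-a)-1}+2^{\frac{\alpha+4(1-a)}2-1}\Big)(1+|U|)^{\max\{1,\frac{(1-r_* )\theta}{r_*(1-\theta)}\}}.$$ Suppose $T>0$ and $B\in(0,1)$ satisfy $\gamma C_*V_0^\gamma\int_0^T\mathcal E(\tau)d\tau\le B$. Then for all $t\in[0,T]$, $$V(t)\le V_0\Big(1-\gamma C_*V_0^\gamma\int_0^t\mathcal E(\tau)d\tau\Big)^{-1/\gamma},\qquad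 V(t)\le V_0(1-B)^{-1/\gamma},$$ and $$\int_0^T\!\!\int_U(1+u)^{-2}|\nabla\bar u|^{2-a}|\bar u|^{\alpha-2}dxdt\le\frac{8\chi_*}{c_4}V_0\Big(1+\frac{B}{\gamma(1-B)^{1+\frac1\gamma}}\Big).$$
   Context: Let $N\ge1$ be an integer, $0=\bar\alpha_0<\dots<\bar\alpha_N$, $a_0,\dots,a_N>0$, $g(s)=\sum_{i=0}^Na_is^{\bar\alpha_i}$ ($0^0=1$), $a=\bar\alpha_N/(1+\bar\alpha_N)$, $\chi_0=\sum_ia_i$. $\vec k\in\mathbb R^3$ a unit vector, $\mathbf Jx=\vec k\times x$; $F_z(v)=g(|v|)v+z\mathbf Jv$ is a bijection of $\mathbb R^3$ for each $z\in\mathbb R$; fix $R_*\ge0$ and $X(z,y)=F_{R_*z}^{-1}(y)$. $\mathcal G>0$, $\Omega\ge0$, $e_0\in C^\infty(\mathbb R,\mathbb R^3)$, $|e_0|=1$, $\mathcal Z(x,t)=-\mathcal Ge_0(t)+\Omega^2\mathbf J^2x$. $U\subset\mathbb R^3$ open bounded with $C^1$ boundary $\Gamma$, $r_U=\max_{\bar U}|x|$, $\chi_*=\max\{1,R_*^2,\chi_0^2,\mathcal G+\Omega^2r_U\}$. Problem: $u_t=\nabla\cdot X(u,\nabla u+u^2\mathcal Z)$ in $U\times(0,\infty)$, $u(\cdot,0)=u_0$, $u=\psi$ on $\Gamma\times(0,\infty)$; $\Psi$ is an extension of $\psi$ to $\bar U\times[0,\infty)$ (so $\bar u=0$ on $\Gamma$).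 Parameters: $\theta=\frac{12(1-a)r_*}{\alpha((5-a)r_*-3)-3ar_*}$, $\mu=\frac{4(1-a)+a\theta}{1-\theta}$, $\gamma=\frac\mu\alpha+\frac{2\theta}{\alpha(1-\theta)}$, $\bar\mu=\frac{3-2a+\theta}{1-\theta}$. Constants: $c_3=a_N^{a-1}$, $c_4=(\min\{1,a_0,a_N\}/2^{\bar\alpha_N})^{1+a}$, $c_5=2^{-a}c_4$, $c_9=c_5\chi_0^{-2}$, $c_{10}=c_4/4$, $c_{11}=4^{1-a}c_5+c_9+2c_3(32c_3/c_4)^{1-a}+c_{10}$, $c_{12}=2\cdot4^{1-a}c_3[1+(32c_3/c_4)^{1-a}]$, $c_{13}=5c_{12}+2c_{11}+1$, $c_{14}=4c_{12}+c_{11}$, $c_{15}=\max\{1,2c_{11},c_{14}\}$; $\bar c>0$ depends on $U$ and $q=r_*(2-a)$ with $\|f\|_{L^{3q/(3-q)}(U)}\le\bar c\|\nabla f\|_{L^q(U)}$ for all $f\in W^{1,q}_0(U)$; $C_1=[2^{\frac{1+r_*}{r_*}}(\frac{\bar c(\alpha-a)}{2-a})^{2-a}(1+|U|)^{\frac{\alpha(1-r_* )-2r_*}{\alpha r_*}}]^{\frac\theta{1-\theta}}$, $C_2=c_{13}C_1(4c_{13}/c_{10})^{\frac\theta{1-\theta}}$, $C_0=\max\{C_2,c_{15}\}\alpha(\alpha-1)$. *)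

theory Defs
  imports "HOL-Analysis.Analysis"
begin

definition C1_on :: "'a::euclidean_space set \<Rightarrow> ('a \<Rightarrow> 'b::real_normed_vector) \<Rightarrow> bool" where
  "C1_on S f \<longleftrightarrow> (\<exists>f'. (\<forall>z\<in>S. (f has_derivative blinfun_apply (f' z)) (at z)) \<and> continuous_on S f')"

definition smooth_curve :: "(real \<Rightarrow> 'b::real_normed_vector) \<Rightarrow> bool" where
  "smooth_curve e \<longleftrightarrow> (\<exists>D::nat \<Rightarrow> real \<Rightarrow> 'b. D 0 = e \<and>
      (\<forall>n t. (D n has_vector_derivative D (Suc n) t) (at t)))"

definition grad3 :: "(real^3 \<Rightarrow> real) \<Rightarrow> real^3 \<Rightarrow> real^3" where
  "grad3 f x = (\<chi> i. frechet_derivative f (at x) (axis i 1))"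

definition div3 :: "(real^3 \<Rightarrow> real^3) \<Rightarrow> real^3 \<Rightarrow> real" where
  "div3 W x = (\<Sum>i\<in>UNIV. frechet_derivative (\<lambda>y. W y $ i) (at x) (axis i 1))"

definition tderiv :: "(real^3 \<Rightarrow> real \<Rightarrow> real) \<Rightarrow> real^3 \<Rightarrow> real \<Rightarrow> real" where
  "tderiv w x t = deriv (\<lambda>s. w x s) t"

definition C1_boundary :: "(real^3) set \<Rightarrow> bool" where
  "C1_boundary U \<longleftrightarrow> (\<forall>p\<in>frontier U. \<exists>r>0. \<exists>(Q :: real^3 \<Rightarrow> real^3) \<gamma>.
      orthogonal_transformation Q \<and> C1_on (UNIV::(real^2) set) (\<gamma> :: real^2 \<Rightarrow> real) \<and>
      (\<forall>x\<in>ball p r. x \<in> U \<longleftrightarrow> (Q x) $ 3 > \<gamma> (vector [(Q x) $ 1, (Q x) $ 2])))"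

definition gfun :: "nat \<Rightarrow> (nat \<Rightarrow> real) \<Rightarrow> (nat \<Rightarrow> real) \<Rightarrow> real \<Rightarrow> real" where
  "gfun N alb ac s = ac 0 + (\<Sum>i\<in>{1..N}. ac i * s powr alb i)"
  \<comment> \<open>since alb 0 = 0 and 0^0 = 1, the i = 0 term is ac 0\<close>

definition Jop :: "real^3 \<Rightarrow> real^3 \<Rightarrow> real^3" where
  "Jop k x = cross3 k x"

definition Fmap :: "nat \<Rightarrow> (nat \<Rightarrow> real) \<Rightarrow> (nat \<Rightarrow> real) \<Rightarrow> real^3 \<Rightarrow> real \<Rightarrow> real^3 \<Rightarrow> real^3" where
  "Fmap N alb ac k z v = gfun N alb ac (norm v) *\<^sub>R v + z *\<^sub>R Jop k v"

definition Xmap :: "nat \<Rightarrow> (nat \<Rightarrow> real) \<Rightarrow> (nat \<Rightarrow> real) \<Rightarrow> real \<Rightarrow> real^3 \<Rightarrow> real \<Rightarrow> real^3 \<Rightarrow> real^3" where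
  "Xmap N alb ac Rs k z y = inv (Fmap N alb ac k (Rs * z)) y"

definition Zfield :: "real \<Rightarrow> real \<Rightarrow> real^3 \<Rightarrow> (real \<Rightarrow> real^3) \<Rightarrow> real^3 \<Rightarrow> real \<Rightarrow> real^3" where
  "Zfield G Om k e0 x t = - (G *\<^sub>R e0 t) + Om\<^sup>2 *\<^sub>R Jop k (Jop k x)"

definition aexp :: "nat \<Rightarrow> (nat \<Rightarrow> real) \<Rightarrow> real" where
  "aexp N alb = alb N / (1 + alb N)"

definition chi0 :: "nat \<Rightarrow> (nat \<Rightarrow> real) \<Rightarrow> real" where
  "chi0 N ac = (\<Sum>i\<le>N. ac i)"

definition rU :: "(real^3) set \<Rightarrow> real" where
  "rU U = Sup (norm ` closure U)"

definition chistar :: "nat \<Rightarrow> (nat \<Rightarrow> real) \<Rightarrow> real \<Rightarrow> real \<Rightarrow> real \<Rightarrow> (real^3) set \<Rightarrow> real" where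
  "chistar N ac Rs G Om U = Max {1, Rs\<^sup>2, (chi0 N ac)\<^sup>2, G + Om\<^sup>2 * rU U}"

definition flux :: "nat \<Rightarrow> (nat \<Rightarrow> real) \<Rightarrow> (nat \<Rightarrow> real) \<Rightarrow> real \<Rightarrow> real^3 \<Rightarrow> real \<Rightarrow> real
    \<Rightarrow> (real \<Rightarrow> real^3) \<Rightarrow> (real^3 \<Rightarrow> real \<Rightarrow> real) \<Rightarrow> real^3 \<Rightarrow> real \<Rightarrow> real^3" where
  "flux N alb ac Rs k G Om e0 u x t =
     Xmap N alb ac Rs k (u x t) (grad3 (\<lambda>y. u y t) x + (u x t)\<^sup>2 *\<^sub>R Zfield G Om k e0 x t)"

definition regular_solution ::
  "nat \<Rightarrow> (nat \<Rightarrow> real) \<Rightarrow> (nat \<Rightarrow> real) \<Rightarrow> real \<Rightarrow> real^3 \<Rightarrow> real \<Rightarrow> real \<Rightarrow> (real \<Rightarrow> real^3)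
    \<Rightarrow> (real^3) set \<Rightarrow> (real^3 \<Rightarrow> real) \<Rightarrow> (real^3 \<Rightarrow> real \<Rightarrow> real) \<Rightarrow> (real^3 \<Rightarrow> real \<Rightarrow> real) \<Rightarrow> bool" where
  "regular_solution N alb ac Rs k G Om e0 U u0 psi u \<longleftrightarrow>
     continuous_on (closure U \<times> {0..}) (\<lambda>(x, t). u x t) \<and>
     (\<exists>S. open S \<and> closure U \<times> {0<..} \<subseteq> S \<and> C1_on S (\<lambda>(x, t). u x t)) \<and>
     (\<exists>S. open S \<and> closure U \<times> {0<..} \<subseteq> S \<and>
          C1_on S (\<lambda>(x, t). flux N alb ac Rs k G Om e0 u x t)) \<and>
     (\<forall>x\<in>U. \<forall>t>0. tderiv u x t = div3 (\<lambda>y. flux N alb ac Rs k G Om e0 u y t) x) \<and>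
     (\<forall>x\<in>U. u x 0 = u0 x) \<and>
     (\<forall>x\<in>frontier U. \<forall>t>0. u x t = psi x t)"

definition regular_extension :: "(real^3) set \<Rightarrow> (real^3 \<Rightarrow> real \<Rightarrow> real) \<Rightarrow> (real^3 \<Rightarrow> real \<Rightarrow> real) \<Rightarrow> bool" where
  "regular_extension U psi Psi \<longleftrightarrow>
     (\<exists>S. open S \<and> closure U \<times> {0..} \<subseteq> S \<and> C1_on S (\<lambda>(x, t). Psi x t)) \<and>
     (\<forall>x\<in>frontier U. \<forall>t>0. Psi x t = psi x t)"

definition theta_p :: "real \<Rightarrow> real \<Rightarrow> real \<Rightarrow> real" where
  "theta_p a rs alpha = 12 * (1 - a) * rs / (alpha * ((5 - a) * rs - 3) - 3 * a * rs)"

definition mu_p :: "real \<Rightarrow> real \<Rightarrow> real" where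
  "mu_p a th = (4 * (1 - a) + a * th) / (1 - th)"

definition gamma_p :: "real \<Rightarrow> real \<Rightarrow> real \<Rightarrow> real" where
  "gamma_p a alpha th = mu_p a th / alpha + 2 * th / (alpha * (1 - th))"

definition mubar_p :: "real \<Rightarrow> real \<Rightarrow> real" where
  "mubar_p a th = (3 - 2 * a + th) / (1 - th)"

definition c3 :: "real \<Rightarrow> real \<Rightarrow> real" where "c3 a aN = aN powr (a - 1)"
definition c4 :: "real \<Rightarrow> real \<Rightarrow> real \<Rightarrow> real \<Rightarrow> real" where
  "c4 a a0 aN alN = (Min {1, a0, aN} / 2 powr alN) powr (1 + a)"
definition c5 :: "real \<Rightarrow> real \<Rightarrow> real \<Rightarrow> real \<Rightarrow> real" where
  "c5 a a0 aN alN = 2 powr (- a) * c4 a a0 aN alN"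
definition c9 :: "real \<Rightarrow> real \<Rightarrow> real \<Rightarrow> real \<Rightarrow> real \<Rightarrow> real" where
  "c9 a a0 aN alN ch0 = c5 a a0 aN alN * ch0 powr (-2)"
definition c10 :: "real \<Rightarrow> real \<Rightarrow> real \<Rightarrow> real \<Rightarrow> real" where
  "c10 a a0 aN alN = c4 a a0 aN alN / 4"
definition c11 :: "real \<Rightarrow> real \<Rightarrow> real \<Rightarrow> real \<Rightarrow> real \<Rightarrow> real" where
  "c11 a a0 aN alN ch0 = 4 powr (1 - a) * c5 a a0 aN alN + c9 a a0 aN alN ch0
      + 2 * c3 a aN * (32 * c3 a aN / c4 a a0 aN alN) powr (1 - a) + c10 a a0 aN alN"
definition c12 :: "real \<Rightarrow> real \<Rightarrow> real \<Rightarrow> real \<Rightarrow> real" where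
  "c12 a a0 aN alN = 2 * 4 powr (1 - a) * c3 a aN * (1 + (32 * c3 a aN / c4 a a0 aN alN) powr (1 - a))"
definition c13 :: "real \<Rightarrow> real \<Rightarrow> real \<Rightarrow> real \<Rightarrow> real \<Rightarrow> real" where
  "c13 a a0 aN alN ch0 = 5 * c12 a a0 aN alN + 2 * c11 a a0 aN alN ch0 + 1"
definition c14 :: "real \<Rightarrow> real \<Rightarrow> real \<Rightarrow> real \<Rightarrow> real \<Rightarrow> real" where
  "c14 a a0 aN alN ch0 = 4 * c12 a a0 aN alN + c11 a a0 aN alN ch0"
definition c15 :: "real \<Rightarrow> real \<Rightarrow> real \<Rightarrow> real \<Rightarrow> real \<Rightarrow> real" where
  "c15 a a0 aN alN ch0 = Max {1, 2 * c11 a a0 aN alN ch0, c14 a a0 aN alN ch0}"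

definition C1c :: "real \<Rightarrow> real \<Rightarrow> real \<Rightarrow> real \<Rightarrow> real \<Rightarrow> real \<Rightarrow> real" where
  "C1c a rs alpha cbar mU th =
     (2 powr ((1 + rs) / rs) * (cbar * (alpha - a) / (2 - a)) powr (2 - a)
       * (1 + mU) powr ((alpha * (1 - rs) - 2 * rs) / (alpha * rs))) powr (th / (1 - th))"

definition C2c :: "real \<Rightarrow> real \<Rightarrow> real \<Rightarrow> real \<Rightarrow> real \<Rightarrow> real \<Rightarrow> real \<Rightarrow> real \<Rightarrow> real \<Rightarrow> real \<Rightarrow> real" where
  "C2c a a0 aN alN ch0 rs alpha cbar mU th =
     c13 a a0 aN alN ch0 * C1c a rs alpha cbar mU th
       * (4 * c13 a a0 aN alN ch0 / c10 a a0 aN alN) powr (th / (1 - th))"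

definition C0c :: "real \<Rightarrow> real \<Rightarrow> real \<Rightarrow> real \<Rightarrow> real \<Rightarrow> real \<Rightarrow> real \<Rightarrow> real \<Rightarrow> real \<Rightarrow> real \<Rightarrow> real" where
  "C0c a a0 aN alN ch0 rs alpha cbar mU th =
     max (C2c a a0 aN alN ch0 rs alpha cbar mU th) (c15 a a0 aN alN ch0) * alpha * (alpha - 1)"


definition Efun :: "real \<Rightarrow> real \<Rightarrow> real \<Rightarrow> real \<Rightarrow> real \<Rightarrow> (real^3) set \<Rightarrow> (real^3 \<Rightarrow> real \<Rightarrow> real) \<Rightarrow> real \<Rightarrow> real" where
  "Efun chis a th rs alpha U Psi \<tau> =
     chis powr (mubar_p a th)
       * (1 + ((LINT x:U|lborel. \<bar>Psi x \<tau>\<bar> powr (2 * rs / (1 - rs)))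
                powr ((1 - rs) / (2 * rs))) powr (2 * th / (1 - th)))
     + chis powr (3 - 2 * a) * (LINT x:U|lborel. \<bar>Psi x \<tau>\<bar> powr (alpha + 4 * (1 - a)))
     + chis powr (1 - a)
         * (LINT x:U|lborel. norm (grad3 (\<lambda>y. Psi y \<tau>) x) powr ((alpha + 4 * (1 - a)) / 2))
     + chis powr (- (3 - 2 * a) * (alpha - 1) / (5 - 4 * a))
         * (LINT x:U|lborel. \<bar>tderiv Psi x \<tau>\<bar> powr ((alpha + 4 * (1 - a)) / (5 - 4 * a)))"

definition Cstar :: "real \<Rightarrow> real \<Rightarrow> real \<Rightarrow> real \<Rightarrow> real \<Rightarrow> real \<Rightarrow> real \<Rightarrow> real \<Rightarrow> real \<Rightarrow> real \<Rightarrow> real" where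
  "Cstar a a0 aN alN ch0 rs alpha cbar mU th =
     C0c a a0 aN alN ch0 rs alpha cbar mU th
       * (1 + 2 powr (2 * th / (1 - th)) + 2 powr (alpha + 4 * (1 - a) - 1)
            + 2 powr ((alpha + 4 * (1 - a)) / 2 - 1))
       * (1 + mU) powr (max 1 ((1 - rs) * th / (rs * (1 - th))))"

end

theory Submission
  imports Defs
begin

text \<open>
Write \<open>w = u - \<Psi>\<close>, which vanishes on the boundary. Testing the equation with \<open>|w|^(\<alpha> - 2) w\<close> gives the
derivative of \<open>V\<close>; the divergence theorem needs no boundary regularity here, since the test function and its
gradient vanish on the frontier and the zero extension is therefore differentiable on the whole space.
The flux bounds \<open>|X(y)| \<le> c |y|^(1 - a)\<close> and \<open>X(y) \<bullet> y \<ge> c |y|^(2 - a) - C\<close>, weighted by \<open>(1 + u)^(-2)\<close>, and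
Young's inequality bound \<open>V'\<close> by minus the weighted dissipation plus the data and the single supercritical
term \<open>\<integral> |w|^(\<alpha> + 4(1 - a))\<close>. The Sobolev inequality for \<open>|w|^((\<alpha> - a)/(2 - a))\<close>, interpolated with \<open>\<integral> |w|^\<alpha>\<close>, bounds that
term by the dissipation to the power \<open>\<theta> < 1\<close>, so it can be absorbed. What remains is \<open>V' \<le> C E V^(1 + \<gamma>)\<close>, that is,
\<open>V^(-\<gamma>) + \<gamma> C \<integral> E\<close> is nondecreasing.
\<close>

subsection \<open>Calculus on bounded open sets\<close>

text \<open>The rotation coefficient grows with \<open>u\<close>, so the coercivity constant of the
  flux degrades to b/K with K = \<kappa> (1 + u)^2; this is where the weight (1 + u)^(-2) comes
  from. Separating the source u^2 Z from the flux costs a factor K^(1 - a), and K^(1 - a) (\<kappa>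
  u^2)^(2 - a) |w|^(\<alpha> - 2) has coefficient \<kappa>^(3 - 2a) and degree 2(1 - a) + 2(2 - a) +
  \<alpha> - 2 = \<alpha> + 4(1 - a): this is the origin of the supercritical exponent. The Sobolev
  inequality knows no weight. Hoelder with exponent r < 1 trades the weight for the integral of (1 +
  u)^s with s = 2r/(1 - r), and s \<le> \<alpha> keeps that integral under the control of the energy
  and of \<Psi>. The price is the smaller Sobolev exponent q = r(2 - a). The surplus of the
  resulting integrability over \<alpha> is measured by D = \<alpha>(r(5 - a) - 3) - 3ar: r > 3/(5 -
  a) makes it grow with \<alpha>, and the second lower bound on \<alpha> says D > 12(1 - a)r, that
  is \<theta> < 1. Finally 1 + \<gamma> is the sum of the powers of V from the interpolation and
  from the weight integral.\<close>

lemma eventually_sgn_eq: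
  fixes s :: real
  assumes "s \<noteq> 0"
  shows "\<forall>\<^sub>F x in nhds s. sgn x = sgn s"
proof (cases "s > 0")
  case True
  then have "\<forall>\<^sub>F x in nhds s. x \<in> {0<..}" by (intro eventually_nhds_in_open) auto
  then show ?thesis by eventually_elim (use True in auto)
next
  case False
  then have "\<forall>\<^sub>F x in nhds s. x \<in> {..<0}" using assms by (intro eventually_nhds_in_open) auto
  then show ?thesis by eventually_elim (use False assms in auto)
qed

lemma has_real_derivative_abs:
  fixes s :: real
  assumes "s \<noteq> 0"
  shows "((\<lambda>s. \<bar>s\<bar>) has_real_derivative sgn s) (at s)"
proof -
  have "((\<lambda>x. sgn s * x) has_real_derivative sgn s) (at s)"
    by (auto intro!: derivative_eq_intros)
  moreover have "\<forall>\<^sub>F x in nhds s. \<bar>x\<bar> = sgn s * x"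
    using eventually_sgn_eq[OF assms] by eventually_elim (metis abs_sgn mult.commute)
  ultimately show ?thesis by (subst DERIV_cong_ev[OF refl _ refl])
qed

text \<open>At 0 the difference quotient has modulus |h|^(\<beta> - 1), which tends to 0 since
  \<beta> > 1; elsewhere the sign is locally constant and the chain rule applies. Serves both the
  energy density |w|^\<alpha> and the Sobolev function |w|^m.\<close>

lemma has_real_derivative_abs_powr:
  fixes s \<beta> :: real
  assumes "\<beta> > 1"
  shows "((\<lambda>s. \<bar>s\<bar> powr \<beta>) has_real_derivative \<beta> * (sgn s * \<bar>s\<bar> powr (\<beta> - 1))) (at s)"
proof (cases "s = 0")
  case True
  have "((\<lambda>h::real. \<bar>h\<bar> powr (\<beta> - 1)) \<longlongrightarrow> \<bar>0\<bar> powr (\<beta> - 1)) (at 0)"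
    by (intro tendsto_powr2 tendsto_intros) (use assms in auto)
  then have "((\<lambda>h::real. \<bar>\<bar>h\<bar> powr \<beta> / h\<bar>) \<longlongrightarrow> 0) (at 0)"
    by (rule tendsto_eq_rhs[OF Lim_transform_eventually])
      (auto simp: eventually_at_filter abs_mult powr_diff intro!: always_eventually)
  then have "((\<lambda>h::real. \<bar>h\<bar> powr \<beta> / h) \<longlongrightarrow> 0) (at 0)"
    by (rule tendsto_rabs_zero_cancel)
  then show ?thesis
    using True assms by (simp add: has_field_derivative_iff)
next
  case False
  from DERIV_fun_powr[OF has_real_derivative_abs[OF False], of \<beta>] False show ?thesis
    by (simp add: mult_ac)
qed

text \<open>This odd power is the test function. At 0 the sign cancels that of h, so the quotient is
  again |h|^(\<beta> - 1); elsewhere the two signs multiply to 1.\<close>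

lemma has_real_derivative_sgn_powr:
  fixes s \<beta> :: real
  assumes "\<beta> > 1"
  shows "((\<lambda>s. sgn s * \<bar>s\<bar> powr \<beta>) has_real_derivative \<beta> * \<bar>s\<bar> powr (\<beta> - 1)) (at s)"
proof (cases "s = 0")
  case True
  have "((\<lambda>h::real. \<bar>h\<bar> powr (\<beta> - 1)) \<longlongrightarrow> \<bar>0\<bar> powr (\<beta> - 1)) (at 0)"
    by (intro tendsto_powr2 tendsto_intros) (use assms in auto)
  then have "((\<lambda>h::real. sgn h * \<bar>h\<bar> powr \<beta> / h) \<longlongrightarrow> 0) (at 0)"
    by (rule tendsto_eq_rhs[OF Lim_transform_eventually])
      (auto simp: eventually_at_filter powr_diff sgn_real_def intro!: always_eventually)
  then show ?thesis
    using True assms by (simp add: has_field_derivative_iff)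
next
  case False
  from DERIV_fun_powr[OF has_real_derivative_abs[OF False], of \<beta>] False
  have 1: "((\<lambda>s. \<bar>s\<bar> powr \<beta>) has_real_derivative \<beta> * (sgn s * \<bar>s\<bar> powr (\<beta> - 1))) (at s)"
    by (simp add: mult_ac)
  have "((\<lambda>x. sgn s * \<bar>x\<bar> powr \<beta>) has_real_derivative sgn s * (\<beta> * (sgn s * \<bar>s\<bar> powr (\<beta> - 1)))) (at s)"
    by (rule DERIV_cmult[OF 1])
  moreover have "sgn s * (\<beta> * (sgn s * \<bar>s\<bar> powr (\<beta> - 1))) = \<beta> * \<bar>s\<bar> powr (\<beta> - 1)"
    using False by (auto simp: sgn_real_def)
  ultimately show ?thesis
    using eventually_sgn_eq[OF False] by (subst DERIV_cong_ev[OF refl _ refl, where g = "\<lambda>x. sgn s * \<bar>x\<bar> powr \<beta>"])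
      (auto elim: eventually_mono)
qed

lemma continuous_sgn_powr:
  fixes \<beta> :: real
  assumes "\<beta> > 0"
  shows "isCont (\<lambda>s::real. sgn s * \<bar>s\<bar> powr \<beta>) s"
proof -
  \<comment> \<open>Powers of the positive and negative parts are continuous separately, which
    removes the discontinuous factor \<open>sgn\<close>.\<close>
  have eq: "(\<lambda>s::real. sgn s * \<bar>s\<bar> powr \<beta>) = (\<lambda>s. max s 0 powr \<beta> - max (- s) 0 powr \<beta>)"
    by (auto simp: fun_eq_iff sgn_real_def max_def)
  show ?thesis unfolding eq
    unfolding isCont_def by (intro tendsto_intros tendsto_powr2) (use assms in auto)
qed

lemma continuous_on_compact_bound:
  fixes f :: "'a::topological_space \<Rightarrow> 'b::real_normed_vector"
  assumes "compact K" "continuous_on K f"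
  obtains L where "\<And>x. x \<in> K \<Longrightarrow> norm (f x) \<le> L"
  using compact_imp_bounded[OF compact_continuous_image[OF assms(2,1)]]
  unfolding bounded_iff by blast

lemma set_integrable_bounded_continuous:
  fixes f :: "'a::euclidean_space \<Rightarrow> real"
  assumes "open U" "bounded U" "continuous_on U f" "\<And>x. x \<in> U \<Longrightarrow> \<bar>f x\<bar> \<le> L"
  shows "set_integrable lborel U f"
proof -
  have fin: "emeasure lborel U < \<infinity>" by (rule emeasure_bounded_finite) fact
  have U: "U \<in> sets lborel" using assms(1) by simp
  have "set_integrable lborel U (\<lambda>x. L)"
    unfolding set_integrable_def using fin U by simp
  moreover have "set_borel_measurable lborel U f"
    using assms(1,3) set_measurable_continuous_on[of U f] by (simp add: set_borel_measurable_def set_measurable_continuous_on)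
  ultimately show ?thesis
    by (rule set_integrable_bound) (use assms(4) in fastforce)
qed

lemma set_integrable_continuous_closure:
  fixes f :: "'a::euclidean_space \<Rightarrow> real"
  assumes "open U" "bounded U" "continuous_on (closure U) f"
  shows "set_integrable lborel U f"
proof -
  have "compact (closure U)" using assms by (simp add: compact_closure)
  from continuous_on_compact_bound[OF this assms(3)]
  obtain L where "\<And>x. x \<in> closure U \<Longrightarrow> norm (f x) \<le> L" by blast
  then show ?thesis
    using assms closure_subset[of U]
    by (intro set_integrable_bounded_continuous[where L = L]) (auto intro: continuous_on_subset)
qed

section \<open>Integrals over U that depend on time\<close>

lemma continuous_on_set_integral:
  fixes f :: "'a::euclidean_space \<Rightarrow> real \<Rightarrow> real"
  assumes U: "open U" "bounded U" and I: "compact I"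
    and f: "continuous_on (closure U \<times> I) (\<lambda>(x, t). f x t)"
  shows "continuous_on I (\<lambda>t. LINT x:U|lborel. f x t)"
proof -
  have Ub: "U \<in> sets borel" using U by simp
  have "compact (closure U \<times> I)"
    using U I by (intro compact_Times) (auto simp: compact_closure)
  from continuous_on_compact_bound[OF this f]
  obtain L where "\<And>z. z \<in> closure U \<times> I \<Longrightarrow> norm (case z of (x, t) \<Rightarrow> f x t) \<le> L" by blast
  then have L: "\<And>x t. x \<in> closure U \<Longrightarrow> t \<in> I \<Longrightarrow> \<bar>f x t\<bar> \<le> L"
    by force
  have slice: "continuous_on (closure U) (\<lambda>x. f x t)" if "t \<in> I" for t
    by (rule continuous_on_compose2[OF f, of _ "\<lambda>x. (x, t)", simplified])
      (use that in \<open>auto intro!: continuous_intros\<close>)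
  have slice2: "continuous_on I (\<lambda>t. f x t)" if "x \<in> closure U" for x
    by (rule continuous_on_compose2[OF f, of _ "\<lambda>t. (x, t)", simplified])
      (use that in \<open>auto intro!: continuous_intros\<close>)
  have meas: "set_borel_measurable lborel U (\<lambda>x. f x t)" if "t \<in> I" for t
    using set_integrable_continuous_closure[OF U slice[OF that]]
    by (auto simp: set_integrable_def set_borel_measurable_def)
  show ?thesis
    unfolding continuous_on_sequentially
  proof (intro allI ballI impI)
    fix s t assume t: "t \<in> I" and s: "(\<forall>n. s n \<in> I) \<and> s \<longlonglongrightarrow> t"
    show "((\<lambda>t. LINT x:U|lborel. f x t) \<circ> s) \<longlonglongrightarrow> (LINT x:U|lborel. f x t)"
      unfolding set_lebesgue_integral_def o_def
    proof (rule integral_dominated_convergence[where w = "\<lambda>x. indicator U x * \<bar>L\<bar>"])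
      show "integrable lborel (\<lambda>x. indicator U x * \<bar>L\<bar>)"
        using emeasure_bounded_finite[OF U(2)] Ub by simp
      show "AE x in lborel. (\<lambda>n. indicator U x *\<^sub>R f x (s n)) \<longlonglongrightarrow> indicator U x *\<^sub>R f x t"
      proof (rule AE_I2)
        fix x
        show "(\<lambda>n. indicator U x *\<^sub>R f x (s n)) \<longlonglongrightarrow> indicator U x *\<^sub>R f x t"
        proof (cases "x \<in> U")
          case True
          then have "x \<in> closure U" using closure_subset by auto
          from slice2[OF this] have "(\<lambda>n. f x (s n)) \<longlonglongrightarrow> f x t"
            using s t by (auto simp: continuous_on_sequentially o_def)
          then show ?thesis by (intro tendsto_intros)
        qed simp
      qed
      show "AE x in lborel. norm (indicator U x *\<^sub>R f x (s n)) \<le> indicator U x * \<bar>L\<bar>" for n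
        using L[of _ "s n"] s closure_subset[of U] by (intro AE_I2) (fastforce simp: indicator_def)
    qed (use meas s t in \<open>auto simp: set_borel_measurable_def\<close>)
  qed
qed

text \<open>Dominated convergence for the difference quotients. Continuity of f' up to the compact
  set closure U x [a, b] bounds it by a constant, and the mean value inequality passes this constant
  on to all quotients; it is integrable because U is bounded.\<close>

lemma has_real_derivative_set_integral:
  fixes f f' :: "'a::euclidean_space \<Rightarrow> real \<Rightarrow> real"
  assumes U: "open U" "bounded U" and "a < t" "t < b"
    and f: "\<And>s. s \<in> {a..b} \<Longrightarrow> continuous_on (closure U) (\<lambda>x. f x s)"
    and f': "continuous_on (closure U \<times> {a..b}) (\<lambda>(x, s). f' x s)"
    and D: "\<And>x s. x \<in> U \<Longrightarrow> s \<in> {a..b} \<Longrightarrow> ((\<lambda>s. f x s) has_real_derivative f' x s) (at s)"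
  shows "((\<lambda>s. LINT x:U|lborel. f x s) has_real_derivative (LINT x:U|lborel. f' x t)) (at t)"
proof -
  have Ub: "U \<in> sets borel" using U by simp
  have "compact (closure U \<times> {a..b})"
    using U by (intro compact_Times) (auto simp: compact_closure)
  from continuous_on_compact_bound[OF this f']
  obtain L where "\<And>z. z \<in> closure U \<times> {a..b} \<Longrightarrow> norm (case z of (x, t) \<Rightarrow> f' x t) \<le> L" by blast
  then have L: "\<And>x t. x \<in> closure U \<Longrightarrow> t \<in> {a..b} \<Longrightarrow> \<bar>f' x t\<bar> \<le> L"
    by force
  have int: "set_integrable lborel U (\<lambda>x. f x s)" if "s \<in> {a..b}" for s
    using set_integrable_continuous_closure[OF U f[OF that]] .
  have int': "set_integrable lborel U (\<lambda>x. f' x t)"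
  proof (rule set_integrable_continuous_closure[OF U])
    show "continuous_on (closure U) (\<lambda>x. f' x t)"
      by (rule continuous_on_compose2[OF f', of _ "\<lambda>x. (x, t)", simplified])
        (use assms(3,4) in \<open>auto intro!: continuous_intros\<close>)
  qed
  have lip: "\<bar>f x r - f x t\<bar> \<le> L * \<bar>r - t\<bar>" if "x \<in> U" "r \<in> {a..b}" for x r
  proof -
    have "norm (f x r - f x t) \<le> L * norm (r - t)"
    proof (rule field_differentiable_bound[where S = "{a..b}" and f' = "f' x"])
      show "(f x has_field_derivative f' x z) (at z within {a..b})" if "z \<in> {a..b}" for z
        using D[OF \<open>x \<in> U\<close> that] by (rule has_field_derivative_at_within)
      show "norm (f' x z) \<le> L" if "z \<in> {a..b}" for z
        using L[of x z] that \<open>x \<in> U\<close> closure_subset[of U] by auto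
    qed (use that assms(3,4) in auto)
    then show ?thesis by simp
  qed
  let ?q = "\<lambda>r x. (f x r - f x t) / (r - t)"
  have "((\<lambda>r. LINT x:U|lborel. ?q r x) \<longlongrightarrow> (LINT x:U|lborel. f' x t)) (at t within {a..b})"
    unfolding tendsto_at_iff_sequentially
  proof (intro allI impI)
    fix s assume s: "\<forall>n. s n \<in> {a..b} - {t}" "s \<longlonglongrightarrow> t"
    show "((\<lambda>r. LINT x:U|lborel. ?q r x) \<circ> s) \<longlonglongrightarrow> (LINT x:U|lborel. f' x t)"
      unfolding set_lebesgue_integral_def o_def
    proof (rule integral_dominated_convergence[where w = "\<lambda>x. indicator U x * \<bar>L\<bar>"])
      show "integrable lborel (\<lambda>x. indicator U x * \<bar>L\<bar>)"
        using emeasure_bounded_finite[OF U(2)] Ub by simp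
      show "AE x in lborel. (\<lambda>n. indicator U x *\<^sub>R ?q (s n) x) \<longlonglongrightarrow> indicator U x *\<^sub>R f' x t"
      proof (rule AE_I2)
        fix x
        show "(\<lambda>n. indicator U x *\<^sub>R ?q (s n) x) \<longlonglongrightarrow> indicator U x *\<^sub>R f' x t"
        proof (cases "x \<in> U")
          case True
          have "((\<lambda>r. ?q r x) \<longlongrightarrow> f' x t) (at t)"
            using D[OF True, of t] assms(3,4) by (simp add: has_field_derivative_iff)
          then have "(\<lambda>n. ?q (s n) x) \<longlonglongrightarrow> f' x t"
            using s unfolding tendsto_at_iff_sequentially by (auto simp: o_def)
          then show ?thesis by (intro tendsto_intros)
        qed simp
      qed
      show "AE x in lborel. norm (indicator U x *\<^sub>R ?q (s n) x) \<le> indicator U x * \<bar>L\<bar>" for n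
      proof (rule AE_I2)
        fix x
        have "\<bar>?q (s n) x\<bar> \<le> \<bar>L\<bar>" if "x \<in> U"
          using lip[OF that, of "s n"] s(1)[rule_format, of n]
          by (simp add: abs_divide divide_le_eq) (smt (verit) mult_right_mono)
        then show "norm (indicator U x *\<^sub>R ?q (s n) x) \<le> indicator U x * \<bar>L\<bar>"
          by (auto simp: indicator_def)
      qed
      have "set_integrable lborel U (?q (s n))" for n
        using s(1) int[of "s n"] int[of t] assms(3,4) by (intro set_integrable_divide set_integral_diff) auto
      then show "(\<lambda>x. indicator U x *\<^sub>R ?q (s n) x) \<in> borel_measurable lborel" for n
        by (auto simp: set_integrable_def)
    qed (use int' in \<open>auto simp: set_integrable_def\<close>)
  qed
  moreover have "at t within {a..b} = at t"
    using assms(3,4) by (intro at_within_interior) auto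
  ultimately have lim: "((\<lambda>r. LINT x:U|lborel. ?q r x) \<longlongrightarrow> (LINT x:U|lborel. f' x t)) (at t)"
    by simp
  have "\<forall>\<^sub>F r in at t. (LINT x:U|lborel. ?q r x) = ((LINT x:U|lborel. f x r) - (LINT x:U|lborel. f x t)) / (r - t)"
  proof -
    have "\<forall>\<^sub>F r in at t. r \<in> {a<..<b}"
      using assms(3,4) by (intro eventually_at_in_open') auto
    then show ?thesis
      by eventually_elim (use int assms(3,4) in \<open>simp add: set_integral_diff\<close>)
  qed
  then show ?thesis
    unfolding has_field_derivative_iff by (rule iffD1[OF tendsto_cong lim])
qed

text \<open>The extension by zero is differentiable at a boundary point because \<open>f\<close> itself has derivative
  0 there; the integral of its difference quotients vanishes by translation invariance.\<close>
lemma integral_derivative_eq_0: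
  fixes f :: "'a::euclidean_space \<Rightarrow> real"
  assumes U: "open U" "bounded U" and S: "closure U \<subseteq> S"
    and f': "\<And>x. x \<in> S \<Longrightarrow> (f has_derivative blinfun_apply (f' x)) (at x)"
    and cont: "continuous_on S f'"
    and bd: "\<And>x. x \<in> frontier U \<Longrightarrow> f x = 0" "\<And>x. x \<in> frontier U \<Longrightarrow> f' x = 0"
  shows "(LINT x:U|lborel. f' x e) = 0"
proof -
  define F where "F x = (if x \<in> U then f x else 0)" for x
  define F' where "F' x = (if x \<in> U then f' x else 0)" for x
  have clos: "closure U = U \<union> frontier U" using U(1)
    by (auto simp: frontier_def interior_open) (use closure_subset in blast)
  have F': "(F has_derivative blinfun_apply (F' x)) (at x)" for x
  proof -
    consider "x \<in> U" | "x \<in> frontier U" | "x \<in> - closure U" using clos by blast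
    then show ?thesis
    proof cases
      case 1
      then have "(F has_derivative blinfun_apply (f' x)) (at x)"
        by (intro has_derivative_transform_within_open[OF f' U(1)])
          (use S closure_subset in \<open>auto simp: F_def\<close>)
      with 1 show ?thesis by (simp add: F'_def)
    next
      case 3
      have "(F has_derivative (\<lambda>_. 0)) (at x)"
        by (rule has_derivative_transform_within_open[OF has_derivative_const, of "- closure U"])
          (use 3 closure_subset in \<open>auto simp: F_def\<close>)
      with 3 show ?thesis using closure_subset by (auto simp: F'_def zero_blinfun.rep_eq)
    next
      case 2
      then have nU: "x \<notin> U" using U(1) by (auto simp: frontier_def interior_open)
      from f'[of x] 2 S bd have "(f has_derivative (\<lambda>_. 0)) (at x)"
        by (simp add: clos subset_iff zero_blinfun.rep_eq)
      then have *: "((\<lambda>y. \<bar>f y\<bar> / norm (y - x)) \<longlongrightarrow> 0) (at x)"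
        using bd(1)[OF 2] by (simp add: has_derivative_iff_norm)
      have "((\<lambda>y. \<bar>F y\<bar> / norm (y - x)) \<longlongrightarrow> 0) (at x)"
        by (rule tendsto_sandwich[OF _ _ tendsto_const *]) (auto simp: F_def)
      then have "(F has_derivative (\<lambda>_. 0)) (at x)"
        using nU by (simp add: has_derivative_iff_norm F_def[of x])
      with nU show ?thesis by (simp add: F'_def zero_blinfun.rep_eq)
    qed
  qed
  have "compact (closure U)" using U by (simp add: compact_closure)
  from continuous_on_compact_bound[OF this continuous_on_subset[OF cont S]]
  obtain L where L: "\<And>x. x \<in> closure U \<Longrightarrow> norm (f' x) \<le> L" by blast
  define L' where "L' = max L 0"
  have L': "norm (F' x) \<le> L'" for x
    using L[of x] closure_subset[of U] by (auto simp: F'_def L'_def)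
  \<comment> \<open>The mean value inequality needs a convex domain, and U may fail to be convex;
    the zero extension lives on the whole space, so the estimate is made for it.\<close>
  have lip: "\<bar>F x - F y\<bar> \<le> L' * norm (x - y)" for x y
    using differentiable_bound[of UNIV F "\<lambda>x. blinfun_apply (F' x)" L' x y] F' L'
    by (auto simp: norm_blinfun.rep_eq[symmetric])
  have contF: "continuous_on UNIV F"
    using F' by (intro has_derivative_continuous_on) (auto intro: has_derivative_at_withinI)
  have Fm: "F \<in> borel_measurable borel" using contF by (rule borel_measurable_continuous_onI)
  have Fi: "integrable lborel F"
  proof -
    have "set_integrable lborel U f"
      using S f' by (intro set_integrable_continuous_closure[OF U] has_derivative_continuous_on)
        (auto intro: has_derivative_at_withinI)
    moreover have "F = (\<lambda>x. indicator U x *\<^sub>R f x)" by (auto simp: F_def)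
    ultimately show ?thesis by (simp add: set_integrable_def)
  qed
  define h where "h n = 1 / real (Suc n)" for n
  have h: "0 < h n" "h n \<le> 1" for n by (auto simp: h_def)
  have h0: "h \<longlonglongrightarrow> 0" unfolding h_def using LIMSEQ_Suc[OF lim_1_over_n[where 'a = real]] by simp
  obtain R where R: "\<And>x. x \<in> U \<Longrightarrow> norm x \<le> R" using U(2) by (auto simp: bounded_iff)
  let ?q = "\<lambda>n x. (F (h n *\<^sub>R e + x) - F x) / h n"
  \<comment> \<open>A quotient is nonzero only if x or its translate lies in U. As the step is at
    most 1, this forces |x| \<le> R + |e|, so one ball carries the dominating function for all
    n.\<close>
  let ?w = "\<lambda>x. indicator (cball 0 (R + norm e)) x * (L' * norm e)"
  have "(\<lambda>n. integral\<^sup>L lborel (?q n)) \<longlonglongrightarrow> integral\<^sup>L lborel (\<lambda>x. F' x e)"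
  proof (rule integral_dominated_convergence[where w = ?w])
    show "integrable lborel ?w"
      using emeasure_bounded_finite[OF bounded_cball, of 0 "R + norm e"]
      by (intro integrable_mult_left integrable_real_indicator) auto
    show "AE x in lborel. (\<lambda>n. ?q n x) \<longlonglongrightarrow> F' x e"
    proof (rule AE_I2)
      fix x
      have "((\<lambda>s. s *\<^sub>R e + x) has_derivative (\<lambda>s. s *\<^sub>R e)) (at (0::real))"
        by (auto intro!: derivative_eq_intros)
      then have "((\<lambda>s. F (s *\<^sub>R e + x)) has_derivative (\<lambda>s. F' x (s *\<^sub>R e))) (at (0::real))"
        by (rule has_derivative_compose) (use F'[of x] in simp)
      then have "((\<lambda>s. F (s *\<^sub>R e + x)) has_real_derivative F' x e) (at 0)"
        by (simp add: has_field_derivative_def blinfun.scaleR_right mult.commute[of "blinfun_apply _ _"] mult_commute_abs)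
      then have lim: "((\<lambda>s. (F (s *\<^sub>R e + x) - F x) / s) \<longlongrightarrow> F' x e) (at 0)"
        by (simp add: has_field_derivative_iff)
      show "(\<lambda>n. ?q n x) \<longlonglongrightarrow> F' x e"
        using lim[unfolded tendsto_at_iff_sequentially o_def, rule_format, of h] h(1) h0
        by (simp add: less_imp_neq[symmetric])
    qed
    show "AE x in lborel. norm (?q n x) \<le> ?w x" for n
    proof (rule AE_I2)
      fix x
      show "norm (?q n x) \<le> ?w x"
      proof (cases "norm x \<le> R + norm e")
        case True
        have "\<bar>F (h n *\<^sub>R e + x) - F x\<bar> \<le> L' * norm e * h n"
          using lip[of "h n *\<^sub>R e + x" x] h[of n] by (simp add: mult_ac)
        with True h[of n] show ?thesis by (simp add: divide_le_eq)
      next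
        case False
        have "norm (h n *\<^sub>R e) \<le> norm e" using h[of n] by (simp add: mult_left_le_one_le)
        then have "\<not> norm (h n *\<^sub>R e + x) \<le> R"
          using False norm_triangle_ineq2[of x "- (h n *\<^sub>R e)"] by (simp add: add.commute)
        then have "h n *\<^sub>R e + x \<notin> U" using R by blast
        moreover have "x \<notin> U" using R[of x] False by auto (smt (verit) norm_ge_zero)
        ultimately show ?thesis using False by (simp add: F_def)
      qed
    qed
    have "set_integrable lborel U (\<lambda>x. f' x e)"
      by (intro set_integrable_continuous_closure[OF U] continuous_intros continuous_on_subset[OF cont S])
    moreover have "(\<lambda>x. F' x e) = (\<lambda>x. indicator U x *\<^sub>R f' x e)" by (auto simp: F'_def)
    ultimately show "(\<lambda>x. F' x e) \<in> borel_measurable lborel"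
      by (auto simp: set_integrable_def)
    show "?q n \<in> borel_measurable lborel" for n
      using Fm by measurable
  qed
  moreover have q0: "integral\<^sup>L lborel (?q n) = 0" for n
  proof -
    have "integral\<^sup>L lborel F = integral\<^sup>L (distr lborel borel ((+) (h n *\<^sub>R e))) F"
      by (simp add: lborel_distr_plus)
    also have "\<dots> = integral\<^sup>L lborel (\<lambda>x. F (h n *\<^sub>R e + x))"
      using Fm by (subst integral_distr) auto
    finally have eq: "integral\<^sup>L lborel (\<lambda>x. F (h n *\<^sub>R e + x)) = integral\<^sup>L lborel F" ..
    have "integrable (distr lborel borel ((+) (h n *\<^sub>R e))) F" using Fi by (simp add: lborel_distr_plus)
    then have "integrable lborel (\<lambda>x. F (h n *\<^sub>R e + x))"
      using Fm by (subst (asm) integrable_distr_eq) auto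
    with Fi eq show ?thesis by simp
  qed
  ultimately have "(\<lambda>n::nat. 0::real) \<longlonglongrightarrow> integral\<^sup>L lborel (\<lambda>x. F' x e)"
    by (simp only: q0)
  then have "integral\<^sup>L lborel (\<lambda>x. F' x e) = 0"
    by (simp add: LIMSEQ_const_iff)
  moreover have "(\<lambda>x. F' x e) = (\<lambda>x. indicator U x *\<^sub>R f' x e)" by (auto simp: F'_def)
  ultimately show ?thesis by (simp add: set_lebesgue_integral_def)
qed

subsection \<open>Elementary and integral inequalities\<close>

lemma Youngs_inequality_powr:
  fixes x y l :: real
  assumes "0 \<le> l" "l \<le> 1" "x \<ge> 0" "y \<ge> 0"
  shows "x powr l * y powr (1 - l) \<le> l * x + (1 - l) * y"
proof (cases "x = 0 \<or> y = 0")
  case True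
  then show ?thesis using assms by (elim disjE) (auto intro!: mult_nonneg_nonneg add_nonneg_nonneg)
next
  case False
  then show ?thesis using Youngs_inequality_0[of l "1 - l" x y] assms by simp
qed

text \<open>The larger of the two numbers dominates both factors. Compared with Young's inequality
  the constants are cruder, but no conjugate exponents appear and only the total degree i + j has to
  be tracked.\<close>

lemma powr_mult_le_add:
  fixes x y i j :: real
  assumes "x \<ge> 0" "y \<ge> 0" "i \<ge> 0" "j \<ge> 0"
  shows "x powr i * y powr j \<le> x powr (i + j) + y powr (i + j)"
proof (cases "x \<le> y")
  case True
  then have "x powr i * y powr j \<le> y powr i * y powr j"
    using assms by (intro mult_right_mono powr_mono2) auto
  then show ?thesis by (simp add: powr_add[symmetric]) (smt (verit) powr_ge_zero)
next
  case False
  then have "x powr i * y powr j \<le> x powr i * x powr j"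
    using assms by (intro mult_left_mono powr_mono2) auto
  then show ?thesis by (simp add: powr_add[symmetric]) (smt (verit) powr_ge_zero)
qed

lemma powr_mult3_le_add:
  fixes x y z i j k :: real
  assumes "x \<ge> 0" "y \<ge> 0" "z \<ge> 0" "i \<ge> 0" "j \<ge> 0" "k \<ge> 0"
  shows "x powr i * y powr j * z powr k \<le> x powr (i + j + k) + y powr (i + j + k) + z powr (i + j + k)"
proof -
  define m where "m = max x (max y z)"
  have "x powr i * y powr j * z powr k \<le> m powr i * m powr j * m powr k"
    using assms by (intro mult_mono powr_mono2 mult_nonneg_nonneg) (auto simp: m_def)
  also have "\<dots> = m powr (i + j + k)" by (simp add: powr_add)
  also have "\<dots> \<le> x powr (i + j + k) + y powr (i + j + k) + z powr (i + j + k)"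
    unfolding m_def max_def by (auto simp: add_nonneg_nonneg add_increasing add_increasing2)
  finally show ?thesis .
qed

text \<open>From x + y \<le> 2 max x y. The factor 2^s also covers 0 \<le> s < 1, where the
  convexity argument behind 2^(s - 1) does not apply.\<close>

lemma add_powr_le:
  fixes x y s :: real
  assumes "x \<ge> 0" "y \<ge> 0" "s \<ge> 0"
  shows "(x + y) powr s \<le> 2 powr s * (x powr s + y powr s)"
proof -
  have "(x + y) powr s \<le> (2 * max x y) powr s"
    using assms by (intro powr_mono2) auto
  also have "\<dots> = 2 powr s * max x y powr s" using assms by (simp add: powr_mult)
  also have "\<dots> \<le> 2 powr s * (x powr s + y powr s)"
    by (intro mult_left_mono) (auto simp: max_def)
  finally show ?thesis .
qed

lemma add_powr_le_convex:
  fixes x y s :: real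
  assumes "x \<ge> 0" "y \<ge> 0" "s \<ge> 1"
  shows "(x + y) powr s \<le> 2 powr (s - 1) * (x powr s + y powr s)"
proof (cases "x = 0 \<or> y = 0")
  case True
  have "1 \<le> 2 powr (s - 1)" using assms by (intro ge_one_powr_ge_zero) auto
  then have "z powr s \<le> 2 powr (s - 1) * z powr s" for z
    by (simp add: mult_le_cancel_right1)
  with True assms show ?thesis by auto
next
  case False
  then have "((1 - 1/2) *\<^sub>R x + (1/2) *\<^sub>R y) powr s \<le> (1 - 1/2) * x powr s + (1/2) * y powr s"
    using assms by (intro convex_onD[OF powr_convex]) auto
  moreover have "(1 - 1/2) *\<^sub>R x + (1/2) *\<^sub>R y = (x + y) / 2" by (simp add: field_simps)
  moreover have "((x + y) / 2) powr s = (x + y) powr s / 2 powr s" using assms by (simp add: powr_divide)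
  ultimately have "(x + y) powr s \<le> 2 powr s / 2 * (x powr s + y powr s)"
    by (simp add: field_simps)
  then show ?thesis by (simp add: powr_diff)
qed

text \<open>Integrate Young's inequality for the normalised functions. Normalising by A + d and B +
  d with d > 0 keeps the divisions meaningful when an integral vanishes; then d tends to 0.\<close>

lemma set_integral_Holder:
  fixes f g :: "'a \<Rightarrow> real"
  assumes f: "set_integrable M U f" "\<And>x. x \<in> U \<Longrightarrow> f x \<ge> 0"
    and g: "set_integrable M U g" "\<And>x. x \<in> U \<Longrightarrow> g x \<ge> 0"
    and l: "0 < l" "l < 1"
    and fg: "set_integrable M U (\<lambda>x. f x powr l * g x powr (1 - l))"
  shows "(LINT x:U|M. f x powr l * g x powr (1 - l)) \<le> (LINT x:U|M. f x) powr l * (LINT x:U|M. g x) powr (1 - l)"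
proof -
  define A where "A = (LINT x:U|M. f x)"
  define B where "B = (LINT x:U|M. g x)"
  have AB: "A \<ge> 0" "B \<ge> 0"
    using f(2) g(2) unfolding A_def B_def set_lebesgue_integral_def
    by (auto intro!: integral_nonneg_AE AE_I2 simp: indicator_def)
  have bd: "(LINT x:U|M. f x powr l * g x powr (1 - l)) \<le> (A + d) powr l * (B + d) powr (1 - l)"
    if d: "d > 0" for d
  proof -
    let ?c = "(A + d) powr l * (B + d) powr (1 - l)"
    have "(LINT x:U|M. f x powr l * g x powr (1 - l))
        \<le> (LINT x:U|M. ?c * (l / (A + d) * f x + (1 - l) / (B + d) * g x))"
    proof (rule set_integral_mono)
      fix x assume x: "x \<in> U"
      have "(f x / (A + d)) powr l * (g x / (B + d)) powr (1 - l)
          \<le> l * (f x / (A + d)) + (1 - l) * (g x / (B + d))"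
        using l AB d f(2)[OF x] g(2)[OF x] by (intro Youngs_inequality_powr) auto
      moreover have "f x powr l * g x powr (1 - l) = ?c * ((f x / (A + d)) powr l * (g x / (B + d)) powr (1 - l))"
        using AB d f(2)[OF x] g(2)[OF x] by (simp add: powr_divide)
      ultimately show "f x powr l * g x powr (1 - l) \<le> ?c * (l / (A + d) * f x + (1 - l) / (B + d) * g x)"
        by (simp add: mult_left_mono)
    qed (use f g fg in \<open>auto intro!: set_integral_add\<close>)
    also have "\<dots> = ?c * (l * (A / (A + d)) + (1 - l) * (B / (B + d)))"
      using f g by (simp add: set_integral_add A_def B_def)
    also have "\<dots> \<le> ?c * (l * 1 + (1 - l) * 1)"
      using AB d l by (intro mult_left_mono add_mono) auto
    finally show ?thesis by simp
  qed
  have "((\<lambda>d. (A + d) powr l * (B + d) powr (1 - l)) \<longlongrightarrow> (A + 0) powr l * (B + 0) powr (1 - l)) (at_right 0)"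
    using l AB by (intro tendsto_intros tendsto_powr2) (auto simp: eventually_at_filter intro!: always_eventually)
  then have "(LINT x:U|M. f x powr l * g x powr (1 - l)) \<le> (A + 0) powr l * (B + 0) powr (1 - l)"
    by (rule tendsto_lowerbound)
      (use bd in \<open>auto simp: eventually_at_filter intro!: always_eventually\<close>)
  then show ?thesis by (simp add: A_def B_def)
qed

text \<open>Read Y as the gradient of w and Z as all remaining contributions to the argument of the
  flux. Writing X \<bullet> Y as X \<bullet> (Y + Z) - X \<bullet> Z, half of the coercive term
  absorbs X \<bullet> Z, and the other half is converted from |Y + Z| back to |Y|, which leaves the
  coefficient b/4.\<close>

lemma flux_dissipation_bound:
  fixes X Y Z :: "'a::real_inner"
  assumes a: "0 < a" "a < 1" and K: "K \<ge> 1" and b: "b > 0" and c: "c > 0"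
    and upper: "norm X \<le> c * norm (Y + Z) powr (1 - a)"
    and lower: "X \<bullet> (Y + Z) \<ge> b / K * (norm (Y + Z) powr (2 - a) - 1/4)"
    and S: "norm Z \<le> S"
  shows "- (X \<bullet> Y) \<le> - (b/4) / K * norm Y powr (2 - a) + (b/4) / K
     + (c * (2 * c * K / b) powr (1 - a) + b / (2 * K)) * S powr (2 - a)"
proof -
  define F where "F = norm (Y + Z)"
  have F0: "F \<ge> 0" and S0: "S \<ge> 0" using S by (auto simp: F_def intro: order_trans[OF norm_ge_zero])
  have pw: "x powr (1 - a) * x = x powr (2 - a)" if "x \<ge> 0" for x :: real
    using that powr_add[of x "1 - a" 1] by (simp add: powr_one_gt_zero_iff)
  have "X \<bullet> Z \<le> norm X * norm Z" by (rule norm_cauchy_schwarz)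
  also have "\<dots> \<le> (c * F powr (1 - a)) * S"
    using upper S c by (intro mult_mono) (auto simp: F_def)
  finally have XZ: "X \<bullet> Z \<le> c * F powr (1 - a) * S" .
  \<comment> \<open>Young's inequality by cases: the threshold for S is the one below which the
    product is at most b/(2K) F^(2 - a). Above it, F \<le> (2cK/b) S, which produces the constant
    (2cK/b)^(1 - a).\<close>
  have Yg: "c * F powr (1 - a) * S \<le> b / (2 * K) * F powr (2 - a) + c * (2 * c * K / b) powr (1 - a) * S powr (2 - a)"
  proof (cases "S \<le> b / (2 * c * K) * F")
    case True
    then have "c * F powr (1 - a) * S \<le> c * F powr (1 - a) * (b / (2 * c * K) * F)"
      using c by (intro mult_left_mono) auto
    also have "\<dots> = b / (2 * K) * (F powr (1 - a) * F)" using c by (simp add: field_simps)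
    also have "\<dots> = b / (2 * K) * F powr (2 - a)" using pw[OF F0] by simp
    finally show ?thesis using c by (simp add: add_increasing2)
  next
    case False
    then have "F \<le> 2 * c * K / b * S" using b c K by (simp add: field_simps)
    then have "F powr (1 - a) \<le> (2 * c * K / b * S) powr (1 - a)"
      using a F0 by (intro powr_mono2) auto
    also have "\<dots> = (2 * c * K / b) powr (1 - a) * S powr (1 - a)"
      by (rule powr_mult)
    finally have "c * F powr (1 - a) * S \<le> c * ((2 * c * K / b) powr (1 - a) * S powr (1 - a)) * S"
      using c S0 by (intro mult_right_mono mult_left_mono) auto
    also have "\<dots> = c * (2 * c * K / b) powr (1 - a) * S powr (2 - a)"
      using pw[OF S0] by (simp add: mult_ac)
    finally show ?thesis using b K by (simp add: add_increasing)
  qed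
  have "norm Y \<le> F + S" using S norm_triangle_ineq4[of "Y + Z" Z] by (simp add: F_def)
  then have "norm Y powr (2 - a) \<le> (F + S) powr (2 - a)"
    using a by (intro powr_mono2) auto
  also have "\<dots> \<le> 2 powr (2 - a - 1) * (F powr (2 - a) + S powr (2 - a))"
    using a F0 S0 by (intro add_powr_le_convex) auto
  also have "\<dots> \<le> 2 powr 1 * (F powr (2 - a) + S powr (2 - a))"
    using a by (intro mult_right_mono powr_mono) auto
  finally have "norm Y powr (2 - a) / 2 - S powr (2 - a) \<le> F powr (2 - a)" by simp
  then have "b / (2 * K) * (norm Y powr (2 - a) / 2 - S powr (2 - a)) \<le> b / (2 * K) * F powr (2 - a)"
    using b K by (intro mult_left_mono) auto
  moreover have "- (X \<bullet> Y) \<le> - (b / K * (F powr (2 - a) - 1/4)) + X \<bullet> Z"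
    using lower by (simp add: F_def inner_add_right)
  moreover have "b / K * F powr (2 - a) = 2 * (b / (2 * K) * F powr (2 - a))" using K by simp
  ultimately have "- (X \<bullet> Y) \<le> b / K / 4 - b / (2 * K) * (norm Y powr (2 - a) / 2 - S powr (2 - a))
      + c * (2 * c * K / b) powr (1 - a) * S powr (2 - a)"
    using XZ Yg by (simp add: right_diff_distrib)
  also have "\<dots> = - (b/4) / K * norm Y powr (2 - a) + (b/4) / K
     + (c * (2 * c * K / b) powr (1 - a) + b / (2 * K)) * S powr (2 - a)"
    using K by (simp add: field_simps)
  finally show ?thesis .
qed

text \<open>Here \<open>w\<close>, \<open>\<psi>\<close>, \<open>H\<close> and \<open>T\<close>
  stand for |u - \<Psi>|, |\<Psi>|, |grad \<Psi>| and |\<Psi>_t|. Every product is a monomial of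
  degree at most p when H counts as degree 2, so it splits into p-th powers, with H appearing as
  H^(p/2); lower degrees are filled up by factors that are at least 1. The T term is rescaled
  separately and yields T^(p/(5 - 4a)). Powers of \<kappa> are raised to 3 - 2a where needed, since
  \<kappa> \<ge> 1.\<close>

lemma source_terms_bound:
  fixes a \<alpha> \<kappa> u w \<psi> H T b c C11 C12 C13 M :: real
  assumes a: "0 < a" "a < 1" and \<alpha>: "\<alpha> > 3" and chi: "\<kappa> \<ge> 1"
    and nonneg: "u \<ge> 0" "w \<ge> 0" "\<psi> \<ge> 0" "H \<ge> 0" "T \<ge> 0" and u: "u \<le> w + \<psi>"
    and b: "0 < b" "b \<le> 1" and c: "c > 0"
    and C12: "C12 = 2 * 4 powr (1 - a) * c * (1 + (32 * c / b) powr (1 - a))"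
    and C11: "C11 \<ge> 8 powr (1 - a) * b / 2 + b / 4"
    and C13: "C13 \<ge> 3 * C12 + 2 * C11 + 1"
    and M: "M \<ge> 1" "M \<ge> 2 * C11" "M \<ge> 4 * C12 + C11"
  defines "K \<equiv> \<kappa> * (1 + u)\<^sup>2" and "p \<equiv> \<alpha> + 4 * (1 - a)"
  shows "((c * (2 * c * K / b) powr (1 - a) + b / (2 * K)) * (\<kappa> * u\<^sup>2 + H) powr (2 - a) + (b/4) / K) * w powr (\<alpha> - 2)
       + T * w powr (\<alpha> - 1) / (\<alpha> - 1)
    \<le> C13 * \<kappa> powr (3 - 2 * a) * w powr p
      + M * \<kappa> powr (3 - 2 * a) * (2 powr (p - 1) * \<psi> powr p + 2 powr (p - 1) + 1 / 2)
      + M / 4 * w powr \<alpha>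
      + M * 2 powr (p / 2 - 1) * \<kappa> powr (1 - a) * H powr (p / 2)
      + M * \<kappa> powr (- (3 - 2 * a) * (\<alpha> - 1) / (5 - 4 * a)) * T powr (p / (5 - 4 * a))"
proof -
  define e where "e = 1 - a"
  have e: "0 < e" "e < 1" "a = 1 - e" using a by (auto simp: e_def)
  have p: "p = \<alpha> + 4 * e" by (simp add: p_def e_def)
  \<comment> \<open>With this shift 1 + u \<le> w + P and P \<ge> 1, so exponents of P may be raised
    freely to reach the full degree p.\<close>
  define P where "P = 1 + \<psi>"
  have P: "P \<ge> 1" "P \<ge> 0" using nonneg by (auto simp: P_def)
  define Wp Pp h where "Wp = w powr p" and "Pp = P powr p" and "h = H powr (p/2)"
  have Wp0: "Wp \<ge> 0" and Pp1: "Pp \<ge> 1" and h0: "h \<ge> 0"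
    using P p e \<alpha> by (auto simp: Wp_def Pp_def h_def intro!: ge_one_powr_ge_zero)
  define X1 X3 where "X1 = \<kappa> powr e" and "X3 = \<kappa> powr (1 + 2 * e)"
  have X1: "X1 \<ge> 1" using chi e by (simp add: X1_def ge_one_powr_ge_zero)
  have X13: "X1 \<le> X3" using chi e by (simp add: X1_def X3_def powr_mono)
  have X3: "X3 \<ge> 1" using X1 X13 by simp
  have uP: "1 + u \<le> w + P" using u by (simp add: P_def)
  have K1: "K \<ge> 1" unfolding K_def
    using mult_mono[of 1 \<kappa> 1 "(1 + u)\<^sup>2"] one_le_power[of "1 + u" 2] chi nonneg by simp
  define G1 G2 \<Theta> where "G1 = 8 powr e * b / 2" and "G2 = b * 2 powr e / 2" and "\<Theta> = c * (32 * c / b) powr e"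
  have \<Theta>0: "\<Theta> \<ge> 0" using c by (simp add: \<Theta>_def)
  have G2: "0 \<le> G2" "G2 \<le> b"
  proof -
    have "2 powr e \<le> 2 powr (1::real)" using e by (intro powr_mono) auto
    then have "2 powr e \<le> 2" by simp
    from mult_left_mono[OF this, of b] show "G2 \<le> b" using b by (simp add: G2_def)
  qed (use b in \<open>simp add: G2_def\<close>)
  have G1: "0 \<le> G1" "G1 + b / 4 \<le> C11" using b C11 by (auto simp: G1_def e_def)
  have c12_ge: "2 * 4 powr e * \<Theta> \<le> C12" "0 \<le> C12"
    using c by (auto simp: C12 \<Theta>_def e_def algebra_simps)
  have Ke: "K powr e = X1 * (1 + u) powr (2 * e)"
    using chi nonneg by (simp add: K_def X1_def powr_mult powr_powr powr_numeral[symmetric] del: powr_numeral)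
  have KS: "(2 * c * K / b) powr e = (2 * c / b) powr e * K powr e"
    by (simp add: powr_mult[symmetric] mult_ac)
  \<comment> \<open>The 32 in the constants is 2 from the Young step times 16, the latter from
    splitting (w + P)^(2 + 4e).\<close>
  have D1: "c * (2 * c / b) powr e * 16 powr e = \<Theta>"
    by (simp add: \<Theta>_def powr_mult[symmetric] mult_ac)
  have S: "(\<kappa> * u\<^sup>2 + H) powr (1 + e) \<le> 2 powr e * (\<kappa> powr (1 + e) * u powr (2 * (1 + e)) + H powr (1 + e))"
  proof -
    have "(\<kappa> * u\<^sup>2 + H) powr (1 + e) \<le> 2 powr (1 + e - 1) * ((\<kappa> * u\<^sup>2) powr (1 + e) + H powr (1 + e))"
      using chi nonneg e by (intro add_powr_le_convex) auto
    also have "(\<kappa> * u\<^sup>2) powr (1 + e) = \<kappa> powr (1 + e) * u powr (2 * (1 + e))"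
      using nonneg by (cases "u = 0") (auto simp: powr_mult powr_powr powr_numeral[symmetric] simp del: powr_numeral)
    finally show ?thesis by simp
  qed
  have prod6: "(w + P) powr (2 + 4 * e) * w powr (\<alpha> - 2) \<le> 2 * 16 powr e * (2 * Wp + Pp)"
  proof -
    have "(w + P) powr (2 + 4 * e) \<le> 2 powr (2 + 4 * e - 1) * (w powr (2 + 4 * e) + P powr (2 + 4 * e))"
      using nonneg P e by (intro add_powr_le_convex) auto
    also have "2 powr (2 + 4 * e - 1) = 2 * 16 powr e"
      using powr_powr[of 2 4 e] by (simp add: powr_add algebra_simps)
    finally have "(w + P) powr (2 + 4 * e) * w powr (\<alpha> - 2)
        \<le> 2 * 16 powr e * (w powr (2 + 4 * e) + P powr (2 + 4 * e)) * w powr (\<alpha> - 2)"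
      by (intro mult_right_mono) auto
    also have "\<dots> = 2 * 16 powr e * (Wp + w powr (\<alpha> - 2) * P powr (2 + 4 * e))"
      by (simp add: algebra_simps Wp_def p powr_add[symmetric])
    also have "w powr (\<alpha> - 2) * P powr (2 + 4 * e) \<le> Wp + Pp"
      using powr_mult_le_add[of w P "\<alpha> - 2" "2 + 4 * e"] nonneg P \<alpha> e by (simp add: Wp_def Pp_def p)
    finally show ?thesis by (simp add: algebra_simps)
  qed
  have add2e: "(w + P) powr (2 * e) \<le> 4 powr e * (w powr (2 * e) + P powr (2 * e))"
    using add_powr_le[of w P "2 * e"] powr_powr[of 2 2 e] nonneg P e by simp
  have prod2: "(w + P) powr (2 * e) * w powr (\<alpha> - 2) \<le> 4 powr e * (2 * Wp + Pp + 1)"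
  proof -
    have "(w + P) powr (2 * e) * w powr (\<alpha> - 2) \<le> 4 powr e * (w powr (2 * e) + P powr (2 * e)) * w powr (\<alpha> - 2)"
      using add2e by (intro mult_right_mono) auto
    also have "\<dots> = 4 powr e * (w powr (\<alpha> - 2 + 2 * e) + w powr (\<alpha> - 2) * P powr (2 * e))"
      by (simp add: algebra_simps powr_add[symmetric])
    also have "\<dots> \<le> 4 powr e * ((Wp + 1) + (Wp + Pp))"
    proof (intro mult_left_mono add_mono)
      show "w powr (\<alpha> - 2 + 2 * e) \<le> Wp + 1"
        using powr_mult_le_add[of w 1 "\<alpha> - 2 + 2 * e" "2 + 2 * e"] nonneg \<alpha> e
        by (simp add: Wp_def p algebra_simps)
      have "w powr (\<alpha> - 2) * P powr (2 * e) \<le> w powr (\<alpha> - 2) * P powr (2 + 4 * e)"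
        using P e by (intro mult_left_mono powr_mono) auto
      also have "\<dots> \<le> Wp + Pp"
        using powr_mult_le_add[of w P "\<alpha> - 2" "2 + 4 * e"] nonneg P \<alpha> e by (simp add: Wp_def Pp_def p)
      finally show "w powr (\<alpha> - 2) * P powr (2 * e) \<le> Wp + Pp" .
    qed auto
    finally show ?thesis by (simp add: algebra_simps)
  qed
  \<comment> \<open>The square root of H is the variable of degree 1: the gradient of \<Psi> stands
    next to \<kappa> u^2, so it counts as two powers of u.\<close>
  have H: "H powr (1 + e) = (H powr (1/2)) powr (2 * (1 + e))" "h = (H powr (1/2)) powr p"
    by (simp_all add: powr_powr h_def add_divide_distrib)
  have prodH: "(w + P) powr (2 * e) * H powr (1 + e) * w powr (\<alpha> - 2) \<le> 4 powr e * (2 * Wp + 2 * h + Pp)"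
  proof -
    have "(w + P) powr (2 * e) * H powr (1 + e) * w powr (\<alpha> - 2)
        \<le> 4 powr e * (w powr (2 * e) + P powr (2 * e)) * H powr (1 + e) * w powr (\<alpha> - 2)"
      using add2e by (intro mult_right_mono) auto
    also have "\<dots> = 4 powr e * (w powr (\<alpha> - 2 + 2 * e) * H powr (1 + e) + w powr (\<alpha> - 2) * H powr (1 + e) * P powr (2 * e))"
      unfolding powr_add[of w "\<alpha> - 2" "2 * e"] by (simp add: algebra_simps)
    also have "\<dots> \<le> 4 powr e * ((Wp + h) + (Wp + h + Pp))"
    proof (intro mult_left_mono add_mono)
      show "w powr (\<alpha> - 2 + 2 * e) * H powr (1 + e) \<le> Wp + h"
        using powr_mult_le_add[of w "H powr (1/2)" "\<alpha> - 2 + 2 * e" "2 * (1 + e)"] nonneg \<alpha> e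
        unfolding H by (simp add: Wp_def p algebra_simps)
      show "w powr (\<alpha> - 2) * H powr (1 + e) * P powr (2 * e) \<le> Wp + h + Pp"
        using powr_mult3_le_add[of w "H powr (1/2)" P "\<alpha> - 2" "2 * (1 + e)" "2 * e"] nonneg \<alpha> e P
        unfolding H by (simp add: Wp_def Pp_def p algebra_simps)
    qed auto
    finally show ?thesis by (simp add: algebra_simps)
  qed
  have wH: "H powr (1 + e) * w powr (\<alpha> - 2) \<le> Wp + h + 1"
    using powr_mult3_le_add[of w "H powr (1/2)" 1 "\<alpha> - 2" "2 * (1 + e)" "2 * e"] nonneg \<alpha> e
    unfolding H by (simp add: Wp_def p algebra_simps)
  have umono: "(1 + u) powr s \<le> (w + P) powr s" if "s \<ge> 0" for s
    using uP nonneg that by (intro powr_mono2) auto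
  have L1a: "(c * (2 * c * K / b) powr e) * (2 powr e * (\<kappa> powr (1 + e) * u powr (2 * (1 + e)))) * w powr (\<alpha> - 2)
     \<le> C12 * X3 * (2 * Wp + Pp)"
  proof -
    have "u powr (2 * (1 + e)) \<le> (1 + u) powr (2 * (1 + e))"
      using nonneg e by (intro powr_mono2) auto
    then have "(c * (2 * c * K / b) powr e) * (2 powr e * (\<kappa> powr (1 + e) * u powr (2 * (1 + e)))) * w powr (\<alpha> - 2)
       \<le> (c * (2 * c * K / b) powr e) * (2 powr e * (\<kappa> powr (1 + e) * (1 + u) powr (2 * (1 + e)))) * w powr (\<alpha> - 2)"
      using c by (intro mult_right_mono mult_left_mono) auto
    also have "\<dots> = c * (2 * c / b) powr e * 2 powr e * (\<kappa> powr (1 + e) * X1)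
        * (((1 + u) powr (2 * (1 + e)) * (1 + u) powr (2 * e)) * w powr (\<alpha> - 2))"
      unfolding KS Ke by (simp only: mult_ac)
    also have "\<dots> = c * (2 * c / b) powr e * 2 powr e * X3 * ((1 + u) powr (2 + 4 * e) * w powr (\<alpha> - 2))"
      unfolding X1_def X3_def powr_add[symmetric] by (simp add: algebra_simps)
    also have "\<dots> \<le> c * (2 * c / b) powr e * 2 powr e * X3 * (2 * 16 powr e * (2 * Wp + Pp))"
    proof (intro mult_left_mono)
      have "(1 + u) powr (2 + 4 * e) * w powr (\<alpha> - 2) \<le> (w + P) powr (2 + 4 * e) * w powr (\<alpha> - 2)"
        using e by (intro mult_right_mono umono) auto
      with prod6 show "(1 + u) powr (2 + 4 * e) * w powr (\<alpha> - 2) \<le> 2 * 16 powr e * (2 * Wp + Pp)"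
        by linarith
    qed (use c X3 in auto)
    also have "\<dots> = (2 * 2 powr e * \<Theta>) * X3 * (2 * Wp + Pp)"
      unfolding D1[symmetric] by (simp add: algebra_simps)
    also have "\<dots> \<le> (2 * 4 powr e * \<Theta>) * X3 * (2 * Wp + Pp)"
      using \<Theta>0 X3 Wp0 Pp1 e by (intro mult_right_mono mult_left_mono powr_mono2) auto
    also have "\<dots> \<le> C12 * X3 * (2 * Wp + Pp)"
      using c12_ge X3 Wp0 Pp1 by (intro mult_right_mono) auto
    finally show ?thesis .
  qed
  have L1b: "(c * (2 * c * K / b) powr e) * (2 powr e * H powr (1 + e)) * w powr (\<alpha> - 2)
     \<le> C12 / 2 * X1 * (2 * Wp + 2 * h + Pp)"
  proof -
    have "(c * (2 * c * K / b) powr e) * (2 powr e * H powr (1 + e)) * w powr (\<alpha> - 2)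
       = c * (2 * c / b) powr e * 2 powr e * X1 * ((1 + u) powr (2 * e) * H powr (1 + e) * w powr (\<alpha> - 2))"
      unfolding KS Ke by (simp add: algebra_simps)
    also have "\<dots> \<le> c * (2 * c / b) powr e * 2 powr e * X1 * (4 powr e * (2 * Wp + 2 * h + Pp))"
    proof (intro mult_left_mono)
      have "(1 + u) powr (2 * e) * H powr (1 + e) * w powr (\<alpha> - 2)
          \<le> (w + P) powr (2 * e) * H powr (1 + e) * w powr (\<alpha> - 2)"
        using e by (intro mult_right_mono umono) auto
      with prodH show "(1 + u) powr (2 * e) * H powr (1 + e) * w powr (\<alpha> - 2)
          \<le> 4 powr e * (2 * Wp + 2 * h + Pp)" by linarith
    qed (use c X1 in auto)
    also have "\<dots> = (c * (2 * c / b) powr e * (2 powr e * 4 powr e)) * X1 * (2 * Wp + 2 * h + Pp)"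
      by (simp add: algebra_simps)
    also have "\<dots> \<le> (c * (2 * c / b) powr e * (4 powr e * 16 powr e)) * X1 * (2 * Wp + 2 * h + Pp)"
      using c X1 Wp0 Pp1 h0 e by (intro mult_right_mono mult_left_mono mult_mono powr_mono2) auto
    also have "\<dots> = (4 powr e * \<Theta>) * X1 * (2 * Wp + 2 * h + Pp)"
      unfolding D1[symmetric] by (simp add: algebra_simps)
    also have "\<dots> \<le> C12 / 2 * X1 * (2 * Wp + 2 * h + Pp)"
      using c12_ge X1 Wp0 Pp1 h0 by (intro mult_right_mono) auto
    finally show ?thesis .
  qed
  have L2a: "b / (2 * K) * (2 powr e * (\<kappa> powr (1 + e) * u powr (2 * (1 + e)))) * w powr (\<alpha> - 2)
     \<le> G1 * X1 * (2 * Wp + Pp + 1)"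
  proof -
    have "u powr (2 * (1 + e)) \<le> (1 + u) powr (2 * (1 + e))"
      using nonneg e by (intro powr_mono2) auto
    then have "b / (2 * K) * (2 powr e * (\<kappa> powr (1 + e) * u powr (2 * (1 + e)))) * w powr (\<alpha> - 2)
       \<le> b / (2 * K) * (2 powr e * (\<kappa> powr (1 + e) * (1 + u) powr (2 * (1 + e)))) * w powr (\<alpha> - 2)"
      using b K1 by (intro mult_right_mono mult_left_mono) auto
    \<comment> \<open>The division by K cancels one factor \<kappa> and the square of 1 + u, so this
      term is of lower order than the one with K^(1 - a).\<close>
    also have "\<dots> = b / 2 * 2 powr e * X1 * ((1 + u) powr (2 * e) * w powr (\<alpha> - 2))"
    proof -
      have "\<kappa> powr (1 + e) = \<kappa> * X1" using chi by (simp add: X1_def powr_add)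
      moreover have "(1 + u) powr (2 * (1 + e)) = (1 + u)\<^sup>2 * (1 + u) powr (2 * e)"
        using nonneg by (simp add: distrib_left powr_add)
      ultimately have "\<kappa> powr (1 + e) * (1 + u) powr (2 * (1 + e)) = K * (X1 * (1 + u) powr (2 * e))"
        by (simp only: K_def mult_ac)
      moreover have "b / (2 * K) * (t * (K * (X1 * z))) * v = b / 2 * t * X1 * (z * v)" for t z v
        using K1 by (simp add: field_simps)
      ultimately show ?thesis by (simp only:)
    qed
    also have "\<dots> \<le> b / 2 * 2 powr e * X1 * (4 powr e * (2 * Wp + Pp + 1))"
    proof (intro mult_left_mono)
      have "(1 + u) powr (2 * e) * w powr (\<alpha> - 2) \<le> (w + P) powr (2 * e) * w powr (\<alpha> - 2)"
        using e by (intro mult_right_mono umono) auto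
      with prod2 show "(1 + u) powr (2 * e) * w powr (\<alpha> - 2) \<le> 4 powr e * (2 * Wp + Pp + 1)" by linarith
    qed (use b X1 in auto)
    also have "\<dots> = G1 * X1 * (2 * Wp + Pp + 1)"
      using powr_mult[of 2 4 e] by (simp add: G1_def)
    finally show ?thesis .
  qed
  have L2b: "b / (2 * K) * (2 powr e * H powr (1 + e)) * w powr (\<alpha> - 2) \<le> G2 * (Wp + h + 1)"
  proof -
    have "b / (2 * K) * (2 powr e * H powr (1 + e)) * w powr (\<alpha> - 2)
      = (b * 2 powr e / 2) / K * (H powr (1 + e) * w powr (\<alpha> - 2))" by simp
    also have "\<dots> \<le> (b * 2 powr e / 2) / 1 * (Wp + h + 1)"
      using b K1 wH by (intro mult_mono divide_left_mono) auto
    finally show ?thesis by (simp add: G2_def)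
  qed
  have L3: "(b/4) / K * w powr (\<alpha> - 2) \<le> b / 4 * (1 + w powr \<alpha>)"
  proof -
    have "w powr (\<alpha> - 2) \<le> w powr \<alpha> + 1"
      using powr_mult_le_add[of w 1 "\<alpha> - 2" 2] nonneg \<alpha> by simp
    then have "(b/4) / K * w powr (\<alpha> - 2) \<le> (b/4) / 1 * (w powr \<alpha> + 1)"
      using b K1 by (intro mult_mono divide_left_mono) auto
    then show ?thesis by (simp add: add.commute)
  qed
  define q where "q = 1 + 4 * e"
  have q: "q > 0" "p = (\<alpha> - 1) + q" using e by (auto simp: q_def p)
  define Tt where "Tt = \<kappa> powr (- (1 + 2 * e) * (\<alpha> - 1) / q) * T powr (p / q)"
  have Tt0: "Tt \<ge> 0" by (simp add: Tt_def)
  have p0: "p > 0" using p \<alpha> e by simp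
  have LT: "T * w powr (\<alpha> - 1) / (\<alpha> - 1) \<le> (X3 * Wp + Tt) / 2"
  proof -
    \<comment> \<open>The powers of \<kappa> in A and B are chosen so that A^p carries the same
      \<kappa>^(1 + 2e) as the supercritical term and so that they cancel in A^(\<alpha> - 1) B^q.
      The compensating negative power in B is the weight of the \<Psi>_t integral in
      \<open>Efun\<close>.\<close>
    define A where "A = \<kappa> powr ((1 + 2 * e) / p) * w"
    define B where "B = T powr (1 / q) * \<kappa> powr (- (1 + 2 * e) * (\<alpha> - 1) / (p * q))"
    have "A powr (\<alpha> - 1) * B powr q \<le> A powr p + B powr p"
      using powr_mult_le_add[of A B "\<alpha> - 1" q] nonneg \<alpha> q by (simp add: A_def B_def)
    moreover have "A powr p = X3 * Wp"
      using p0 by (simp add: A_def X3_def Wp_def powr_mult powr_powr)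
    moreover have "B powr p = Tt"
      using p0 by (simp add: B_def Tt_def powr_mult powr_powr)
    moreover have "A powr (\<alpha> - 1) * B powr q = T * w powr (\<alpha> - 1)"
    proof -
      have "\<kappa> powr ((1 + 2 * e) / p * (\<alpha> - 1)) * \<kappa> powr (- (1 + 2 * e) * (\<alpha> - 1) / (p * q) * q) = 1"
      proof -
        have "(1 + 2 * e) / p * (\<alpha> - 1) + - (1 + 2 * e) * (\<alpha> - 1) / (p * q) * q = 0"
          using q(1) p0 by (simp add: field_simps)
        then show ?thesis using chi unfolding powr_add[symmetric] by simp
      qed
      moreover have "A powr (\<alpha> - 1) * B powr q = (T powr (1 / q)) powr q * w powr (\<alpha> - 1) *
          (\<kappa> powr ((1 + 2 * e) / p * (\<alpha> - 1)) * \<kappa> powr (- (1 + 2 * e) * (\<alpha> - 1) / (p * q) * q))"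
        by (simp add: A_def B_def powr_mult powr_powr mult_ac)
      moreover have "(T powr (1 / q)) powr q = T" using q(1) nonneg by (simp add: powr_powr)
      ultimately show ?thesis by simp
    qed
    ultimately have "T * w powr (\<alpha> - 1) \<le> X3 * Wp + Tt" by simp
    moreover have "T * w powr (\<alpha> - 1) / (\<alpha> - 1) \<le> T * w powr (\<alpha> - 1) / 2"
      using \<alpha> nonneg by (intro divide_left_mono) auto
    ultimately show ?thesis by simp
  qed
  have Pp: "Pp \<le> 2 powr (p - 1) * (1 + \<psi> powr p)"
    using add_powr_le_convex[of 1 \<psi> p] nonneg p \<alpha> e by (simp add: Pp_def P_def)
  have two: "4 \<le> 2 powr (p - 1)" "5 / 4 \<le> 2 powr (p / 2 - 1)"
  proof -
    have "2 powr 2 \<le> (2::real) powr (p - 1)" using p \<alpha> e by (intro powr_mono) auto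
    then show "4 \<le> 2 powr (p - 1)" by simp
    have "2 powr (1/2) \<le> (2::real) powr (p / 2 - 1)" using p \<alpha> e by (intro powr_mono) auto
    moreover have "5 / 4 \<le> (2::real) powr (1/2)"
      using real_le_rsqrt[of "5/4" 2] by (simp add: powr_half_sqrt power2_eq_square)
    ultimately show "5 / 4 \<le> 2 powr (p / 2 - 1)" by linarith
  qed
  have "((c * (2 * c * K / b) powr e + b / (2 * K)) * (\<kappa> * u\<^sup>2 + H) powr (1 + e) + (b/4) / K) * w powr (\<alpha> - 2)
     \<le> ((c * (2 * c * K / b) powr e + b / (2 * K)) *
        (2 powr e * (\<kappa> powr (1 + e) * u powr (2 * (1 + e)) + H powr (1 + e))) + (b/4) / K) * w powr (\<alpha> - 2)"
    using b c K1 by (intro mult_right_mono add_mono mult_left_mono S) auto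
  also have "\<dots> \<le> C12 * X3 * (2 * Wp + Pp) + C12 / 2 * X1 * (2 * Wp + 2 * h + Pp) + G1 * X1 * (2 * Wp + Pp + 1)
     + G2 * (Wp + h + 1) + b / 4 * (1 + w powr \<alpha>)"
  proof -
    have "((A + B) * (t * (y + z)) + Q) * v = A * (t * y) * v + A * (t * z) * v + B * (t * y) * v + B * (t * z) * v + Q * v"
      for A B t y z Q v :: real by algebra
    then show ?thesis using L1a L1b L2a L2b L3 by (simp only:)
  qed
  also have "\<dots> \<le> C12 * X3 * (2 * Wp + Pp) + (C12 * X3 * Wp + C12 * X1 * h + C12 / 2 * X3 * Pp) + G1 * X3 * (2 * Wp + Pp + 1)
     + (G2 * X3 * Wp + G2 * X1 * h + G2 * X3) + b / 4 * (X3 + w powr \<alpha>)"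
  proof -
    have "C12 / 2 * X1 * (2 * Wp + Pp) \<le> C12 / 2 * X3 * (2 * Wp + Pp)"
      using c12_ge X13 Wp0 Pp1 by (intro mult_right_mono mult_left_mono) auto
    moreover have "G1 * X1 * (2 * Wp + Pp + 1) \<le> G1 * X3 * (2 * Wp + Pp + 1)"
      using G1 X13 Wp0 Pp1 by (intro mult_right_mono mult_left_mono) auto
    moreover have "G2 * 1 * Wp \<le> G2 * X3 * Wp" "G2 * 1 * h \<le> G2 * X1 * h" "G2 * 1 \<le> G2 * X3"
      using G2 X3 X1 Wp0 h0 by (intro mult_right_mono mult_left_mono; simp)+
    moreover have "b / 4 * (1 + w powr \<alpha>) \<le> b / 4 * (X3 + w powr \<alpha>)"
      using b X3 by (intro mult_left_mono) auto
    moreover have "C12 / 2 * X1 * (2 * Wp + 2 * h + Pp) = C12 / 2 * X1 * (2 * Wp + Pp) + C12 * X1 * h"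
      "C12 / 2 * X3 * (2 * Wp + Pp) = C12 * X3 * Wp + C12 / 2 * X3 * Pp"
      "G2 * (Wp + h + 1) = G2 * 1 * Wp + G2 * 1 * h + G2 * 1"
      by (simp_all add: field_simps)
    ultimately show ?thesis by linarith
  qed
  also have "\<dots> = (3 * C12 + 2 * G1 + G2) * (X3 * Wp) + X3 * ((C12 * 3 / 2 + G1) * Pp + G1 + G2 + b / 4)
     + (C12 + G2) * (X1 * h) + b / 4 * w powr \<alpha>"
    by (simp add: field_simps)
  finally have main: "((c * (2 * c * K / b) powr e + b / (2 * K)) * (\<kappa> * u\<^sup>2 + H) powr (1 + e) + (b/4) / K) * w powr (\<alpha> - 2)
     \<le> (3 * C12 + 2 * G1 + G2) * (X3 * Wp) + X3 * ((C12 * 3 / 2 + G1) * Pp + G1 + G2 + b / 4)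
     + (C12 + G2) * (X1 * h) + b / 4 * w powr \<alpha>" .
  have r1: "(3 * C12 + 2 * G1 + G2) * (X3 * Wp) + X3 * Wp / 2 \<le> C13 * (X3 * Wp)"
  proof -
    have "3 * C12 + 2 * G1 + G2 + 1 / 2 \<le> C13" using G1 G2 C13 b by linarith
    then have "(3 * C12 + 2 * G1 + G2 + 1 / 2) * (X3 * Wp) \<le> C13 * (X3 * Wp)"
      using X3 Wp0 by (intro mult_right_mono) auto
    then show ?thesis by (simp add: algebra_simps)
  qed
  have r2: "(C12 * 3 / 2 + G1) * Pp + G1 + G2 + b / 4 \<le> M * (2 powr (p - 1) * \<psi> powr p + 2 powr (p - 1) + 1 / 2)"
  proof -
    \<comment> \<open>The b/4 withheld from M is multiplied by at least 4 and so pays for G2 \<le>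
      b; the remaining G1 + b/4 \<le> C11 \<le> M/2 is the summand 1/2 of the claim.\<close>
    have "(C12 * 3 / 2 + G1) * Pp \<le> (M - b / 4) * (2 powr (p - 1) * (1 + \<psi> powr p))"
      using Pp c12_ge G1 M Pp1 b by (intro mult_mono) auto
    also have "\<dots> = M * (2 powr (p - 1) * \<psi> powr p + 2 powr (p - 1))
        - b / 4 * (2 powr (p - 1) * (1 + \<psi> powr p))"
      by (simp add: algebra_simps)
    also have "\<dots> \<le> M * (2 powr (p - 1) * \<psi> powr p + 2 powr (p - 1)) - b"
    proof -
      have "4 * 1 \<le> 2 powr (p - 1) * (1 + \<psi> powr p)" using two by (intro mult_mono) auto
      then have "b / 4 * 4 \<le> b / 4 * (2 powr (p - 1) * (1 + \<psi> powr p))"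
        using b by (intro mult_left_mono) auto
      then show ?thesis by simp
    qed
    finally show ?thesis using G1 G2 M by (simp add: algebra_simps)
  qed
  have r3: "(C12 + G2) * (X1 * h) \<le> M * 2 powr (p / 2 - 1) * (X1 * h)"
  proof (intro mult_right_mono)
    \<comment> \<open>A quarter of M covers C12 and a whole M covers G2 \<le> b \<le> 1. The total
      5/4 fits because p > 3 gives 2^(p/2 - 1) \<ge> sqrt 2.\<close>
    have "C12 + G2 \<le> M * (5 / 4)" using c12_ge(2) G1 G2 M b by linarith
    also have "\<dots> \<le> M * 2 powr (p / 2 - 1)" using two(2) M(1) by (intro mult_left_mono) linarith+
    finally show "C12 + G2 \<le> M * 2 powr (p / 2 - 1)" .
  qed (use X1 h0 in auto)
  have r4: "b / 4 * w powr \<alpha> \<le> M / 4 * w powr \<alpha>" using b M by (intro mult_right_mono) auto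
  have r5: "Tt / 2 \<le> M * Tt" using mult_right_mono[OF M(1) Tt0] Tt0 by linarith
  have r2': "X3 * ((C12 * 3 / 2 + G1) * Pp + G1 + G2 + b / 4)
      \<le> M * (X3 * (2 powr (p - 1) * \<psi> powr p + 2 powr (p - 1) + 1 / 2))"
    unfolding mult.left_commute[of M] by (rule mult_left_mono[OF r2]) (use X3 in linarith)
  have fin: "((c * (2 * c * K / b) powr e + b / (2 * K)) * (\<kappa> * u\<^sup>2 + H) powr (1 + e) + (b/4) / K) * w powr (\<alpha> - 2)
       + T * w powr (\<alpha> - 1) / (\<alpha> - 1)
     \<le> C13 * (X3 * Wp) + M * (X3 * (2 powr (p - 1) * \<psi> powr p + 2 powr (p - 1) + 1 / 2)) + M / 4 * w powr \<alpha>
      + M * 2 powr (p / 2 - 1) * (X1 * h) + M * Tt"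
  proof -
    have "A + B \<le> S1 + S2 + S3 + S4 + S5"
      if "A \<le> s1 + s2 + s3 + s4" "B \<le> (x + t) / 2" "s1 + x / 2 \<le> S1" "s2 \<le> S2" "s3 \<le> S4" "s4 \<le> S3" "t / 2 \<le> S5"
      for A B s1 s2 s3 s4 x t S1 S2 S3 S4 S5 :: real
    proof -
      have "A + B \<le> (s1 + x / 2) + s2 + s3 + s4 + t / 2" using that(1,2) by (simp add: add_divide_distrib)
      also have "\<dots> \<le> S1 + S2 + S4 + S3 + S5" using that(3-7) by (intro add_mono)
      finally show ?thesis by simp
    qed
    from this[OF main LT r1 r2' r3 r4 r5] show ?thesis .
  qed
  have subst: "2 - a = 1 + e" "1 - a = e" "3 - 2 * a = 1 + 2 * e" "5 - 4 * a = q"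
    by (auto simp: e_def q_def)
  show ?thesis
    using fin unfolding subst X1_def X3_def Wp_def h_def Tt_def by (simp only: mult.assoc)
qed

subsection \<open>The nonlinear flux\<close>

lemma continuous_on_gfun:
  assumes "\<And>i. i \<in> {1..N} \<Longrightarrow> alb i > 0"
  shows "continuous_on {0..} (gfun N alb ac)"
proof -
  have "continuous_on {0..} (\<lambda>s::real. s powr alb i)" if "i \<in> {1..N}" for i
    using assms[OF that] by (intro continuous_on_powr' continuous_intros) auto
  then have "continuous_on {0..} (\<lambda>s::real. ac 0 + (\<Sum>i\<in>{1..N}. ac i * s powr alb i))"
    by (intro continuous_on_add continuous_on_const continuous_on_sum continuous_on_mult)
  then show ?thesis by (simp add: gfun_def[abs_def])
qed

lemma gfun_ge:
  assumes "\<And>i. i \<le> N \<Longrightarrow> ac i > 0"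
  shows "gfun N alb ac s \<ge> ac 0" and "N \<ge> 1 \<Longrightarrow> gfun N alb ac s \<ge> ac N * s powr alb N"
proof -
  have nn: "0 \<le> ac i * s powr alb i" if "i \<in> {1..N}" for i
    using assms[of i] that by simp
  then have "0 \<le> (\<Sum>i\<in>{1..N}. ac i * s powr alb i)" by (rule sum_nonneg)
  then show "gfun N alb ac s \<ge> ac 0" by (simp add: gfun_def)
  assume N: "N \<ge> 1"
  then have "ac N * s powr alb N \<le> (\<Sum>i\<in>{1..N}. ac i * s powr alb i)"
    using nn by (intro member_le_sum) auto
  then show "gfun N alb ac s \<ge> ac N * s powr alb N" using assms[of 0] by (simp add: gfun_def)
qed

lemma gfun_le:
  assumes "\<And>i. i \<le> N \<Longrightarrow> ac i > 0" "\<And>i. i \<in> {1..N} \<Longrightarrow> alb i > 0" "\<And>i. i \<in> {1..N} \<Longrightarrow> alb i \<le> alb N"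
    and "s \<ge> 0"
  shows "s \<le> 1 \<Longrightarrow> gfun N alb ac s \<le> chi0 N ac"
    and "s \<ge> 1 \<Longrightarrow> alb N \<ge> 0 \<Longrightarrow> gfun N alb ac s \<le> chi0 N ac * s powr alb N"
proof -
  have chi0: "chi0 N ac = ac 0 + (\<Sum>i\<in>{1..N}. ac i)"
    by (simp add: chi0_def sum.atLeast_Suc_atMost[of 0] atMost_atLeast0)
  show "gfun N alb ac s \<le> chi0 N ac" if "s \<le> 1"
  proof -
    have "ac i * s powr alb i \<le> ac i * 1" if "i \<in> {1..N}" for i
      using assms(1)[of i] assms(2)[OF that] that \<open>s \<le> 1\<close> assms(4)
      by (intro mult_left_mono powr_le1) auto
    then show ?thesis unfolding gfun_def chi0 by (intro add_left_mono sum_mono) auto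
  qed
  show "gfun N alb ac s \<le> chi0 N ac * s powr alb N" if s: "s \<ge> 1" and N: "alb N \<ge> 0"
  proof -
    have "ac i * s powr alb i \<le> ac i * s powr alb N" if "i \<in> {1..N}" for i
      using assms(1)[of i] assms(3)[OF that] that s
      by (intro mult_left_mono powr_mono) auto
    then have "(\<Sum>i\<in>{1..N}. ac i * s powr alb i) \<le> (\<Sum>i\<in>{1..N}. ac i * s powr alb N)"
      by (intro sum_mono) auto
    moreover have "ac 0 * 1 \<le> ac 0 * s powr alb N"
      using assms(1)[of 0] s N by (intro mult_left_mono ge_one_powr_ge_zero) auto
    ultimately show ?thesis unfolding gfun_def chi0
      by (simp add: distrib_right sum_distrib_right)
  qed
qed

text \<open>J v is orthogonal to v, so the rotation does not contribute to the work. It weakens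
  coercivity only indirectly, by making the argument y = F(v) larger than g(|v|)|v|.\<close>

lemma Fmap_inner: "v \<bullet> Fmap N alb ac k z v = gfun N alb ac (norm v) * (norm v)\<^sup>2"
  by (simp add: Fmap_def Jop_def inner_add_right dot_cross_self power2_norm_eq_inner)

lemma norm_Jop_le:
  assumes "norm k = 1"
  shows "norm (Jop k v) \<le> norm v"
proof (rule power2_le_imp_le)
  have "(norm (Jop k v))\<^sup>2 + (k \<bullet> v)\<^sup>2 = (norm v)\<^sup>2"
    using norm_cross_dot[of k v] assms by (simp add: Jop_def)
  then show "(norm (Jop k v))\<^sup>2 \<le> (norm v)\<^sup>2"
    using zero_le_power2[of "k \<bullet> v"] by linarith
qed simp

text \<open>For a frozen value G of g the map is linear and explicitly invertible, so it remains to
  match G with g(|v|), a scalar equation solved by the intermediate value theorem. Surjectivity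
  makes \<open>inv\<close> a right inverse, so that \<open>Xmap\<close> really solves F(X) =
  y.\<close>

lemma surj_Fmap:
  assumes ac: "\<And>i. i \<le> N \<Longrightarrow> ac i > 0" and alb: "\<And>i. i \<in> {1..N} \<Longrightarrow> alb i > 0" and k: "norm k = 1"
  shows "surj (Fmap N alb ac k z)"
  unfolding surj_def
proof
  fix y :: "real^3"
  let ?g = "gfun N alb ac"
  \<comment> \<open>Along k the operator G + zJ is multiplication by G; on the orthogonal plane J is
    a quarter turn, so the inverse there is (G - zJ)/(G^2 + z^2), as for complex numbers.\<close>
  define v where "v G = (1 / G) *\<^sub>R ((k \<bullet> y) *\<^sub>R k)
      + (1 / (G\<^sup>2 + z\<^sup>2)) *\<^sub>R (G *\<^sub>R (y - (k \<bullet> y) *\<^sub>R k) - z *\<^sub>R Jop k y)" for G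
  have JJ: "Jop k (Jop k y) = (k \<bullet> y) *\<^sub>R k - y"
    using k Lagrange[of k k y] by (simp add: Jop_def norm_eq_1)
  have Jlin: "Jop k (b + c) = Jop k b + Jop k c" "Jop k (b - c) = Jop k b - Jop k c" "Jop k (s *\<^sub>R b) = s *\<^sub>R Jop k b"
    "Jop k k = 0" for b c s
    by (simp_all add: Jop_def cross_add_right Cross3.right_diff_distrib cross_mult_right)
  have eq: "G *\<^sub>R v G + z *\<^sub>R Jop k (v G) = y" if G: "G > 0" for G
  proof -
    define D where "D = G\<^sup>2 + z\<^sup>2"
    have D: "D > 0" using G by (simp add: D_def add_pos_nonneg)
    have "G *\<^sub>R v G + z *\<^sub>R Jop k (v G) = (k \<bullet> y) *\<^sub>R k + (1 / D) *\<^sub>R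
       (G\<^sup>2 *\<^sub>R (y - (k \<bullet> y) *\<^sub>R k) - (G * z) *\<^sub>R Jop k y + (G * z) *\<^sub>R Jop k y
         - z\<^sup>2 *\<^sub>R ((k \<bullet> y) *\<^sub>R k - y))"
      using G unfolding v_def D_def[symmetric]
      by (simp add: Jlin JJ scaleR_add_right scaleR_diff_right power2_eq_square mult_ac)
    also have "\<dots> = (k \<bullet> y) *\<^sub>R k + (1 / D) *\<^sub>R (D *\<^sub>R (y - (k \<bullet> y) *\<^sub>R k))"
    proof -
      have "G\<^sup>2 *\<^sub>R (y - (k \<bullet> y) *\<^sub>R k) - (G * z) *\<^sub>R Jop k y + (G * z) *\<^sub>R Jop k y
         - z\<^sup>2 *\<^sub>R ((k \<bullet> y) *\<^sub>R k - y) = D *\<^sub>R (y - (k \<bullet> y) *\<^sub>R k)"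
        by (simp add: D_def algebra_simps)
      then show ?thesis by (simp only:)
    qed
    also have "\<dots> = y" using D by simp
    finally show ?thesis .
  qed
  have g0: "?g s > 0" "?g s \<ge> ac 0" for s 
    using gfun_ge(1)[where N = N and ac = ac and alb = alb and s = s, OF ac] ac[of 0] by auto
  have bound: "norm (v G) \<le> norm y / G" if G: "G > 0" for G
  proof -
    have "G * (norm (v G))\<^sup>2 = v G \<bullet> y"
      using arg_cong[OF eq[OF G], of "\<lambda>w. v G \<bullet> w"]
      by (simp add: inner_add_right Jop_def dot_cross_self power2_norm_eq_inner)
    also have "\<dots> \<le> norm (v G) * norm y" by (rule norm_cauchy_schwarz)
    finally have "norm (v G) * (G * norm (v G)) \<le> norm (v G) * norm y"
      by (simp add: power2_eq_square mult_ac)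
    then have "G * norm (v G) \<le> norm y" by (cases "v G = 0") auto
    then show ?thesis using G by (simp add: field_simps)
  qed
  define R where "R = norm y / ac 0"
  have R: "R \<ge> 0" using ac[of 0] by (simp add: R_def)
  have contg: "continuous_on {0..R} ?g"
    using continuous_on_gfun[OF alb] by (rule continuous_on_subset) auto
  have "\<exists>s\<ge>0. s \<le> R \<and> s - norm (v (?g s)) = 0"
  proof (rule IVT')
    show "0 - norm (v (?g 0)) \<le> 0" by simp
    have "norm (v (?g R)) \<le> norm y / ?g R" using bound g0 by blast
    also have "\<dots> \<le> R" unfolding R_def using g0 ac[of 0] by (intro divide_left_mono) auto
    finally show "0 \<le> R - norm (v (?g R))" by simp
    have nz: "?g s \<noteq> 0" "(?g s)\<^sup>2 + z\<^sup>2 \<noteq> 0" for s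
      using g0(1)[of s] by (auto simp: add_nonneg_eq_0_iff)
    show "continuous_on {0..R} (\<lambda>s. s - norm (v (?g s)))"
      unfolding v_def using nz by (intro continuous_intros contg) auto
  qed (use R in auto)
  then obtain s where s: "s \<ge> 0" "norm (v (?g s)) = s" by auto
  have "Fmap N alb ac k z (v (?g s)) = y"
    using eq[OF g0(1)[of s]] s by (simp add: Fmap_def)
  then show "\<exists>x. y = Fmap N alb ac k z x" by metis
qed

text \<open>Write n = |X|. Everything follows from X \<bullet> y = g(n) n^2 and g(n) n \<le> |y|
  \<le> (g(n) + Z) n. With d = \<open>alb N\<close>, the term of degree d in g gives |y| \<ge>
  \<open>ac N\<close> n^(1 + d), and 1/(1 + d) = 1 - a. For coercivity g is compared with a constant
  when n \<le> 1 and with n^d when n > 1; in the first case only |y|^2 is controlled, and passing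
  from it to |y|^(2 - a) costs the 1/4.\<close>

lemma Xmap_bounds:
  fixes N alb ac k Rs z y
  defines "a \<equiv> aexp N alb" and "X \<equiv> Xmap N alb ac Rs k z y"
  assumes N: "N \<ge> 1" and ac: "\<And>i. i \<le> N \<Longrightarrow> ac i > 0"
    and alb: "\<And>i. i \<in> {1..N} \<Longrightarrow> alb i > 0" "\<And>i. i \<in> {1..N} \<Longrightarrow> alb i \<le> alb N" and k: "norm k = 1"
    and K: "K \<ge> 1" "(chi0 N ac + \<bar>Rs * z\<bar>)\<^sup>2 \<le> K"
    and b: "0 < b" "b \<le> ac 0" "b \<le> ac N"
  shows "norm X \<le> c3 a (ac N) * norm y powr (1 - a)"
    and "X \<bullet> y \<ge> b / K * (norm y powr (2 - a) - 1 / 4)"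
proof -
  define d where "d = alb N"
  have d: "d > 0" using alb(1)[of N] N by (simp add: d_def)
  have a: "a = d / (1 + d)" by (simp add: a_def aexp_def d_def)
  have a01: "0 < a" "a < 1" using d by (auto simp: a)
  have a1: "(1 + d) * (1 - a) = 1" "(1 + d) * (2 - a) = 2 + d" using d by (auto simp: a field_simps)
  define n G Z where "n = norm X" and "G = gfun N alb ac (norm X)" and "Z = \<bar>Rs * z\<bar>"
  have n0: "n \<ge> 0" and Z0: "Z \<ge> 0" by (auto simp: n_def Z_def)
  have FX: "Fmap N alb ac k (Rs * z) X = y"
    unfolding X_def Xmap_def by (rule surj_f_inv_f[OF surj_Fmap[OF ac alb(1) k]])
  have inner: "X \<bullet> y = G * n\<^sup>2"
    using Fmap_inner[of X N alb ac k "Rs * z"] FX by (simp add: G_def n_def)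
  have Gge: "G \<ge> ac 0" "G \<ge> ac N * n powr d"
    using gfun_ge[where N = N and ac = ac and alb = alb and s = n, OF ac] N by (auto simp: G_def n_def d_def)
  have "norm y \<le> G * n + Z * norm (Jop k X)"
    using norm_triangle_ineq[of "G *\<^sub>R X" "(Rs * z) *\<^sub>R Jop k X"] FX Gge(1) ac[of 0]
    by (simp add: Fmap_def G_def n_def Z_def)
  also have "\<dots> \<le> G * n + Z * n" using norm_Jop_le[OF k, of X] Z0 by (simp add: n_def mult_left_mono)
  finally have yle: "norm y \<le> (G + Z) * n" by (simp add: distrib_right)
  have yge: "G * n \<le> norm y"
  proof (cases "n = 0")
    case False
    have "n * (G * n) \<le> n * norm y"
      using norm_cauchy_schwarz[of X y] inner by (simp add: n_def power2_eq_square mult_ac)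
    then show ?thesis using False n0 by simp
  qed simp
  have nd: "n powr d * n = n powr (1 + d)" using n0 by (simp add: powr_add)
  have "ac N * n powr (1 + d) \<le> norm y"
  proof -
    have "ac N * n powr d * n \<le> G * n" using Gge n0 by (intro mult_right_mono) auto
    with yge nd show ?thesis by (simp only: mult.assoc)
  qed
  then have "(n powr (1 + d)) powr (1 - a) \<le> (norm y / ac N) powr (1 - a)"
    using ac[of N] a01 by (intro powr_mono2) (auto simp: field_simps)
  then have "n \<le> (norm y / ac N) powr (1 - a)"
    using n0 by (simp add: powr_powr a1)
  also have "\<dots> = c3 a (ac N) * norm y powr (1 - a)"
    using ac[of N] powr_minus[of "ac N" "1 - a"] by (simp add: c3_def powr_divide field_simps)
  finally show "norm X \<le> c3 a (ac N) * norm y powr (1 - a)" by (simp add: n_def)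
  have chi0: "chi0 N ac \<ge> 0" unfolding chi0_def using ac by (intro sum_nonneg) (auto intro: less_imp_le)
  show "X \<bullet> y \<ge> b / K * (norm y powr (2 - a) - 1 / 4)"
  proof (cases "n \<le> 1")
    case True
    then have "G \<le> chi0 N ac"
      using gfun_le(1)[where N = N and ac = ac and alb = alb and s = n, OF ac alb] n0 by (simp add: G_def n_def)
    then have "norm y \<le> (chi0 N ac + Z) * n"
      using yle n0 by (meson add_right_mono mult_right_mono order_trans)
    then have "(norm y)\<^sup>2 \<le> (chi0 N ac + Z)\<^sup>2 * n\<^sup>2"
      by (metis norm_ge_zero power_mono power_mult_distrib)
    also have "\<dots> \<le> K * n\<^sup>2" using K by (intro mult_right_mono) (auto simp: Z_def)
    finally have y2: "(norm y)\<^sup>2 \<le> K * n\<^sup>2" .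
    \<comment> \<open>\<open>r powr (2 - a) - r\<^sup>2 \<le> a (r - r\<^sup>2) \<le> a / 4\<close> by Young's inequality\<close>
    have "norm y powr (2 - a) \<le> (norm y)\<^sup>2 + 1 / 4"
    proof -
      define r where "r = norm y"
      have r0: "r \<ge> 0" by (simp add: r_def)
      have "r powr (2 - a) = r powr a * (r\<^sup>2) powr (1 - a)"
      proof (cases "r = 0")
        case False
        then have "(r\<^sup>2) powr (1 - a) = r powr (2 * (1 - a))"
          using r0 powr_powr[of r 2 "1 - a"] by simp
        then show ?thesis by (simp add: powr_add[symmetric] algebra_simps)
      qed (use a01 in simp)
      also have "\<dots> \<le> a * r + (1 - a) * r\<^sup>2" using a01 r0 by (intro Youngs_inequality_powr) auto
      also have "\<dots> \<le> r\<^sup>2 + 1 / 4"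
      proof -
        have "r - r\<^sup>2 \<le> 1 / 4" using zero_le_power2[of "r - 1/2"] by (simp add: power2_eq_square algebra_simps)
        then have "a * (r - r\<^sup>2) \<le> a * (1 / 4)" using a01 by (intro mult_left_mono) auto
        also have "\<dots> \<le> 1 / 4" using a01 by simp
        finally show ?thesis by (simp add: algebra_simps)
      qed
      finally show ?thesis by (simp add: r_def)
    qed
    then have "b / K * (norm y powr (2 - a) - 1 / 4) \<le> b / K * (norm y)\<^sup>2"
      using b K by (intro mult_left_mono) auto
    also have "\<dots> \<le> b / K * (K * n\<^sup>2)" using y2 b K by (intro mult_left_mono) auto
    also have "\<dots> = b * n\<^sup>2" using K by simp
    also have "\<dots> \<le> G * n\<^sup>2" using b Gge by (intro mult_right_mono) auto
    finally show ?thesis using inner by simp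
  next
    case False
    then have "G \<le> chi0 N ac * n powr d"
      using gfun_le(2)[where N = N and ac = ac and alb = alb and s = n, OF ac alb] n0 d by (simp add: G_def n_def d_def)
    moreover have "Z * 1 \<le> Z * n powr d"
      using False d Z0 by (intro mult_left_mono ge_one_powr_ge_zero) auto
    ultimately have "G + Z \<le> (chi0 N ac + Z) * n powr d" by (simp add: distrib_right)
    then have "(G + Z) * n \<le> (chi0 N ac + Z) * n powr d * n" using n0 by (rule mult_right_mono)
    then have y1: "norm y \<le> (chi0 N ac + Z) * n powr (1 + d)"
      using yle unfolding mult.assoc nd by linarith
    have "norm y powr (2 - a) \<le> ((chi0 N ac + Z) * n powr (1 + d)) powr (2 - a)"
      using y1 a01 by (intro powr_mono2) auto
    also have "\<dots> = (chi0 N ac + Z) powr (2 - a) * n powr (2 + d)"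
      by (simp add: powr_mult powr_powr a1)
    also have "\<dots> \<le> K * n powr (2 + d)"
    proof (rule mult_right_mono)
      \<comment> \<open>The base may be below 1, so it is first replaced by sqrt K \<ge> 1; only
        then can the exponent 2 - a be raised to 2.\<close>
      have "chi0 N ac + Z \<le> sqrt K" using K by (intro real_le_rsqrt) (simp add: Z_def)
      then have "(chi0 N ac + Z) powr (2 - a) \<le> sqrt K powr (2 - a)"
        using chi0 Z0 a01 by (intro powr_mono2) auto
      also have "\<dots> \<le> sqrt K powr 2" using K a01 by (intro powr_mono) auto
      also have "\<dots> = K" using K by simp
      finally show "(chi0 N ac + Z) powr (2 - a) \<le> K" .
    qed simp
    finally have "b / K * norm y powr (2 - a) \<le> b / K * (K * n powr (2 + d))"
      using b K by (intro mult_left_mono) auto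
    also have "\<dots> = b * n powr (2 + d)" using K by simp
    also have "\<dots> \<le> ac N * n powr (2 + d)" using b by (intro mult_right_mono) auto
    also have "\<dots> = (ac N * n powr d) * n\<^sup>2"
      using False powr_add[of n 2 d] by simp
    also have "\<dots> \<le> G * n\<^sup>2" using Gge by (intro mult_right_mono) auto
    finally have "b / K * norm y powr (2 - a) \<le> X \<bullet> y" using inner by simp
    moreover have "0 \<le> b / K * (1 / 4)" using b K by simp
    ultimately show ?thesis by (simp add: right_diff_distrib)
  qed
qed

text \<open>Dividing by 2^\<open>alN\<close> \<ge> 1 and raising a number of (0, 1] to the power 1 +
  a only decrease it. Thus \<open>c4\<close> can serve as the common lower bound b of 1, a_0 and a_N
  in the flux estimates.\<close>

lemma c4_bounds:
  assumes "0 \<le> a" "a0 > 0" "aN > 0" "alN \<ge> 0"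
  shows "0 < c4 a a0 aN alN" "c4 a a0 aN alN \<le> 1" "c4 a a0 aN alN \<le> a0" "c4 a a0 aN alN \<le> aN"
proof -
  define m where "m = Min {1, a0, aN}"
  define x where "x = m / 2 powr alN"
  have m: "0 < m" "m \<le> 1" "m \<le> a0" "m \<le> aN" using assms by (auto simp: m_def)
  have "1 \<le> 2 powr alN" using assms by (intro ge_one_powr_ge_zero) auto
  then have "x \<le> m" "0 < x" using m by (auto simp: x_def divide_le_eq mult_le_cancel_left1)
  moreover from this m have "x powr (1 + a) \<le> x powr 1" using assms by (intro powr_mono') auto
  ultimately have "c4 a a0 aN alN \<le> m" "0 < c4 a a0 aN alN"
    unfolding c4_def m_def[symmetric] x_def[symmetric] by auto
  with m show "0 < c4 a a0 aN alN" "c4 a a0 aN alN \<le> 1" "c4 a a0 aN alN \<le> a0" "c4 a a0 aN alN \<le> aN" by auto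
qed

subsection \<open>Interpolation with the weighted dissipation\<close>

lemma grad3_eq:
  assumes "(f has_derivative f') (at x)"
  shows "grad3 f x = (\<chi> i. f' (axis i 1))"
  by (simp add: grad3_def frechet_derivative_at[OF assms, symmetric])

lemma continuous_on_grad3:
  assumes "\<And>x. x \<in> S \<Longrightarrow> (f has_derivative blinfun_apply (f' x)) (at x)" "continuous_on S f'"
  shows "continuous_on S (grad3 f)"
proof -
  have "continuous_on S (\<lambda>x. \<chi> i. f' x (axis i 1))"
    by (intro continuous_intros assms(2))
  then show ?thesis
    by (rule continuous_on_eq) (simp add: grad3_eq[OF assms(1)])
qed

lemma continuous_on_powr_pos:
  fixes f :: "'a::topological_space \<Rightarrow> real"
  assumes "continuous_on S f" "\<And>x. x \<in> S \<Longrightarrow> f x \<ge> 0" "s > 0"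
  shows "continuous_on S (\<lambda>x. f x powr s)"
  by (rule continuous_on_powr'[OF assms(1) continuous_on_const]) (use assms in auto)

lemma set_integral_nonneg:
  fixes f :: "'a \<Rightarrow> real"
  assumes "\<And>x. x \<in> U \<Longrightarrow> f x \<ge> 0"
  shows "(LINT x:U|M. f x) \<ge> 0"
  unfolding set_lebesgue_integral_def
  using assms by (intro integral_nonneg_AE AE_I2) (auto simp: indicator_def)

text \<open>The power m satisfies (m - 1)(2 - a) = \<alpha> - 2, so the gradient of f = |w|^m to the
  power 2 - a is, up to m^(2 - a), the dissipation density without weight. Since q = r(2 - a),
  Hoelder with exponents r and 1 - r brings the weight back, and s is chosen so that the two powers
  of 1 + u cancel. The Sobolev inequality for f then bounds a high power of |w|, and l places
  \<alpha> + 4(1 - a) between that power and \<alpha>.\<close>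

lemma weighted_interpolation:
  fixes U :: "(real^3) set" and w u :: "real^3 \<Rightarrow> real" and a r \<alpha> cbar \<theta> :: real
  defines "q \<equiv> r * (2 - a)" and "m \<equiv> (\<alpha> - a) / (2 - a)" and "s \<equiv> 2 * r / (1 - r)"
  defines "l \<equiv> \<theta> * (3 - q) / (3 * r)"
  assumes U: "open U" "bounded U" and S: "open S" "closure U \<subseteq> S"
    and w: "\<And>x. x \<in> S \<Longrightarrow> (w has_derivative blinfun_apply (w' x)) (at x)" "continuous_on S w'"
    and bd: "\<And>x. x \<in> frontier U \<Longrightarrow> w x = 0"
    and u: "continuous_on (closure U) u" "\<And>x. x \<in> closure U \<Longrightarrow> u x \<ge> 0"
    and a: "0 < a" "a < 1" and r: "0 < r" "r < 1" and \<alpha>: "\<alpha> > 3" and cbar: "cbar > 0"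
    and sobolev: "\<And>f. (\<exists>S. open S \<and> closure U \<subseteq> S \<and> C1_on S f) \<Longrightarrow> (\<forall>x\<in>frontier U. f x = 0) \<Longrightarrow>
        (LINT x:U|lborel. \<bar>f x\<bar> powr (3 * q / (3 - q))) powr ((3 - q) / (3 * q))
          \<le> cbar * (LINT x:U|lborel. norm (grad3 f x) powr q) powr (1 / q)"
    and \<theta>: "0 < \<theta>" and l: "l < 1"
    and interp: "\<alpha> * (1 - l) + (\<alpha> - a) * \<theta> = \<alpha> + 4 * (1 - a)"
  shows "(LINT x:U|lborel. \<bar>w x\<bar> powr (\<alpha> + 4 * (1 - a))) \<le>
     (LINT x:U|lborel. \<bar>w x\<bar> powr \<alpha>) powr (1 - l) * (cbar * m) powr ((2 - a) * \<theta>)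
     * (LINT x:U|lborel. (1 + u x) powr (- 2) * norm (grad3 w x) powr (2 - a) * \<bar>w x\<bar> powr (\<alpha> - 2)) powr \<theta>
     * (LINT x:U|lborel. (1 + u x) powr s) powr (\<theta> * (1 - r) / r)"
proof -
  have q: "0 < q" "q < 2" using a r mult_strict_mono[of r 1 "2 - a" 2] by (auto simp: q_def)
  have m: "m > 1" using a \<alpha> by (simp add: m_def field_simps)
  have s: "s > 0" using r by (simp add: s_def)
  have l0: "l > 0" using \<theta> q r by (simp add: l_def)
  have cU: "x \<in> closure U" if "x \<in> U" for x using that closure_subset by auto
  define qs where "qs = 3 * q / (3 - q)"
  have qs: "qs > 0" using q by (simp add: qs_def)
  define f where "f x = \<bar>w x\<bar> powr m" for x
  define f' where "f' x = (m * (sgn (w x) * \<bar>w x\<bar> powr (m - 1))) *\<^sub>R w' x" for x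
  have f: "(f has_derivative blinfun_apply (f' x)) (at x)" if "x \<in> S" for x
  proof -
    have "(f has_derivative (\<lambda>h. m * (sgn (w x) * \<bar>w x\<bar> powr (m - 1)) * w' x h)) (at x)"
      unfolding f_def
      using has_derivative_compose[OF w(1)[OF that] has_real_derivative_abs_powr[OF m, unfolded has_field_derivative_def]]
      by simp
    then show ?thesis by (simp add: f'_def scaleR_blinfun.rep_eq)
  qed
  have contw: "continuous_on S w"
    using w(1) by (intro has_derivative_continuous_on) (auto intro: has_derivative_at_withinI)
  have f': "continuous_on S f'"
  proof -
    have "continuous_on S (\<lambda>x. sgn (w x) * \<bar>w x\<bar> powr (m - 1))"
      by (rule continuous_on_compose2[OF continuous_at_imp_continuous_on contw, of UNIV "\<lambda>z. sgn z * \<bar>z\<bar> powr (m - 1)"])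
        (use m continuous_sgn_powr in auto)
    then show ?thesis
      unfolding f'_def by (intro continuous_on_scaleR[OF continuous_on_mult[OF continuous_on_const] w(2)])
  qed
  have gradf: "norm (grad3 f x) = m * \<bar>w x\<bar> powr (m - 1) * norm (grad3 w x)" if "x \<in> S" for x
  proof -
    have "grad3 f x = (m * (sgn (w x) * \<bar>w x\<bar> powr (m - 1))) *\<^sub>R grad3 w x"
      unfolding grad3_eq[OF f[OF that]] grad3_eq[OF w(1)[OF that]]
      by (simp add: f'_def scaleR_blinfun.rep_eq vec_eq_iff)
    then show ?thesis using m by (auto simp: abs_mult sgn_real_def)
  qed
  have wc: "continuous_on (closure U) w" using contw S(2) by (rule continuous_on_subset)
  have gc: "continuous_on (closure U) (grad3 w)"
    using continuous_on_grad3[OF w] S(2) by (rule continuous_on_subset)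
  have int_w: "set_integrable lborel U (\<lambda>x. \<bar>w x\<bar> powr t)" if "t > 0" for t
    by (intro set_integrable_continuous_closure[OF U] continuous_on_powr_pos continuous_intros wc) (use that in auto)
  define h where "h x = (1 + u x) powr (- 2) * norm (grad3 w x) powr (2 - a) * \<bar>w x\<bar> powr (\<alpha> - 2)" for x
  define k where "k x = (1 + u x) powr s" for x
  define A Q I W where "A = (LINT x:U|lborel. \<bar>w x\<bar> powr \<alpha>)" and "Q = (LINT x:U|lborel. \<bar>w x\<bar> powr (m * qs))"
    and "I = (LINT x:U|lborel. h x)" and "W = (LINT x:U|lborel. k x)"
  have hc: "continuous_on (closure U) h" unfolding h_def
    by (intro continuous_on_mult continuous_on_powr continuous_on_powr_pos continuous_intros wc gc u(1))
      (use u(2) a \<alpha> in \<open>auto simp: add_nonneg_eq_0_iff\<close>)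
  have kc: "continuous_on (closure U) k" unfolding k_def
    by (intro continuous_on_powr_pos continuous_intros u(1)) (use u(2) s in auto)
  have nonneg: "A \<ge> 0" "Q \<ge> 0" "I \<ge> 0" "W \<ge> 0"
    by (auto simp: A_def Q_def I_def W_def h_def k_def intro!: set_integral_nonneg)
  have hk: "norm (grad3 f x) powr q = m powr q * (h x powr r * k x powr (1 - r))" if x: "x \<in> U" for x
  proof -
    have xS: "x \<in> S" using x cU S by auto
    have u1: "1 + u x > 0" using u(2)[OF cU[OF x]] by simp
    have e1: "(m - 1) * q = (\<alpha> - 2) * r" using a by (simp add: m_def q_def field_simps)
    have e2: "s * (1 - r) = 2 * r" using r by (simp add: s_def)
    have h1: "h x powr r = (1 + u x) powr (- 2 * r) * norm (grad3 w x) powr q * \<bar>w x\<bar> powr ((m - 1) * q)"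
      unfolding e1 by (simp add: h_def powr_mult powr_powr q_def mult_ac)
    have k1: "k x powr (1 - r) = (1 + u x) powr (2 * r)" unfolding k_def powr_powr e2 ..
    have c1: "(1 + u x) powr (- 2 * r) * (1 + u x) powr (2 * r) = 1"
      using u1 unfolding powr_add[symmetric] by simp
    have "h x powr r * k x powr (1 - r) = ((1 + u x) powr (- 2 * r) * (1 + u x) powr (2 * r))
        * (norm (grad3 w x) powr q * \<bar>w x\<bar> powr ((m - 1) * q))"
      unfolding h1 k1 by (simp only: mult_ac)
    then have "h x powr r * k x powr (1 - r) = norm (grad3 w x) powr q * \<bar>w x\<bar> powr ((m - 1) * q)"
      unfolding c1 by simp
    then show ?thesis using m by (simp add: gradf[OF xS] powr_mult powr_powr mult_ac)
  qed
  have B: "(LINT x:U|lborel. norm (grad3 f x) powr q) \<le> m powr q * (I powr r * W powr (1 - r))"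
  proof -
    have "(LINT x:U|lborel. norm (grad3 f x) powr q) = (LINT x:U|lborel. m powr q * (h x powr r * k x powr (1 - r)))"
      using U hk by (intro set_lebesgue_integral_cong) auto
    also have "\<dots> = m powr q * (LINT x:U|lborel. h x powr r * k x powr (1 - r))" by simp
    also have "\<dots> \<le> m powr q * (I powr r * W powr (1 - r))"
      unfolding I_def W_def
    proof (intro mult_left_mono set_integral_Holder)
      show "set_integrable lborel U (\<lambda>x. h x powr r * k x powr (1 - r))"
        by (intro set_integrable_continuous_closure[OF U] continuous_on_mult continuous_on_powr_pos hc kc)
          (use r in \<open>auto simp: h_def k_def\<close>)
    qed (use r U hc kc in \<open>auto intro!: set_integrable_continuous_closure simp: h_def k_def\<close>)
    finally show ?thesis .
  qed
  have fq: "\<bar>f x\<bar> powr qs = \<bar>w x\<bar> powr (m * qs)" for x by (simp add: f_def powr_powr)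
  have "\<exists>S. open S \<and> closure U \<subseteq> S \<and> C1_on S f"
    using S f f' unfolding C1_on_def by blast
  moreover have "\<forall>x\<in>frontier U. f x = 0" using bd m by (simp add: f_def)
  ultimately have "Q powr (1 / qs) \<le> cbar * (LINT x:U|lborel. norm (grad3 f x) powr q) powr (1 / q)"
    using sobolev[of f] q unfolding qs_def[symmetric] fq Q_def[symmetric] by (simp add: qs_def)
  also have "\<dots> \<le> cbar * (m powr q * (I powr r * W powr (1 - r))) powr (1 / q)"
    using B cbar q by (intro mult_left_mono powr_mono2 set_integral_nonneg) auto
  finally have Q1: "Q powr (1 / qs) \<le> cbar * (m powr q * (I powr r * W powr (1 - r))) powr (1 / q)" .
  have "3 - q \<noteq> 0" using q by simp
  \<comment> \<open>The Sobolev inequality is raised to the power \<open>qs * l\<close>. The choice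
    of l makes the dissipation, which enters it with the exponent r/q, come out with exactly
    \<theta>.\<close>
  then have ql0: "qs * l = q * (\<theta> / r)" unfolding qs_def l_def by simp
  have ql: "qs * l = (2 - a) * \<theta>" "1 / q * (qs * l) = \<theta> / r" "q * (\<theta> / r) = (2 - a) * \<theta>"
    "r * (\<theta> / r) = \<theta>" "(1 - r) * (\<theta> / r) = \<theta> * (1 - r) / r"
  proof -
    show ql3: "q * (\<theta> / r) = (2 - a) * \<theta>" using r by (simp add: q_def)
    show "qs * l = (2 - a) * \<theta>" using ql0 ql3 by simp
    show "1 / q * (qs * l) = \<theta> / r" unfolding ql0 using q by simp
  qed (use r in simp_all)
  have "Q powr l = (Q powr (1 / qs)) powr (qs * l)" using qs by (simp add: powr_powr)
  also have "\<dots> \<le> (cbar * (m powr q * (I powr r * W powr (1 - r))) powr (1 / q)) powr (qs * l)"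
    using Q1 qs l0 by (intro powr_mono2) auto
  also have "\<dots> = cbar powr ((2 - a) * \<theta>) * (m powr q * (I powr r * W powr (1 - r))) powr (\<theta> / r)"
    unfolding powr_mult[of cbar] powr_powr[of _ "1 / q"] ql(1) ql(2)[unfolded ql(1)] ..
  also have "\<dots> = cbar powr ((2 - a) * \<theta>) * (m powr ((2 - a) * \<theta>) * (I powr \<theta> * W powr (\<theta> * (1 - r) / r)))"
    by (simp only: powr_mult powr_powr ql)
  finally have Ql: "Q powr l \<le> (cbar * m) powr ((2 - a) * \<theta>) * I powr \<theta> * W powr (\<theta> * (1 - r) / r)"
    by (simp add: powr_mult mult_ac)
  have mq: "m * qs * l = (\<alpha> - a) * \<theta>"
    using ql(1) a by (simp add: m_def mult.assoc)
  have eqp: "\<bar>w x\<bar> powr (\<alpha> + 4 * (1 - a)) = (\<bar>w x\<bar> powr (m * qs)) powr l * (\<bar>w x\<bar> powr \<alpha>) powr (1 - l)" for x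
    unfolding powr_powr mq powr_add[symmetric] interp[symmetric] by (simp add: add.commute)
  have "(LINT x:U|lborel. \<bar>w x\<bar> powr (\<alpha> + 4 * (1 - a))) \<le> Q powr l * A powr (1 - l)"
    unfolding eqp Q_def A_def
  proof (rule set_integral_Holder)
    show "set_integrable lborel U (\<lambda>x. (\<bar>w x\<bar> powr (m * qs)) powr l * (\<bar>w x\<bar> powr \<alpha>) powr (1 - l))"
      unfolding eqp[symmetric] using int_w[of "\<alpha> + 4 * (1 - a)"] a \<alpha> by simp
  qed (use l l0 int_w m qs \<alpha> in auto)
  also have "\<dots> \<le> ((cbar * m) powr ((2 - a) * \<theta>) * I powr \<theta> * W powr (\<theta> * (1 - r) / r)) * A powr (1 - l)"
    using Ql by (rule mult_right_mono) auto
  finally show ?thesis unfolding A_def I_def W_def h_def k_def by (simp add: mult_ac)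
qed

text \<open>Since 1 + u \<le> |w| + (1 + |v|), the integral splits: s \<le> \<alpha> and the finite
  volume bound the w part by a power of V, and the v part is data. The sum is then written as a
  product, because V is to appear as one overall factor.\<close>

lemma shifted_power_integral_bound:
  fixes U :: "'a::euclidean_space set" and w v u :: "'a \<Rightarrow> real" and s \<alpha> \<eta> :: real
  assumes U: "open U" "bounded U"
    and w: "continuous_on (closure U) w" and v: "continuous_on (closure U) v" and u: "continuous_on (closure U) u"
    and unn: "\<And>x. x \<in> U \<Longrightarrow> u x \<ge> 0" and uw: "\<And>x. x \<in> U \<Longrightarrow> u x \<le> \<bar>w x\<bar> + \<bar>v x\<bar>"
    and s: "1 \<le> s" "s \<le> \<alpha>" and \<eta>: "\<eta> > 0"
  defines "V \<equiv> 1 + (LINT x:U|lborel. \<bar>w x\<bar> powr \<alpha>)" and "\<mu> \<equiv> measure lborel U"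
    and "n \<equiv> ((LINT x:U|lborel. \<bar>v x\<bar> powr s) powr (1 / s)) powr (s * \<eta>)"
  shows "(LINT x:U|lborel. (1 + u x) powr s) powr \<eta> \<le>
     2 powr ((s + 1) * \<eta>) * (1 + \<mu>) powr (\<eta> * (1 - s / \<alpha>)) * V powr (s * \<eta> / \<alpha>)
      * ((1 + 2 powr (s * \<eta>)) * (1 + \<mu>) powr (max 1 \<eta>) * (1 + n))"
proof -
  have \<mu>: "\<mu> \<ge> 0" by (simp add: \<mu>_def)
  have Ub: "U \<in> sets lborel" and fin: "emeasure lborel U < \<infinity>"
    using U emeasure_bounded_finite by auto
  have one: "set_integrable lborel U (\<lambda>x. 1::real)" "(LINT x:U|lborel. (1::real)) = \<mu>"
    using Ub fin by (auto simp: set_integrable_def set_lebesgue_integral_def \<mu>_def)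
  have int_w: "set_integrable lborel U (\<lambda>x. \<bar>w x\<bar> powr t)" if "t > 0" for t
    by (intro set_integrable_continuous_closure[OF U] continuous_on_powr_pos continuous_intros w) (use that in auto)
  have int_v: "set_integrable lborel U (\<lambda>x. \<bar>v x\<bar> powr s)"
    by (intro set_integrable_continuous_closure[OF U] continuous_on_powr_pos continuous_intros v) (use s in auto)
  have int_u: "set_integrable lborel U (\<lambda>x. (1 + u x) powr s)"
  proof (rule set_integrable_bound[where f = "\<lambda>x. (1 + \<bar>u x\<bar>) powr s"])
    show "set_integrable lborel U (\<lambda>x. (1 + \<bar>u x\<bar>) powr s)"
      by (intro set_integrable_continuous_closure[OF U] continuous_on_powr_pos continuous_intros u) (use s in auto)
    have "(\<lambda>x. indicator U x *\<^sub>R (1 + u x) powr s) = (\<lambda>x. indicator U x *\<^sub>R (1 + \<bar>u x\<bar>) powr s)"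
      using unn by (auto simp: indicator_def fun_eq_iff)
    then show "set_borel_measurable lborel U (\<lambda>x. (1 + u x) powr s)"
      using \<open>set_integrable lborel U (\<lambda>x. (1 + \<bar>u x\<bar>) powr s)\<close>
      unfolding set_integrable_def set_borel_measurable_def by auto
  qed (use unn in auto)
  define X Y N where "X = (LINT x:U|lborel. \<bar>w x\<bar> powr s)" and "Y = (LINT x:U|lborel. (1 + \<bar>v x\<bar>) powr s)"
    and "N = (LINT x:U|lborel. \<bar>v x\<bar> powr s)"
  have int_v1: "set_integrable lborel U (\<lambda>x. (1 + \<bar>v x\<bar>) powr s)"
    by (intro set_integrable_continuous_closure[OF U] continuous_on_powr_pos continuous_intros v) (use s in auto)
  have nonneg: "X \<ge> 0" "Y \<ge> 0" "N \<ge> 0" "(LINT x:U|lborel. \<bar>w x\<bar> powr \<alpha>) \<ge> 0"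
    by (auto simp: X_def Y_def N_def intro!: set_integral_nonneg)
  have V1: "V \<ge> 1" using nonneg by (simp add: V_def)
  have W: "(LINT x:U|lborel. (1 + u x) powr s) \<le> 2 powr s * (X + Y)"
  proof -
    have "(LINT x:U|lborel. (1 + u x) powr s) \<le> (LINT x:U|lborel. 2 powr s * (\<bar>w x\<bar> powr s + (1 + \<bar>v x\<bar>) powr s))"
    proof (rule set_integral_mono[OF int_u])
      fix x assume x: "x \<in> U"
      have "(1 + u x) powr s \<le> (\<bar>w x\<bar> + (1 + \<bar>v x\<bar>)) powr s"
        using unn[OF x] uw[OF x] s by (intro powr_mono2) auto
      also have "\<dots> \<le> 2 powr s * (\<bar>w x\<bar> powr s + (1 + \<bar>v x\<bar>) powr s)"
        using s by (intro add_powr_le) auto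
      finally show "(1 + u x) powr s \<le> 2 powr s * (\<bar>w x\<bar> powr s + (1 + \<bar>v x\<bar>) powr s)" .
    qed (use int_w[of s] int_v1 s in \<open>auto intro!: set_integral_add\<close>)
    also have "\<dots> = 2 powr s * (X + Y)"
      using int_w[of s] int_v1 s by (simp add: X_def Y_def set_integral_add)
    finally show ?thesis .
  qed
  have X: "X powr \<eta> \<le> V powr (s * \<eta> / \<alpha>) * (1 + \<mu>) powr (\<eta> * (1 - s / \<alpha>))"
  proof -
    have "X \<le> V powr (s / \<alpha>) * (1 + \<mu>) powr (1 - s / \<alpha>)"
    proof (cases "s = \<alpha>")
      case True
      then show ?thesis using V1 s \<mu> by (simp add: X_def V_def)
    next
      case False
      have "X = (LINT x:U|lborel. (\<bar>w x\<bar> powr \<alpha>) powr (s / \<alpha>) * 1 powr (1 - s / \<alpha>))"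
        using s by (simp add: X_def powr_powr)
      also have "\<dots> \<le> (LINT x:U|lborel. \<bar>w x\<bar> powr \<alpha>) powr (s / \<alpha>) * (LINT x:U|lborel. 1) powr (1 - s / \<alpha>)"
        using s False int_w one by (intro set_integral_Holder) (auto simp: powr_powr)
      also have "\<dots> \<le> V powr (s / \<alpha>) * (1 + \<mu>) powr (1 - s / \<alpha>)"
        unfolding one(2) using s False nonneg \<mu> by (intro mult_mono powr_mono2) (auto simp: V_def)
      finally show ?thesis .
    qed
    then have "X powr \<eta> \<le> (V powr (s / \<alpha>) * (1 + \<mu>) powr (1 - s / \<alpha>)) powr \<eta>"
      using nonneg \<eta> by (intro powr_mono2) auto
    then show ?thesis by (simp add: powr_mult powr_powr mult_ac)
  qed
  have Y: "Y powr \<eta> \<le> 2 powr (s * \<eta>) * (\<mu> powr \<eta> + n)"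
  proof -
    have "Y \<le> (LINT x:U|lborel. 2 powr (s - 1) * (1 + \<bar>v x\<bar> powr s))"
      unfolding Y_def
    proof (rule set_integral_mono[OF int_v1])
      show "(1 + \<bar>v x\<bar>) powr s \<le> 2 powr (s - 1) * (1 + \<bar>v x\<bar> powr s)" for x
        using add_powr_le_convex[of 1 "\<bar>v x\<bar>" s] s by simp
    qed (use one int_v in \<open>auto intro!: set_integral_add\<close>)
    also have "\<dots> = 2 powr (s - 1) * (\<mu> + N)"
      using one int_v by (simp add: N_def set_integral_add)
    finally have "Y powr \<eta> \<le> (2 powr (s - 1) * (\<mu> + N)) powr \<eta>"
      using nonneg \<eta> by (intro powr_mono2) auto
    also have "\<dots> = 2 powr ((s - 1) * \<eta>) * (\<mu> + N) powr \<eta>"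
      by (simp add: powr_mult powr_powr)
    also have "\<dots> \<le> 2 powr ((s - 1) * \<eta>) * (2 powr \<eta> * (\<mu> powr \<eta> + N powr \<eta>))"
      using \<mu> nonneg \<eta> by (intro mult_left_mono add_powr_le) auto
    also have "\<dots> = 2 powr ((s - 1) * \<eta> + \<eta>) * (\<mu> powr \<eta> + N powr \<eta>)" by (simp only: powr_add mult.assoc)
    also have "(s - 1) * \<eta> + \<eta> = s * \<eta>" by (simp add: algebra_simps)
    also have "N powr \<eta> = n" using s by (simp add: n_def N_def powr_powr)
    finally show ?thesis .
  qed
  \<comment> \<open>The exponent \<eta> is what the volume in the v part requires; the 1 in the
    maximum is there for terms in which the volume enters linearly. This is the volume factor of
    \<open>Cstar\<close>.\<close>
  define t M2 where "t = 2 powr (s * \<eta>)" and "M2 = (1 + \<mu>) powr (max 1 \<eta>)"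
  have t0: "t \<ge> 0" and n0: "n \<ge> 0" by (auto simp: t_def n_def)
  have M1: "M2 \<ge> 1" using \<mu> by (simp add: M2_def ge_one_powr_ge_zero)
  have M2: "\<mu> powr \<eta> \<le> M2"
  proof -
    have "\<mu> powr \<eta> \<le> (1 + \<mu>) powr \<eta>" using \<mu> \<eta> by (intro powr_mono2) auto
    also have "\<dots> \<le> M2" unfolding M2_def using \<mu> by (intro powr_mono) auto
    finally show ?thesis .
  qed
  \<comment> \<open>Since Z \<ge> 1, the data term may be multiplied by it; this turns the sum into
    a product.\<close>
  define Z where "Z = (1 + \<mu>) powr (\<eta> * (1 - s / \<alpha>)) * V powr (s * \<eta> / \<alpha>)"
  have Z1: "Z \<ge> 1" unfolding Z_def
  proof -
    have "1 * 1 \<le> (1 + \<mu>) powr (\<eta> * (1 - s / \<alpha>)) * V powr (s * \<eta> / \<alpha>)"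
      using \<mu> V1 s \<eta> by (intro mult_mono ge_one_powr_ge_zero) auto
    then show "1 \<le> (1 + \<mu>) powr (\<eta> * (1 - s / \<alpha>)) * V powr (s * \<eta> / \<alpha>)" by simp
  qed
  have "X powr \<eta> + Y powr \<eta> \<le> Z + t * (\<mu> powr \<eta> + n)"
    using X Y by (simp add: Z_def t_def mult.commute)
  also have "\<dots> \<le> Z * (M2 * (1 + n)) + Z * (t * (M2 * (1 + n)))"
  proof (rule add_mono)
    have "1 * 1 \<le> M2 * (1 + n)" using M1 n0 by (intro mult_mono) auto
    then show "Z \<le> Z * (M2 * (1 + n))" using Z1 mult_left_mono[of 1 "M2 * (1 + n)" Z] by simp
    have "1 * n \<le> M2 * n" using M1 n0 by (rule mult_right_mono)
    then have "\<mu> powr \<eta> + n \<le> M2 * (1 + n)" using M2 by (simp add: distrib_left)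
    then have "1 * (t * (\<mu> powr \<eta> + n)) \<le> Z * (t * (M2 * (1 + n)))"
      using Z1 t0 n0 by (intro mult_mono mult_left_mono) auto
    then show "t * (\<mu> powr \<eta> + n) \<le> Z * (t * (M2 * (1 + n)))" by simp
  qed
  also have "\<dots> = Z * ((1 + t) * M2 * (1 + n))" by (simp add: algebra_simps)
  finally have XY: "X powr \<eta> + Y powr \<eta> \<le> Z * ((1 + t) * M2 * (1 + n))" .
  have "(LINT x:U|lborel. (1 + u x) powr s) powr \<eta> \<le> (2 powr s * (X + Y)) powr \<eta>"
    using W \<eta> by (intro powr_mono2 set_integral_nonneg) auto
  also have "\<dots> = 2 powr (s * \<eta>) * (X + Y) powr \<eta>" by (simp add: powr_mult powr_powr)
  also have "\<dots> \<le> 2 powr (s * \<eta>) * (2 powr \<eta> * (X powr \<eta> + Y powr \<eta>))"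
    using nonneg \<eta> by (intro mult_left_mono add_powr_le) auto
  also have "\<dots> \<le> 2 powr (s * \<eta>) * (2 powr \<eta> * (Z * ((1 + t) * M2 * (1 + n))))"
    using XY by (intro mult_left_mono) auto
  also have "\<dots> = 2 powr ((s + 1) * \<eta>) * (Z * ((1 + t) * M2 * (1 + n)))"
  proof -
    have "2 powr ((s + 1) * \<eta>) = 2 powr (s * \<eta>) * (2::real) powr \<eta>"
      by (simp add: distrib_right powr_add)
    then show ?thesis by (simp only: mult_ac)
  qed
  finally show ?thesis by (simp add: Z_def t_def M2_def mult_ac)
qed

text \<open>Young's inequality with weights \<theta> and 1 - \<theta>. The second factor Y is
  determined by requiring that (\<epsilon>/\<kappa> I)^\<theta> Y^(1 - \<theta>) reproduce the bound
  for c \<kappa>^b J exactly; this is why every other factor acquires the exponent 1/(1 -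
  \<theta>).\<close>

lemma absorb_interpolation:
  fixes c \<epsilon> \<kappa> J I A V W G \<theta> l :: real
  assumes \<theta>: "0 < \<theta>" "\<theta> < 1" and c: "c > 0" and \<epsilon>: "\<epsilon> > 0" and \<kappa>: "\<kappa> > 0"
    and nn: "I \<ge> 0" "G \<ge> 0" "W \<ge> 0" "V \<ge> 0"
    and J: "J \<le> V powr (1 - l) * G powr \<theta> * I powr \<theta> * W powr (\<eta> * (1 - \<theta>))"
  shows "c * \<kappa> powr b * J \<le> \<epsilon> / \<kappa> * I
    + c * (c / \<epsilon>) powr (\<theta> / (1 - \<theta>)) * \<kappa> powr ((b + \<theta>) / (1 - \<theta>)) * V powr ((1 - l) / (1 - \<theta>))
      * G powr (\<theta> / (1 - \<theta>)) * W powr \<eta>"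
proof -
  define Y where "Y = c * (c / \<epsilon>) powr (\<theta> / (1 - \<theta>)) * \<kappa> powr ((b + \<theta>) / (1 - \<theta>)) * V powr ((1 - l) / (1 - \<theta>))
      * G powr (\<theta> / (1 - \<theta>)) * W powr \<eta>"
  have Y0: "Y \<ge> 0" using c nn by (simp add: Y_def)
  have e: "x / (1 - \<theta>) * (1 - \<theta>) = x" for x using \<theta> by simp
  have "Y powr (1 - \<theta>) = c powr (1 - \<theta>) * (c / \<epsilon>) powr \<theta> * \<kappa> powr (b + \<theta>) * V powr (1 - l)
      * G powr \<theta> * W powr (\<eta> * (1 - \<theta>))"
    unfolding Y_def powr_mult powr_powr e ..
  also have "\<kappa> powr (b + \<theta>) = \<kappa> powr b * \<kappa> powr \<theta>" by (rule powr_add)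
  also have "(c / \<epsilon>) powr \<theta> = c powr \<theta> / \<epsilon> powr \<theta>" using c \<epsilon> by (simp add: powr_divide)
  finally have "(\<epsilon> / \<kappa> * I) powr \<theta> * Y powr (1 - \<theta>)
    = (c powr (1 - \<theta>) * c powr \<theta>) * (\<epsilon> powr \<theta> / \<epsilon> powr \<theta>) * (\<kappa> powr \<theta> / \<kappa> powr \<theta>) * \<kappa> powr b
       * (V powr (1 - l) * G powr \<theta> * I powr \<theta> * W powr (\<eta> * (1 - \<theta>)))"
    using \<epsilon> \<kappa> by (simp add: powr_mult powr_divide mult_ac)
  also have "\<dots> = c * \<kappa> powr b * (V powr (1 - l) * G powr \<theta> * I powr \<theta> * W powr (\<eta> * (1 - \<theta>)))"
    using c \<epsilon> \<kappa> unfolding powr_add[symmetric] by simp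
  finally have eq: "c * \<kappa> powr b * (V powr (1 - l) * G powr \<theta> * I powr \<theta> * W powr (\<eta> * (1 - \<theta>)))
      = (\<epsilon> / \<kappa> * I) powr \<theta> * Y powr (1 - \<theta>)" ..
  have "c * \<kappa> powr b * J \<le> c * \<kappa> powr b * (V powr (1 - l) * G powr \<theta> * I powr \<theta> * W powr (\<eta> * (1 - \<theta>)))"
    using c J by (intro mult_left_mono) auto
  also have "\<dots> \<le> \<theta> * (\<epsilon> / \<kappa> * I) + (1 - \<theta>) * Y"
    unfolding eq using \<theta> \<epsilon> \<kappa> nn Y0 by (intro Youngs_inequality_powr) auto
  also have "\<dots> \<le> 1 * (\<epsilon> / \<kappa> * I) + 1 * Y"
    using \<theta> \<epsilon> \<kappa> nn Y0 by (intro add_mono mult_right_mono) auto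
  finally show ?thesis by (simp add: Y_def)
qed

subsection \<open>The nonlinear Gronwall inequality\<close>

text \<open>The first two bounds come from the monotone quantity \<Phi>. For the third, the
  differential inequality is integrated again, now keeping the dissipation and inserting the bound
  just obtained for V. The dissipation I is compared pointwise with an integrable majorant under the
  nonnegative integral.\<close>

lemma nonlinear_gronwall:
  fixes V V' E I :: "real \<Rightarrow> real" and T \<gamma> C \<kappa> B :: real
  assumes T: "T > 0" and V: "continuous_on {0..T} V" and E: "continuous_on {0..T} E"
    and V': "\<And>t. 0 < t \<Longrightarrow> t < T \<Longrightarrow> (V has_real_derivative V' t) (at t)"
    and ineq: "\<And>t. 0 < t \<Longrightarrow> t < T \<Longrightarrow> V' t + \<kappa> * I t \<le> C * E t * V t powr (1 + \<gamma>)"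
    and I: "\<And>t. 0 < t \<Longrightarrow> t < T \<Longrightarrow> I t \<ge> 0" and E0: "\<And>t. t \<in> {0..T} \<Longrightarrow> E t \<ge> 0"
    and V1: "\<And>t. t \<in> {0..T} \<Longrightarrow> V t \<ge> 1"
    and pos: "\<gamma> > 0" "\<kappa> > 0" "C > 0" and B: "B < 1"
    and hyp: "\<gamma> * C * V 0 powr \<gamma> * (LINT s:{0..T}|lborel. E s) \<le> B"
  shows "\<And>t. t \<in> {0..T} \<Longrightarrow> V t \<le> V 0 * (1 - \<gamma> * C * V 0 powr \<gamma> * (LINT s:{0..t}|lborel. E s)) powr (- 1 / \<gamma>)"
    and "\<And>t. t \<in> {0..T} \<Longrightarrow> V t \<le> V 0 * (1 - B) powr (- 1 / \<gamma>)"
    and "(\<integral>\<^sup>+ t\<in>{0..T}. ennreal (I t) \<partial>lborel)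
        \<le> ennreal (V 0 / \<kappa> * (1 + B / (\<gamma> * (1 - B) powr (1 + 1 / \<gamma>))))"
proof -
  define F where "F t = integral {0..t} E" for t
  have V0: "V 0 \<ge> 1" using V1 T by simp
  have Eint: "E integrable_on {0..t}" if "t \<in> {0..T}" for t
    using that by (intro integrable_continuous_real continuous_on_subset[OF E]) auto
  have LF: "(LINT s:{0..t}|lborel. E s) = F t" if "t \<in> {0..T}" for t
    unfolding F_def
  proof (rule set_borel_integral_eq_integral)
    show "set_integrable lborel {0..t} E"
      using that by (intro borel_integrable_atLeastAtMost' continuous_on_subset[OF E]) auto
  qed
  have F': "(F has_real_derivative E t) (at t)" if "0 < t" "t < T" for t
  proof -
    have "(F has_vector_derivative E t) (at t within {0..T})"
      unfolding F_def by (rule integral_has_vector_derivative[OF E]) (use that in auto)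
    moreover have "at t within {0..T} = at t" using that by (intro at_within_interior) auto
    ultimately show ?thesis by (simp add: has_real_derivative_iff_has_vector_derivative)
  qed
  have Fc: "continuous_on {0..T} F"
    unfolding F_def by (rule indefinite_integral_continuous_1[OF Eint]) (use T in auto)
  have Fmono: "0 \<le> F t" "F t \<le> F T" if "t \<in> {0..T}" for t
  proof -
    show "0 \<le> F t" unfolding F_def using that E0 by (intro integral_nonneg[OF Eint]) auto
    show "F t \<le> F T" unfolding F_def
      using that E0 T by (intro integral_subset_le Eint) auto
  qed
  define D where "D t = 1 - \<gamma> * C * V 0 powr \<gamma> * F t" for t
  have DB: "D t \<ge> 1 - B" if "t \<in> {0..T}" for t
  proof -
    have "\<gamma> * C * V 0 powr \<gamma> * F t \<le> \<gamma> * C * V 0 powr \<gamma> * F T"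
      using Fmono[OF that] pos by (intro mult_left_mono) auto
    also have "\<dots> \<le> B" using hyp LF[of T] T by simp
    finally show ?thesis by (simp add: D_def)
  qed
  have bound: "V t \<le> V 0 * D t powr (- 1 / \<gamma>)" if t: "t \<in> {0..T}" for t
  proof -
    define \<Phi> where "\<Phi> s = V s powr (- \<gamma>) + \<gamma> * C * F s" for s
    have "\<Phi> 0 \<le> \<Phi> t"
    proof (rule DERIV_nonneg_imp_increasing_open[of 0 t \<Phi>])
      fix s assume s: "0 < s" "s < t"
      then have s': "s < T" using t by simp
      have Vs: "V s \<ge> 1" using V1 s s' by simp
      have d: "(\<Phi> has_real_derivative (- \<gamma>) * V s powr (- \<gamma> - 1) * V' s + \<gamma> * C * E s) (at s)"
        unfolding \<Phi>_def using Vs V'[OF s(1) s'] F'[OF s(1) s']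
        by (auto intro!: derivative_eq_intros simp: powr_diff)
      have "V' s \<le> C * E s * V s powr (1 + \<gamma>)"
        using ineq[OF s(1) s'] I[OF s(1) s'] pos mult_nonneg_nonneg[of \<kappa> "I s"] by linarith
      then have "V s powr (- \<gamma> - 1) * V' s \<le> V s powr (- \<gamma> - 1) * (C * E s * V s powr (1 + \<gamma>))"
        by (rule mult_left_mono) simp
      also have "\<dots> = C * E s * (V s powr (- \<gamma> - 1) * V s powr (1 + \<gamma>))" by simp
      also have "V s powr (- \<gamma> - 1) * V s powr (1 + \<gamma>) = 1"
        unfolding powr_add[symmetric] using Vs by simp
      finally have "\<gamma> * (V s powr (- \<gamma> - 1) * V' s) \<le> \<gamma> * (C * E s * 1)"
        using pos by (intro mult_left_mono) auto
      then show "\<exists>y. (\<Phi> has_real_derivative y) (at s) \<and> 0 \<le> y"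
        using d by (intro exI conjI) (auto simp: mult_ac)
    next
      have "continuous_on {0..t} V" "continuous_on {0..t} F"
        using V Fc t by (auto intro: continuous_on_subset)
      then show "continuous_on {0..t} \<Phi>"
        unfolding \<Phi>_def using V1 t
        by (intro continuous_intros) (auto, smt (verit) V1 atLeastAtMost_iff)
    qed (use t in auto)
    moreover have "F 0 = 0" by (simp add: F_def)
    ultimately have 1: "V 0 powr (- \<gamma>) - \<gamma> * C * F t \<le> V t powr (- \<gamma>)"
      by (simp add: \<Phi>_def)
    have "V 0 powr (- \<gamma>) * D t = V 0 powr (- \<gamma>) - \<gamma> * C * F t * (V 0 powr (- \<gamma>) * V 0 powr \<gamma>)"
      by (simp add: D_def algebra_simps)
    also have "V 0 powr (- \<gamma>) * V 0 powr \<gamma> = 1" unfolding powr_add[symmetric] using V0 by simp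
    finally have 2: "V 0 powr (- \<gamma>) * D t \<le> V t powr (- \<gamma>)" using 1 by simp
    \<comment> \<open>Raising to the power -1/\<gamma> reverses the inequality and needs this
      positivity, which is where B < 1 enters.\<close>
    have D0: "D t > 0" using DB[OF t] B by simp
    have "(V t powr (- \<gamma>)) powr (- 1 / \<gamma>) \<le> (V 0 powr (- \<gamma>) * D t) powr (- 1 / \<gamma>)"
      using 2 D0 V0 pos by (intro powr_mono2') auto
    also have "\<dots> = V 0 * D t powr (- 1 / \<gamma>)" using V0 pos by (simp add: powr_mult powr_powr)
    finally show ?thesis using V1[OF t] pos by (simp add: powr_powr)
  qed
  show "V t \<le> V 0 * (1 - \<gamma> * C * V 0 powr \<gamma> * (LINT s:{0..t}|lborel. E s)) powr (- 1 / \<gamma>)"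
    if "t \<in> {0..T}" for t
    using bound[OF that] LF[OF that] by (simp add: D_def)
  have VB: "V t \<le> V 0 * (1 - B) powr (- 1 / \<gamma>)" if "t \<in> {0..T}" for t
  proof -
    have "D t powr (- 1 / \<gamma>) \<le> (1 - B) powr (- 1 / \<gamma>)"
      using DB[OF that] B pos by (intro powr_mono2') auto
    then have "V 0 * D t powr (- 1 / \<gamma>) \<le> V 0 * (1 - B) powr (- 1 / \<gamma>)"
      using V0 by (intro mult_left_mono) auto
    with bound[OF that] show ?thesis by linarith
  qed
  then show "V t \<le> V 0 * (1 - B) powr (- 1 / \<gamma>)" if "t \<in> {0..T}" for t using that .
  define W where "W t = E t * V t powr (1 + \<gamma>)" for t
  have Wc: "continuous_on {0..T} W"
    unfolding W_def using V1 by (intro continuous_intros E V) (auto, smt (verit) V1 atLeastAtMost_iff)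
  define H where "H t = (C * integral {0..t} W - V t) / \<kappa>" for t
  \<comment> \<open>The derivative of H inside the interval, set to 0 at the endpoints, where V' is
    not controlled. The fundamental theorem needs only continuity of H there, and h \<ge> 0 makes
    its gauge integral a nonnegative Lebesgue integral.\<close>
  define h where "h t = (if 0 < t \<and> t < T then (C * W t - V' t) / \<kappa> else 0)" for t
  have Wint: "W integrable_on {0..T}" by (rule integrable_continuous_real[OF Wc])
  have hint: "(h has_integral H T - H 0) {0..T}"
  proof (rule fundamental_theorem_of_calculus_interior)
    show "continuous_on {0..T} H"
      unfolding H_def using pos
      by (intro continuous_intros indefinite_integral_continuous_1[OF Wint] V) auto
    fix t assume t: "t \<in> {0<..<T}"
    have "((\<lambda>t. integral {0..t} W) has_vector_derivative W t) (at t within {0..T})"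
      by (rule integral_has_vector_derivative[OF Wc]) (use t in auto)
    moreover have "at t within {0..T} = at t" using t by (intro at_within_interior) auto
    ultimately have W': "((\<lambda>t. integral {0..t} W) has_real_derivative W t) (at t)"
      by (simp add: has_real_derivative_iff_has_vector_derivative)
    have "(H has_real_derivative (C * W t - V' t) / \<kappa>) (at t)"
      unfolding H_def using t pos V'[of t] by (auto intro!: derivative_eq_intros W')
    then show "(H has_vector_derivative h t) (at t)"
      using t by (simp add: h_def has_real_derivative_iff_has_vector_derivative)
  qed (use T in simp)
  have Ih: "I t \<le> h t" if "0 < t" "t < T" for t
    using ineq[OF that] pos that by (simp add: h_def W_def field_simps)
  have h0: "0 \<le> h t" for t using Ih[of t] I[of t] by (auto simp: h_def)
  have "(\<integral>\<^sup>+ t\<in>{0..T}. ennreal (I t) \<partial>lborel) \<le> (\<integral>\<^sup>+ t\<in>{0..T}. ennreal (h t) \<partial>lborel)"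
  proof (rule nn_integral_mono_AE)
    have "AE t in lborel. t \<noteq> 0 \<and> t \<noteq> T" by (intro AE_conjI AE_lborel_singleton)
    then show "AE t in lborel. ennreal (I t) * indicator {0..T} t \<le> ennreal (h t) * indicator {0..T} t"
      by eventually_elim (auto simp: indicator_def intro!: ennreal_leI Ih)
  qed
  also have "\<dots> = ennreal (H T - H 0)"
    using hint h0 by (intro nn_integral_has_integral_lebesgue') auto
  also have "\<dots> \<le> ennreal (V 0 / \<kappa> * (1 + B / (\<gamma> * (1 - B) powr (1 + 1 / \<gamma>))))"
  proof (rule ennreal_leI)
    let ?m = "V 0 * (1 - B) powr (- 1 / \<gamma>)"
    have "integral {0..T} W \<le> integral {0..T} (\<lambda>t. ?m powr (1 + \<gamma>) * E t)"
    proof (rule integral_le[OF Wint])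
      show "(\<lambda>t. ?m powr (1 + \<gamma>) * E t) integrable_on {0..T}"
        using Eint[of T] T by (intro integrable_on_mult_right) auto
      fix t assume t: "t \<in> {0..T}"
      have "V t powr (1 + \<gamma>) \<le> ?m powr (1 + \<gamma>)"
        using VB[OF t] V1[OF t] pos by (intro powr_mono2) auto
      then show "W t \<le> ?m powr (1 + \<gamma>) * E t"
        using E0[OF t] by (simp add: W_def mult_mono mult.commute)
    qed
    also have "\<dots> = ?m powr (1 + \<gamma>) * F T" by (simp add: F_def)
    also have "?m powr (1 + \<gamma>) = V 0 * V 0 powr \<gamma> * (1 / (1 - B) powr (1 + 1 / \<gamma>))"
    proof -
      have "- 1 / \<gamma> * (1 + \<gamma>) = - (1 + 1 / \<gamma>)" using pos by (simp add: field_simps)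
      then have e: "?m powr (1 + \<gamma>) = V 0 powr (1 + \<gamma>) * (1 - B) powr (- (1 + 1 / \<gamma>))"
        unfolding powr_mult powr_powr by simp
      have v: "V 0 powr (1 + \<gamma>) = V 0 * V 0 powr \<gamma>" using V0 by (simp add: powr_add)
      show ?thesis unfolding e v powr_minus_divide ..
    qed
    finally have "C * integral {0..T} W \<le> C * (V 0 * V 0 powr \<gamma> * (1 / (1 - B) powr (1 + 1 / \<gamma>)) * F T)"
      using pos by (intro mult_left_mono) auto
    \<comment> \<open>Splitting V 0^(1 + \<gamma>) and inserting \<gamma> isolates the quantity that
      is at most B by hypothesis; this accounts for the factor 1/\<gamma> in the final
      estimate.\<close>
    also have "\<dots> = V 0 / (\<gamma> * (1 - B) powr (1 + 1 / \<gamma>)) * (\<gamma> * C * V 0 powr \<gamma> * F T)"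
      using pos B by (simp add: field_simps)
    also have "\<dots> \<le> V 0 / (\<gamma> * (1 - B) powr (1 + 1 / \<gamma>)) * B"
      using hyp LF[of T] T V0 pos by (intro mult_left_mono) auto
    finally have "C * integral {0..T} W - V T + V 0 \<le> V 0 + V 0 / (\<gamma> * (1 - B) powr (1 + 1 / \<gamma>)) * B"
      using V1[of T] T by simp
    then have "(C * integral {0..T} W - V T + V 0) / \<kappa> \<le> (V 0 + V 0 / (\<gamma> * (1 - B) powr (1 + 1 / \<gamma>)) * B) / \<kappa>"
      using pos by (intro divide_right_mono) auto
    moreover have "H T - H 0 = (C * integral {0..T} W - V T + V 0) / \<kappa>"
      by (simp add: H_def diff_divide_distrib add_divide_distrib)
    moreover have "(v + v / d * b) / k = v / k * (1 + b / d)" for v d b k :: real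
      by (simp add: distrib_left add_divide_distrib mult_ac)
    ultimately show "H T - H 0 \<le> V 0 / \<kappa> * (1 + B / (\<gamma> * (1 - B) powr (1 + 1 / \<gamma>)))"
      by (simp only:)
  qed
  finally show "(\<integral>\<^sup>+ t\<in>{0..T}. ennreal (I t) \<partial>lborel)
        \<le> ennreal (V 0 / \<kappa> * (1 + B / (\<gamma> * (1 - B) powr (1 + 1 / \<gamma>))))" .
qed

section \<open>Space-time regularity, collection of constants, and integration by parts\<close>

lemma C1_on_partial_derivatives:
  fixes f :: "'a::euclidean_space \<Rightarrow> real \<Rightarrow> 'b::real_normed_vector"
  assumes "C1_on S (\<lambda>(x, t). f x t)"
  shows "\<exists>F :: 'a \<times> real \<Rightarrow> ('a \<times> real) \<Rightarrow>\<^sub>L 'b. continuous_on S F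
    \<and> (\<forall>x t. (x, t) \<in> S \<longrightarrow> ((\<lambda>y. f y t) has_derivative (\<lambda>h. blinfun_apply (F (x, t)) (h, 0))) (at x))
    \<and> (\<forall>x t. (x, t) \<in> S \<longrightarrow> ((\<lambda>s. f x s) has_vector_derivative blinfun_apply (F (x, t)) (0, 1)) (at t))"
proof -
  from assms obtain F where F: "\<And>z. z \<in> S \<Longrightarrow> ((\<lambda>(x, t). f x t) has_derivative blinfun_apply (F z)) (at z)"
    and cont: "continuous_on S F" unfolding C1_on_def by blast
  show ?thesis
  proof (intro exI[of _ F] conjI cont allI impI)
    fix x t assume xt: "(x, t) \<in> S"
    have "((\<lambda>y. (y, t)) has_derivative (\<lambda>h. (h, 0))) (at x)" by (auto intro!: derivative_eq_intros)
    from has_derivative_compose[OF this F[OF xt]]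
    show "((\<lambda>y. f y t) has_derivative (\<lambda>h. blinfun_apply (F (x, t)) (h, 0))) (at x)" by simp
    have "((\<lambda>s. (x, s)) has_derivative (\<lambda>h. (0, h))) (at t)" by (auto intro!: derivative_eq_intros)
    from has_derivative_compose[OF this F[OF xt]]
    have "((\<lambda>s. f x s) has_derivative (\<lambda>h. blinfun_apply (F (x, t)) (0, h))) (at t)" by simp
    moreover have "(\<lambda>h. blinfun_apply (F (x, t)) (0, h)) = (\<lambda>h. h *\<^sub>R blinfun_apply (F (x, t)) (0, 1))"
    proof
      show "blinfun_apply (F (x, t)) (0, h) = h *\<^sub>R blinfun_apply (F (x, t)) (0, 1)" for h
        using blinfun.scaleR_right[of "F (x, t)" h "(0, 1)"] by simp
    qed
    ultimately show "((\<lambda>s. f x s) has_vector_derivative blinfun_apply (F (x, t)) (0, 1)) (at t)"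
      by (simp only: has_vector_derivative_def)
  qed
qed

text \<open>The spatial estimates need an open neighbourhood of closure U at one fixed time. It is
  the preimage of the space-time neighbourhood, and the slice derivative is the full one composed
  with the embedding h -> (h, 0), which keeps it continuous in operator norm.\<close>

lemma C1_on_slice:
  fixes f :: "'a::euclidean_space \<Rightarrow> real \<Rightarrow> 'b::real_normed_vector"
  assumes "open S" "C \<times> {t} \<subseteq> S" "C1_on S (\<lambda>(x, t). f x t)"
  obtains S' f' where "open S'" "C \<subseteq> S'"
    "\<And>x. x \<in> S' \<Longrightarrow> ((\<lambda>y. f y t) has_derivative blinfun_apply (f' x)) (at x)" "continuous_on S' f'"
proof -
  obtain F :: "'a \<times> real \<Rightarrow> ('a \<times> real) \<Rightarrow>\<^sub>L 'b" where F0: "continuous_on S F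
    \<and> (\<forall>x t. (x, t) \<in> S \<longrightarrow> ((\<lambda>y. f y t) has_derivative (\<lambda>h. blinfun_apply (F (x, t)) (h, 0))) (at x))
    \<and> (\<forall>x t. (x, t) \<in> S \<longrightarrow> ((\<lambda>s. f x s) has_vector_derivative blinfun_apply (F (x, t)) (0, 1)) (at t))"
    using C1_on_partial_derivatives[OF assms(3)] by (rule exE)
  note F = F0[THEN conjunct1] F0[THEN conjunct2, THEN conjunct1, rule_format]
  define i :: "'a \<Rightarrow>\<^sub>L ('a \<times> real)" where "i = Blinfun (\<lambda>h. (h, 0))"
  have i: "blinfun_apply i h = (h, 0)" for h
    unfolding i_def by (subst bounded_linear_Blinfun_apply) (auto intro!: bounded_linear_Pair bounded_linear_ident bounded_linear_zero)
  define S' where "S' = (\<lambda>x. (x, t)) -` S"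
  show ?thesis
  proof (rule that[of S' "\<lambda>x. F (x, t) o\<^sub>L i"])
    show "open S'" unfolding S'_def using assms(1) by (intro open_vimage continuous_intros)
    show "C \<subseteq> S'" using assms(2) by (auto simp: S'_def)
    show "((\<lambda>y. f y t) has_derivative blinfun_apply (F (x, t) o\<^sub>L i)) (at x)" if "x \<in> S'" for x
    proof -
      have "blinfun_apply (F (x, t) o\<^sub>L i) = (\<lambda>h. blinfun_apply (F (x, t)) (h, 0))"
        by (simp add: fun_eq_iff i)
      then show ?thesis using F(2)[of x t] that by (simp add: S'_def)
    qed
    have "continuous_on S' (\<lambda>x. F (x, t))"
      by (rule continuous_on_compose2[OF F(1)]) (auto simp: S'_def intro!: continuous_intros)
    then show "continuous_on S' (\<lambda>x. F (x, t) o\<^sub>L i)" by (intro continuous_intros)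
  qed
qed

text \<open>Pure bookkeeping, kept abstract so that it is linear in named quantities.
  \<open>A\<close> is \<alpha>(\<alpha> - 1); \<open>X1\<close>, \<open>X3\<close>,
  \<open>X4\<close>, \<open>X5\<close> are the powers of \<kappa> in \<open>Efun\<close>;
  \<open>P1\<close>, \<open>P2\<close>, \<open>P3\<close> its integrals; \<open>t0\<close>,
  \<open>t1\<close>, \<open>t2\<close> the powers of 2 in \<open>Cstar\<close>. All sources are
  enlarged to the common factor M A M2 Vg times the sum of the t's.\<close>

lemma collect_terms:
  fixes V' A c \<kappa> I c13 X1 X3 X4 X5 J M C2 t0 t1 t2 P1 P2 P3 \<mu> V Vg M2 n :: real
  assumes V': "V' \<le> A * (- (c / \<kappa>) * I + c13 * X3 * J + M * X3 * (t1 * P1 + (t1 + 1 / 2) * \<mu>)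
      + M / 4 * (V - 1) + M * t2 * X1 * P2 + M * X4 * P3)"
    and J: "c13 * X3 * J \<le> c / 4 / \<kappa> * I + C2 * X5 * Vg * ((1 + t0) * M2 * (1 + n))"
    and A: "A \<ge> 1" and c: "c > 0" "\<kappa> > 0" and I: "I \<ge> 0"
    and M: "M \<ge> 1" "C2 \<le> M" and X: "0 \<le> X1" "0 \<le> X3" "X3 \<le> X5" "1 \<le> X5" "0 \<le> X4"
    and t: "0 \<le> t0" "1 \<le> t1" "1 / 2 \<le> t2" and P: "0 \<le> P1" "0 \<le> P2" "0 \<le> P3" "0 \<le> n"
    and V: "1 \<le> V" "V \<le> Vg" and \<mu>: "0 \<le> \<mu>" "1 + \<mu> \<le> M2"
  shows "V' + c / 2 / \<kappa> * I \<le> M * A * (1 + t0 + t1 + t2) * M2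
     * (X5 * (1 + n) + X3 * P1 + X1 * P2 + X4 * P3) * Vg"
proof -
  define Z where "Z = M2 * Vg"
  have Z1: "Z \<ge> 1" using V \<mu> mult_mono[of 1 M2 1 Vg] by (simp add: Z_def)
  define S where "S = 1 + t0 + t1 + t2"
  have b1: "X5 * Vg * ((1 + t0) * M2 * (1 + n)) = (1 + t0) * Z * (X5 * (1 + n))"
    by (simp add: Z_def)
  have b2: "t1 * (X3 * P1) \<le> S * Z * (X3 * P1)" "t2 * (X1 * P2) \<le> S * Z * (X1 * P2)" "1 * (X4 * P3) \<le> S * Z * (X4 * P3)"
  proof -
    have "t1 * 1 \<le> S * Z" "t2 * 1 \<le> S * Z" "1 * 1 \<le> S * Z"
      using t Z1 by (intro mult_mono; simp add: S_def)+
    then show "t1 * (X3 * P1) \<le> S * Z * (X3 * P1)" "t2 * (X1 * P2) \<le> S * Z * (X1 * P2)" "1 * (X4 * P3) \<le> S * Z * (X4 * P3)"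
      using X P by (intro mult_right_mono; simp)+
  qed
  \<comment> \<open>The interpolation term uses the share 1 + t0 of S on the factor X5 (1 + n), so
    t1 + t2 is what remains for the volume term and V - 1. They fit because 1/2 \<le> t2 and 1 +
    \<mu> \<le> M2.\<close>
  have b3: "X3 * ((t1 + 1 / 2) * \<mu>) + 1 / 4 * (V - 1) \<le> (t1 + t2) * Z * (X5 * (1 + n))"
  proof -
    have "X3 * ((t1 + 1 / 2) * \<mu>) + 1 / 4 * (V - 1) \<le> X5 * ((t1 + 1 / 2) * \<mu>) * Vg + X5 * (t1 + 1 / 2) * Vg"
    proof (rule add_mono)
      have "X3 * ((t1 + 1 / 2) * \<mu>) \<le> X5 * ((t1 + 1 / 2) * \<mu>)"
        using X t \<mu> by (intro mult_right_mono) auto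
      also have "\<dots> = X5 * ((t1 + 1 / 2) * \<mu>) * 1" by simp
      also have "\<dots> \<le> X5 * ((t1 + 1 / 2) * \<mu>) * Vg"
        using X t \<mu> V by (intro mult_left_mono) auto
      finally show "X3 * ((t1 + 1 / 2) * \<mu>) \<le> X5 * ((t1 + 1 / 2) * \<mu>) * Vg" .
      have "1 * (1 / 4) * (V - 1) \<le> X5 * (t1 + 1 / 2) * Vg"
        using X t V by (intro mult_mono) auto
      then show "1 / 4 * (V - 1) \<le> X5 * (t1 + 1 / 2) * Vg" by simp
    qed
    also have "\<dots> = (t1 + 1 / 2) * X5 * Vg * (1 + \<mu>)" by (simp add: algebra_simps)
    also have "\<dots> \<le> (t1 + t2) * X5 * Vg * M2"
      using t X V \<mu> by (intro mult_mono) auto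
    also have "\<dots> = (t1 + t2) * Z * X5 * 1" by (simp add: Z_def)
    also have "\<dots> \<le> (t1 + t2) * Z * X5 * (1 + n)"
      using t X Z1 P by (intro mult_left_mono mult_nonneg_nonneg) auto
    finally show ?thesis by (simp add: mult_ac)
  qed
  have W0: "X5 * Vg * ((1 + t0) * M2 * (1 + n)) \<ge> 0"
    using X V t \<mu> P by (intro mult_nonneg_nonneg) auto
  have bracket: "X5 * Vg * ((1 + t0) * M2 * (1 + n)) + X3 * (t1 * P1 + (t1 + 1 / 2) * \<mu>)
      + 1 / 4 * (V - 1) + t2 * X1 * P2 + X4 * P3
     \<le> S * Z * (X5 * (1 + n) + X3 * P1 + X1 * P2 + X4 * P3)"
  proof -
    have "S * Z * (X5 * (1 + n) + X3 * P1 + X1 * P2 + X4 * P3)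
      = (1 + t0) * Z * (X5 * (1 + n)) + (t1 + t2) * Z * (X5 * (1 + n))
       + S * Z * (X3 * P1) + S * Z * (X1 * P2) + S * Z * (X4 * P3)"
      by (simp add: S_def distrib_left distrib_right)
    moreover have "X3 * (t1 * P1 + (t1 + 1 / 2) * \<mu>) = t1 * (X3 * P1) + X3 * ((t1 + 1 / 2) * \<mu>)"
      by (simp add: distrib_left)
    moreover have "t2 * X1 * P2 = t2 * (X1 * P2)" by simp
    ultimately show ?thesis using b1 b2 b3 by linarith
  qed
  have "C2 * (X5 * Vg * ((1 + t0) * M2 * (1 + n))) \<le> M * (X5 * Vg * ((1 + t0) * M2 * (1 + n)))"
    using M W0 by (intro mult_right_mono) auto
  then have "c13 * X3 * J \<le> c / 4 / \<kappa> * I + M * (X5 * Vg * ((1 + t0) * M2 * (1 + n)))"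
    using J by (simp add: mult.assoc)
  moreover have "M * (X5 * Vg * ((1 + t0) * M2 * (1 + n))) + M * X3 * (t1 * P1 + (t1 + 1 / 2) * \<mu>)
      + M / 4 * (V - 1) + M * t2 * X1 * P2 + M * X4 * P3
      = M * (X5 * Vg * ((1 + t0) * M2 * (1 + n)) + X3 * (t1 * P1 + (t1 + 1 / 2) * \<mu>)
      + 1 / 4 * (V - 1) + t2 * X1 * P2 + X4 * P3)"
    by (simp add: distrib_left)
  moreover have "M * (X5 * Vg * ((1 + t0) * M2 * (1 + n)) + X3 * (t1 * P1 + (t1 + 1 / 2) * \<mu>)
      + 1 / 4 * (V - 1) + t2 * X1 * P2 + X4 * P3) \<le> M * (S * Z * (X5 * (1 + n) + X3 * P1 + X1 * P2 + X4 * P3))"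
    using M by (intro mult_left_mono bracket) auto
  ultimately have "- (c / \<kappa>) * I + c13 * X3 * J + M * X3 * (t1 * P1 + (t1 + 1 / 2) * \<mu>)
      + M / 4 * (V - 1) + M * t2 * X1 * P2 + M * X4 * P3
    \<le> - (c / \<kappa>) * I + c / 4 / \<kappa> * I + M * (S * Z * (X5 * (1 + n) + X3 * P1 + X1 * P2 + X4 * P3))"
    by linarith
  also have "\<dots> \<le> - (c / 2 / \<kappa> * I) + M * (S * Z * (X5 * (1 + n) + X3 * P1 + X1 * P2 + X4 * P3))"
  proof -
    have "0 \<le> c / \<kappa> * I" using c I by simp
    moreover have "c / 2 / \<kappa> * I = (c / \<kappa> * I) / 2" "c / 4 / \<kappa> * I = (c / \<kappa> * I) / 4" "- (c / \<kappa>) * I = - (c / \<kappa> * I)"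
      by simp_all
    ultimately show ?thesis by linarith
  qed
  finally have "V' \<le> A * (- (c / 2 / \<kappa> * I) + M * (S * Z * (X5 * (1 + n) + X3 * P1 + X1 * P2 + X4 * P3)))"
    using V' A by (meson mult_left_mono order_trans zero_le_one)
  \<comment> \<open>Of the dissipation c, a quarter was spent on absorption and at least c/2 is
    left; A \<ge> 1 lets it stand without the factor A. With c = b/4 this is the b/8 behind the
    factor 8 in the theorem.\<close>
  moreover have "1 * (c / 2 / \<kappa> * I) \<le> A * (c / 2 / \<kappa> * I)"
    using A c I by (intro mult_right_mono) auto
  ultimately have "V' + c / 2 / \<kappa> * I \<le> A * (M * (S * Z * (X5 * (1 + n) + X3 * P1 + X1 * P2 + X4 * P3)))"
    unfolding distrib_left[of A] mult_minus_right by linarith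
  then show ?thesis by (simp add: S_def Z_def mult_ac)
qed

text \<open>Each component of \<phi> X has a partial derivative with integral 0, because the
  function and its whole derivative vanish on the frontier. For the derivative this uses \<alpha> >
  2: then \<phi>' = (\<alpha> - 1)|w|^(\<alpha> - 2) is 0 wherever w is. Summing the product rule
  over the components gives the identity.\<close>

lemma weighted_divergence_theorem:
  fixes U :: "(real^3) set" and w :: "real^3 \<Rightarrow> real" and X :: "real^3 \<Rightarrow> real^3"
  assumes U: "open U" "bounded U" and S: "closure U \<subseteq> S" and \<alpha>: "\<alpha> > 2"
    and w: "\<And>x. x \<in> S \<Longrightarrow> (w has_derivative blinfun_apply (w' x)) (at x)" "continuous_on S w'"
    and X: "\<And>x. x \<in> S \<Longrightarrow> (X has_derivative blinfun_apply (X' x)) (at x)" "continuous_on S X'"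
    and bd: "\<And>x. x \<in> frontier U \<Longrightarrow> w x = 0"
  shows "set_integrable lborel U (\<lambda>x. sgn (w x) * \<bar>w x\<bar> powr (\<alpha> - 1) * div3 X x)"
    and "set_integrable lborel U (\<lambda>x. \<bar>w x\<bar> powr (\<alpha> - 2) * (X x \<bullet> grad3 w x))"
    and "(LINT x:U|lborel. sgn (w x) * \<bar>w x\<bar> powr (\<alpha> - 1) * div3 X x)
      = - (\<alpha> - 1) * (LINT x:U|lborel. \<bar>w x\<bar> powr (\<alpha> - 2) * (X x \<bullet> grad3 w x))"
proof -
  define \<phi> where "\<phi> x = sgn (w x) * \<bar>w x\<bar> powr (\<alpha> - 1)" for x
  define \<phi>' where "\<phi>' x = (\<alpha> - 1) * \<bar>w x\<bar> powr (\<alpha> - 2)" for x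
  have contw: "continuous_on S w"
    using w(1) by (intro has_derivative_continuous_on) (auto intro: has_derivative_at_withinI)
  have contX: "continuous_on S X"
    using X(1) by (intro has_derivative_continuous_on) (auto intro: has_derivative_at_withinI)
  have \<phi>: "(\<phi> has_derivative (\<lambda>h. \<phi>' x * w' x h)) (at x)" if "x \<in> S" for x
    unfolding \<phi>_def \<phi>'_def
    using has_derivative_compose[OF w(1)[OF that] has_real_derivative_sgn_powr[unfolded has_field_derivative_def], of "\<alpha> - 1"] \<alpha>
    by simp
  have c\<phi>: "continuous_on S \<phi>" unfolding \<phi>_def
    by (rule continuous_on_compose2[OF continuous_at_imp_continuous_on contw, of UNIV "\<lambda>z. sgn z * \<bar>z\<bar> powr (\<alpha> - 1)"])
      (use \<alpha> continuous_sgn_powr in auto)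
  have c\<phi>': "continuous_on S \<phi>'" unfolding \<phi>'_def
    by (intro continuous_on_mult continuous_on_const continuous_on_powr_pos continuous_on_rabs contw) (use \<alpha> in auto)
  define f where "f i x = \<phi> x * (X x \<bullet> axis i 1)" for i x
  define f' where "f' i x = \<phi> x *\<^sub>R (blinfun_inner_left (axis i 1) o\<^sub>L X' x) + (\<phi>' x * (X x \<bullet> axis i 1)) *\<^sub>R w' x" for i x
  have f: "(f i has_derivative blinfun_apply (f' i x)) (at x)" if "x \<in> S" for i x
  proof -
    have "((\<lambda>x. X x \<bullet> axis i 1) has_derivative (\<lambda>h. X' x h \<bullet> axis i 1)) (at x)"
      by (rule has_derivative_inner_left[OF X(1)[OF that]])
    from has_derivative_mult[OF \<phi>[OF that] this]
    have "(f i has_derivative (\<lambda>h. \<phi> x * (X' x h \<bullet> axis i 1) + \<phi>' x * w' x h * (X x \<bullet> axis i 1))) (at x)"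
      by (simp add: f_def[abs_def])
    moreover have "blinfun_apply (f' i x) = (\<lambda>h. \<phi> x * (X' x h \<bullet> axis i 1) + \<phi>' x * w' x h * (X x \<bullet> axis i 1))"
      by (simp add: f'_def fun_eq_iff blinfun.add_left blinfun.scaleR_left blinfun_inner_left.rep_eq mult_ac)
    ultimately show ?thesis by simp
  qed
  have f'c: "continuous_on S (f' i)" for i
    unfolding f'_def by (intro continuous_intros c\<phi> c\<phi>' contX w(2) X(2))
  have zero: "(LINT x:U|lborel. f' i x (axis i 1)) = 0" for i
  proof (rule integral_derivative_eq_0[OF U S f f'c])
    fix x assume "x \<in> frontier U"
    then have "w x = 0" by (rule bd)
    then show "f i x = 0" "f' i x = 0" using \<alpha> by (auto simp: f_def f'_def \<phi>_def \<phi>'_def)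
  qed
  have dX: "div3 X x = (\<Sum>i\<in>UNIV. X' x (axis i 1) \<bullet> axis i 1)" if "x \<in> S" for x
  proof -
    have "((\<lambda>y. X y $ i) has_derivative (\<lambda>h. X' x h \<bullet> axis i 1)) (at x)" for i
      using has_derivative_inner_left[OF X(1)[OF that], of "axis i 1"] by (simp add: inner_axis)
    from frechet_derivative_at[OF this, symmetric] show ?thesis by (simp add: div3_def)
  qed
  have gw: "X x \<bullet> grad3 w x = (\<Sum>i\<in>UNIV. (X x \<bullet> axis i 1) * w' x (axis i 1))" if "x \<in> S" for x
    unfolding grad3_eq[OF w(1)[OF that]] by (subst inner_vec_def) (simp add: inner_axis)
  have sumf: "(\<Sum>i\<in>UNIV. f' i x (axis i 1)) = \<phi> x * div3 X x + \<phi>' x * (X x \<bullet> grad3 w x)" if "x \<in> S" for x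
    unfolding dX[OF that] gw[OF that]
    by (simp add: f'_def blinfun.add_left blinfun.scaleR_left blinfun_inner_left.rep_eq sum.distrib sum_distrib_left mult_ac)
  have US: "x \<in> S" if "x \<in> U" for x using that S closure_subset by auto
  have cdiv: "continuous_on S (div3 X)"
    by (rule continuous_on_eq[of S "\<lambda>x. \<Sum>i\<in>UNIV. X' x (axis i 1) \<bullet> axis i 1"])
      (auto simp: dX intro!: continuous_intros X(2))
  have cgw: "continuous_on S (\<lambda>x. X x \<bullet> grad3 w x)"
    by (intro continuous_intros contX continuous_on_grad3[OF w])
  have int1: "set_integrable lborel U (\<lambda>x. \<phi> x * div3 X x)"
    by (intro set_integrable_continuous_closure[OF U] continuous_on_subset[OF _ S] continuous_on_mult c\<phi> cdiv)
  then show "set_integrable lborel U (\<lambda>x. sgn (w x) * \<bar>w x\<bar> powr (\<alpha> - 1) * div3 X x)" by (simp add: \<phi>_def)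
  show int2: "set_integrable lborel U (\<lambda>x. \<bar>w x\<bar> powr (\<alpha> - 2) * (X x \<bullet> grad3 w x))"
    by (intro set_integrable_continuous_closure[OF U] continuous_on_subset[OF _ S] continuous_on_mult cgw
        continuous_on_powr_pos continuous_on_rabs contw) (use \<alpha> in auto)
  have intf: "set_integrable lborel U (\<lambda>x. f' i x (axis i 1))" for i
    by (intro set_integrable_continuous_closure[OF U] continuous_on_subset[OF _ S] continuous_intros f'c)
  have "(LINT x:U|lborel. \<phi> x * div3 X x + \<phi>' x * (X x \<bullet> grad3 w x)) = (LINT x:U|lborel. \<Sum>i\<in>UNIV. f' i x (axis i 1))"
    using U by (intro set_lebesgue_integral_cong) (auto simp: sumf[OF US])
  also have "\<dots> = (\<Sum>i\<in>UNIV. LINT x:U|lborel. f' i x (axis i 1))"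
    using intf unfolding set_lebesgue_integral_def set_integrable_def scaleR_sum_right
    by (rule Bochner_Integration.integral_sum)
  also have "\<dots> = 0" by (simp add: zero)
  finally have 0: "(LINT x:U|lborel. \<phi> x * div3 X x + \<phi>' x * (X x \<bullet> grad3 w x)) = 0" .
  have eq: "\<phi>' x * (X x \<bullet> grad3 w x) = (\<alpha> - 1) * (\<bar>w x\<bar> powr (\<alpha> - 2) * (X x \<bullet> grad3 w x))" for x
    by (simp add: \<phi>'_def)
  have "(LINT x:U|lborel. \<phi> x * div3 X x) + (\<alpha> - 1) * (LINT x:U|lborel. \<bar>w x\<bar> powr (\<alpha> - 2) * (X x \<bullet> grad3 w x)) = 0"
    using 0 int1 int2 unfolding eq by (simp add: set_integral_add)
  then show "(LINT x:U|lborel. sgn (w x) * \<bar>w x\<bar> powr (\<alpha> - 1) * div3 X x)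
      = - (\<alpha> - 1) * (LINT x:U|lborel. \<bar>w x\<bar> powr (\<alpha> - 2) * (X x \<bullet> grad3 w x))"
    unfolding \<phi>_def[symmetric] by linarith
qed

text \<open>The time derivative is continuous for positive times only, so differentiation under the
  integral is carried out on the window [t/2, 2t], which is compact and stays away from time
  0.\<close>

lemma has_real_derivative_integral_abs_powr:
  fixes U :: "'a::euclidean_space set" and w :: "'a \<Rightarrow> real \<Rightarrow> real"
  assumes U: "open U" "bounded U" and t: "t > 0" and \<alpha>: "\<alpha> > 1"
    and w: "continuous_on (closure U \<times> {0..}) (\<lambda>(x, s). w x s)"
    and wt: "continuous_on (closure U \<times> {0<..}) (\<lambda>(x, s). w_t x s)"
    and D: "\<And>x s. x \<in> U \<Longrightarrow> s > 0 \<Longrightarrow> ((\<lambda>s. w x s) has_real_derivative w_t x s) (at s)"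
  shows "((\<lambda>s. LINT x:U|lborel. \<bar>w x s\<bar> powr \<alpha>) has_real_derivative
    (LINT x:U|lborel. \<alpha> * (sgn (w x t) * \<bar>w x t\<bar> powr (\<alpha> - 1)) * w_t x t)) (at t)"
proof (rule has_real_derivative_set_integral[OF U, of "t / 2" t "2 * t"])
  show "continuous_on (closure U) (\<lambda>x. \<bar>w x s\<bar> powr \<alpha>)" if "s \<in> {t / 2..2 * t}" for s
  proof (intro continuous_on_powr_pos continuous_on_rabs)
    show "continuous_on (closure U) (\<lambda>x. w x s)"
      by (rule continuous_on_compose2[OF w, of _ "\<lambda>x. (x, s)", simplified])
        (use that t in \<open>auto intro!: continuous_intros\<close>)
  qed (use \<alpha> in auto)
  have w2: "continuous_on (closure U \<times> {t / 2..2 * t}) (\<lambda>z. w (fst z) (snd z))"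
    using w t by (intro continuous_on_subset[OF w[unfolded case_prod_beta]]) auto
  have wt2: "continuous_on (closure U \<times> {t / 2..2 * t}) (\<lambda>z. w_t (fst z) (snd z))"
    using t by (intro continuous_on_subset[OF wt[unfolded case_prod_beta]]) auto
  have "continuous_on (closure U \<times> {t / 2..2 * t}) (\<lambda>z. sgn (w (fst z) (snd z)) * \<bar>w (fst z) (snd z)\<bar> powr (\<alpha> - 1))"
    by (rule continuous_on_compose2[OF continuous_at_imp_continuous_on w2, of UNIV "\<lambda>z. sgn z * \<bar>z\<bar> powr (\<alpha> - 1)"])
      (use \<alpha> continuous_sgn_powr in auto)
  then show "continuous_on (closure U \<times> {t / 2..2 * t})
      (\<lambda>(x, s). \<alpha> * (sgn (w x s) * \<bar>w x s\<bar> powr (\<alpha> - 1)) * w_t x s)"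
    unfolding case_prod_beta
    by (intro continuous_on_mult[OF continuous_on_mult[OF continuous_on_const] wt2])
  show "((\<lambda>s. \<bar>w x s\<bar> powr \<alpha>) has_real_derivative \<alpha> * (sgn (w x s) * \<bar>w x s\<bar> powr (\<alpha> - 1)) * w_t x s) (at s)"
    if "x \<in> U" "s \<in> {t / 2..2 * t}" for x s
    using DERIV_chain2[OF has_real_derivative_abs_powr[OF \<alpha>] D[OF that(1)], of s] that t by simp
qed (use t in auto)

subsection \<open>The energy inequality\<close>

lemma set_integral_add_mult:
  fixes f g :: "'a \<Rightarrow> real"
  assumes "set_integrable M A f" "set_integrable M A g"
  shows "set_integrable M A (\<lambda>x. c * f x + g x)"
    and "(LINT x:A|M. c * f x + g x) = c * (LINT x:A|M. f x) + (LINT x:A|M. g x)"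
  using assms by (auto simp: set_integral_add)

lemma has_derivative_imp_continuous_on:
  assumes "\<And>x. x \<in> S \<Longrightarrow> (f has_derivative f' x) (at x)" "C \<subseteq> S"
  shows "continuous_on C f"
  using assms by (intro has_derivative_continuous_on) (blast intro: has_derivative_at_withinI)

text \<open>The origin of all exponents. The high power of the interpolation is 3r(\<alpha> - a)/(3
  - q); it exceeds \<alpha> exactly when D > 0, and \<theta> = 12(1 - a)r/D is the solution of the
  degree balance. The assumption on r gives r > 3/5, hence s > 3 and \<alpha> > 3, which the powers
  |w|^(\<alpha> - 2) and the crude constants rely on.\<close>

lemma exponent_relations:
  fixes a r \<alpha> :: real
  defines "\<theta> \<equiv> theta_p a r \<alpha>" and "q \<equiv> r * (2 - a)" and "s \<equiv> 2 * r / (1 - r)"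
  defines "\<eta> \<equiv> (1 - r) * \<theta> / (r * (1 - \<theta>))" and "l \<equiv> \<theta> * (3 - q) / (3 * r)"
  assumes a: "0 < a" "a < 1" and r: "3 / (5 - a) < r" "r < 1"
    and \<alpha>: "\<alpha> \<ge> 2 * r / (1 - r)" "\<alpha> > 3 * r * (4 - 3 * a) / (r * (5 - a) - 3)"
  shows "0 < r" "\<alpha> > 3" "0 < \<theta>" "\<theta> < 1" "1 \<le> s" "s \<le> \<alpha>" "0 < \<eta>" "l < 1"
    and "\<alpha> * (1 - l) + (\<alpha> - a) * \<theta> = \<alpha> + 4 * (1 - a)"
    and "s * \<eta> = 2 * \<theta> / (1 - \<theta>)" "(s + 1) * \<eta> = (1 + r) / r * (\<theta> / (1 - \<theta>))"
    and "\<eta> * (1 - s / \<alpha>) = (\<alpha> * (1 - r) - 2 * r) / (\<alpha> * r) * (\<theta> / (1 - \<theta>))"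
    and "\<eta> * (1 - \<theta>) = \<theta> * (1 - r) / r" "1 / s = (1 - r) / (2 * r)"
    and "(1 - l) / (1 - \<theta>) + s * \<eta> / \<alpha> = 1 + gamma_p a \<alpha> \<theta>" "0 < gamma_p a \<alpha> \<theta>"
proof -
  have r5: "3 < r * (5 - a)" using r a by (simp add: field_simps)
  have r35: "r > 3 / 5"
  proof -
    have "3 / 5 \<le> 3 / (5 - a)" using a by (intro divide_left_mono) auto
    with r show ?thesis by simp
  qed
  then show r0: "0 < r" by simp
  have s3: "s > 3" using r35 r by (simp add: s_def field_simps)
  then show \<alpha>3: "\<alpha> > 3" using \<alpha>(1) by (simp add: s_def)
  show "1 \<le> s" using s3 by simp
  show "s \<le> \<alpha>" using \<alpha>(1) by (simp add: s_def)
  define D where "D = \<alpha> * ((5 - a) * r - 3) - 3 * a * r"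
  have D1: "D > 12 * (1 - a) * r"
    using \<alpha>(2) r5 by (simp add: D_def field_simps)
  have ar: "0 < 12 * (1 - a) * r" using a r0 by simp
  have \<theta>D: "\<theta> = 12 * (1 - a) * r / D" by (simp add: \<theta>_def theta_p_def D_def)
  show \<theta>0: "0 < \<theta>" using \<theta>D D1 ar by simp
  show \<theta>1: "\<theta> < 1" using \<theta>D D1 ar by simp
  show "0 < \<eta>" using \<theta>0 \<theta>1 r0 r by (simp add: \<eta>_def)
  have \<theta>D': "\<theta> * D = 12 * (1 - a) * r" using \<theta>D D1 ar by simp
  show interp: "\<alpha> * (1 - l) + (\<alpha> - a) * \<theta> = \<alpha> + 4 * (1 - a)"
  proof -
    \<comment> \<open>After clearing the denominator 3r of l, the bracket is exactly D, so the
      degree balance reduces to the definition of \<theta>.\<close>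
    have "(\<alpha> * (1 - l) + (\<alpha> - a) * \<theta> - \<alpha>) * (3 * r) = \<theta> * (3 * r * (\<alpha> - a) - \<alpha> * (3 - r * (2 - a)))"
      using r0 by (simp add: l_def q_def field_simps)
    also have "\<dots> = \<theta> * D" by (simp add: D_def algebra_simps)
    also have "\<dots> = (4 * (1 - a)) * (3 * r)" using \<theta>D' by simp
    finally show ?thesis using r0 by simp
  qed
  show "l < 1"
  proof -
    have "(\<alpha> - a) * \<theta> < \<alpha> * 1" using \<alpha>3 a \<theta>0 \<theta>1 by (intro mult_strict_mono) auto
    with interp have "0 < \<alpha> * (1 - l)" using a by simp
    then show ?thesis using \<alpha>3 by (simp add: zero_less_mult_iff)
  qed
  have n1: "1 - \<theta> \<noteq> 0" "1 - r \<noteq> 0" "r \<noteq> 0" "\<alpha> \<noteq> 0" using \<theta>1 r r0 \<alpha>3 by auto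
  show s\<eta>: "s * \<eta> = 2 * \<theta> / (1 - \<theta>)" using n1 by (simp add: s_def \<eta>_def)
  have \<eta>2: "\<eta> = (1 - r) / r * (\<theta> / (1 - \<theta>))" by (simp add: \<eta>_def)
  have "(s + 1) * \<eta> = (2 + (1 - r) / r) * (\<theta> / (1 - \<theta>))"
    unfolding distrib_right s\<eta> by (simp add: \<eta>2)
  also have "2 + (1 - r) / r = (1 + r) / r" using n1 by (simp add: field_simps)
  finally show "(s + 1) * \<eta> = (1 + r) / r * (\<theta> / (1 - \<theta>))" .
  have "\<eta> * (1 - s / \<alpha>) = \<eta> - s * \<eta> / \<alpha>" by (simp add: algebra_simps)
  also have "\<dots> = ((1 - r) / r - 2 / \<alpha>) * (\<theta> / (1 - \<theta>))" 
  proof -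
    have "x * y - 2 * y / z = (x - 2 / z) * y" for x y z :: real
      by (simp add: left_diff_distrib)
    moreover have "s * \<eta> = 2 * (\<theta> / (1 - \<theta>))" using s\<eta> by simp
    ultimately show ?thesis unfolding \<eta>2 by (simp only:)
  qed
  also have "(1 - r) / r - 2 / \<alpha> = (\<alpha> * (1 - r) - 2 * r) / (\<alpha> * r)" using n1 by (simp add: field_simps)
  finally show "\<eta> * (1 - s / \<alpha>) = (\<alpha> * (1 - r) - 2 * r) / (\<alpha> * r) * (\<theta> / (1 - \<theta>))" .
  show "\<eta> * (1 - \<theta>) = \<theta> * (1 - r) / r" using n1 by (simp add: \<eta>_def)
  show "1 / s = (1 - r) / (2 * r)" by (simp add: s_def)
  have "\<alpha> * (1 - l) = \<alpha> * (1 - \<theta>) + (4 * (1 - a) + a * \<theta>)" using interp by (simp add: algebra_simps)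
  then have "1 - l = (1 - \<theta>) + (4 * (1 - a) + a * \<theta>) / \<alpha>" using n1 by (simp add: field_simps)
  then have "(1 - l) / (1 - \<theta>) = ((1 - \<theta>) + (4 * (1 - a) + a * \<theta>) / \<alpha>) / (1 - \<theta>)"
    by (simp only:)
  also have "\<dots> = (1 - \<theta>) / (1 - \<theta>) + (4 * (1 - a) + a * \<theta>) / \<alpha> / (1 - \<theta>)"
    by (rule add_divide_distrib)
  also have "(1 - \<theta>) / (1 - \<theta>) = 1" using n1 by simp
  finally show "(1 - l) / (1 - \<theta>) + s * \<eta> / \<alpha> = 1 + gamma_p a \<alpha> \<theta>"
    unfolding s\<eta> by (simp add: gamma_p_def mu_p_def mult_ac)
  have "0 < mu_p a \<theta>" unfolding mu_p_def using a \<theta>0 \<theta>1 by (intro divide_pos_pos add_pos_pos) auto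
  then show "0 < gamma_p a \<alpha> \<theta>" unfolding gamma_p_def
    using \<theta>0 \<theta>1 \<alpha>3 by (intro add_pos_pos divide_pos_pos) auto
qed

text \<open>The Sobolev inequality is stated for functions that are C1 near the closure and vanish
  on the frontier, the class of the function |w|^m to which it is applied. \<open>alb_pos\<close>
  and \<open>alb_le\<close> are the form in which the flux estimates use the strict monotonicity of
  the exponents.\<close>

locale forchheimer_flow =
  fixes N :: nat and alb ac :: "nat \<Rightarrow> real" and Rs G Om :: real and k :: "real^3"
    and e0 :: "real \<Rightarrow> real^3" and U :: "(real^3) set" and cbar rs alpha :: real
    and u0 :: "real^3 \<Rightarrow> real" and psi Psi u :: "real^3 \<Rightarrow> real \<Rightarrow> real"
  assumes N: "N \<ge> 1"
    and alb_pos: "\<And>i. i \<in> {1..N} \<Longrightarrow> alb i > 0" and alb_le: "\<And>i. i \<in> {1..N} \<Longrightarrow> alb i \<le> alb N"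
    and ac_pos: "\<And>i. i \<le> N \<Longrightarrow> ac i > 0"
    and k_unit: "norm k = 1" and Rs: "Rs \<ge> 0"
    and G: "G \<ge> 0" and e0_unit: "\<And>t. norm (e0 t) = 1"
    and U: "open U" "bounded U"
    and cbar_pos: "cbar > 0"
    and sobolev: "\<And>f. (\<exists>S. open S \<and> closure U \<subseteq> S \<and> C1_on S f) \<Longrightarrow> (\<forall>x\<in>frontier U. f x = 0) \<Longrightarrow>
        (LINT x:U|lborel. \<bar>f x\<bar> powr (3 * (rs * (2 - aexp N alb)) / (3 - rs * (2 - aexp N alb))))
          powr ((3 - rs * (2 - aexp N alb)) / (3 * (rs * (2 - aexp N alb))))
          \<le> cbar * (LINT x:U|lborel. norm (grad3 f x) powr (rs * (2 - aexp N alb))) powr (1 / (rs * (2 - aexp N alb)))"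
    and rs: "3 / (5 - aexp N alb) < rs" "rs < 1"
    and alpha: "alpha \<ge> 2 * rs / (1 - rs)"
      "alpha > 3 * rs * (4 - 3 * aexp N alb) / (rs * (5 - aexp N alb) - 3)"
    and sol: "regular_solution N alb ac Rs k G Om e0 U u0 psi u"
    and u_nonneg: "\<And>x t. x \<in> closure U \<Longrightarrow> t \<ge> 0 \<Longrightarrow> u x t \<ge> 0"
    and ext: "regular_extension U psi Psi"
begin

abbreviation "a \<equiv> aexp N alb"
abbreviation "\<theta> \<equiv> theta_p (aexp N alb) rs alpha"
abbreviation "\<kappa> \<equiv> chistar N ac Rs G Om U"
abbreviation "b \<equiv> c4 (aexp N alb) (ac 0) (ac N) (alb N)"
abbreviation "C11 \<equiv> c11 (aexp N alb) (ac 0) (ac N) (alb N) (chi0 N ac)"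
abbreviation "C12 \<equiv> c12 (aexp N alb) (ac 0) (ac N) (alb N)"
abbreviation "C13 \<equiv> c13 (aexp N alb) (ac 0) (ac N) (alb N) (chi0 N ac)"

lemma a01: "0 < a" "a < 1"
  using alb_pos[of N] N by (auto simp: aexp_def)

lemmas exps = exponent_relations[OF a01 rs alpha]

lemma kappa_bounds: "\<kappa> \<ge> 1" "Rs\<^sup>2 \<le> \<kappa>" "(chi0 N ac)\<^sup>2 \<le> \<kappa>" "G + Om\<^sup>2 * rU U \<le> \<kappa>"
  unfolding chistar_def by auto

lemma Zfield_bound:
  assumes "x \<in> U"
  shows "norm (Zfield G Om k e0 x t) \<le> \<kappa>"
proof -
  have "norm x \<le> rU U"
    unfolding rU_def
  proof (rule cSup_upper)
    show "norm x \<in> norm ` closure U" using assms closure_subset by auto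
    have "bounded (closure U)" by (rule bounded_closure[OF U(2)])
    then obtain R where "\<forall>x\<in>closure U. norm x \<le> R" unfolding bounded_iff by blast
    then show "bdd_above (norm ` closure U)" by (intro bdd_aboveI) auto
  qed
  then have J: "norm (Jop k (Jop k x)) \<le> rU U"
    using norm_Jop_le[OF k_unit, of "Jop k x"] norm_Jop_le[OF k_unit, of x] by linarith
  have "norm (Zfield G Om k e0 x t) \<le> norm (G *\<^sub>R e0 t) + norm (Om\<^sup>2 *\<^sub>R Jop k (Jop k x))"
    unfolding Zfield_def by (metis norm_minus_cancel norm_triangle_ineq)
  also have "\<dots> \<le> G + Om\<^sup>2 * rU U"
    using G e0_unit[of t] J by (simp add: mult_left_mono)
  finally show ?thesis using kappa_bounds(4) by linarith
qed

text \<open>Both \<open>chi0 N ac\<close> and \<open>Rs\<close> are at most sqrt \<kappa>, so their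
  combination with weights 1 and z is at most sqrt \<kappa> (1 + z). This makes \<kappa> (1 + z)^2
  an admissible K in the coercivity bound and is the reason for the two squares in
  \<open>chistar\<close>.\<close>

lemma kappa_weight:
  assumes "z \<ge> 0"
  shows "\<kappa> * (1 + z)\<^sup>2 \<ge> 1" "(chi0 N ac + \<bar>Rs * z\<bar>)\<^sup>2 \<le> \<kappa> * (1 + z)\<^sup>2"
proof -
  show "\<kappa> * (1 + z)\<^sup>2 \<ge> 1"
    using mult_mono[of 1 \<kappa> 1 "(1 + z)\<^sup>2"] one_le_power[of "1 + z" 2] kappa_bounds(1) assms by simp
  have "chi0 N ac \<le> sqrt \<kappa>" "Rs \<le> sqrt \<kappa>"
    using kappa_bounds by (auto intro: real_le_rsqrt)
  then have "chi0 N ac + Rs * z \<le> sqrt \<kappa> + sqrt \<kappa> * z"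
    using assms by (intro add_mono mult_right_mono) auto
  moreover have "0 \<le> chi0 N ac"
    unfolding chi0_def using ac_pos by (intro sum_nonneg) (auto intro: less_imp_le)
  ultimately have "(chi0 N ac + \<bar>Rs * z\<bar>)\<^sup>2 \<le> (sqrt \<kappa> * (1 + z))\<^sup>2"
    using Rs assms by (intro power_mono) (auto simp: distrib_left)
  also have "\<dots> = \<kappa> * (1 + z)\<^sup>2" using kappa_bounds(1) by (simp add: power_mult_distrib)
  finally show "(chi0 N ac + \<bar>Rs * z\<bar>)\<^sup>2 \<le> \<kappa> * (1 + z)\<^sup>2" .
qed

lemma b_bounds: "0 < b" "b \<le> 1" "b \<le> ac 0" "b \<le> ac N"
proof -
  have "0 \<le> alb N" using alb_pos[of N] N by simp
  then show "0 < b" "b \<le> 1" "b \<le> ac 0" "b \<le> ac N"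
    using c4_bounds[of a "ac 0" "ac N" "alb N"] a01 ac_pos by auto
qed

lemma c3_pos: "0 < c3 a (ac N)" using ac_pos[of N] by (simp add: c3_def)

text \<open>The first summand of \<open>c11\<close> equals 8^(1 - a) b/2, since 2^(-a) is half of
  2^(1 - a), and \<open>c10\<close> equals b/4; the other two summands are nonnegative
  slack.\<close>

lemma constants:
  shows "C12 = 2 * 4 powr (1 - a) * c3 a (ac N) * (1 + (32 * c3 a (ac N) / b) powr (1 - a))"
    and "C11 \<ge> 8 powr (1 - a) * b / 2 + b / 4" "C13 \<ge> 3 * C12 + 2 * C11 + 1" "C13 > 0"
proof -
  show "C12 = 2 * 4 powr (1 - a) * c3 a (ac N) * (1 + (32 * c3 a (ac N) / b) powr (1 - a))"
    by (simp add: c12_def)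
  then have C12: "C12 \<ge> 0" using c3_pos by simp
  have "4 powr (1 - a) * 2 powr (- a) = 4 powr (1 - a) * 2 powr (1 - a) / (2::real)"
    by (simp add: powr_diff powr_minus field_simps)
  also have "\<dots> = 8 powr (1 - a) / 2" by (simp flip: powr_mult)
  finally have "4 powr (1 - a) * c5 a (ac 0) (ac N) (alb N) = 8 powr (1 - a) * b / 2"
    by (simp add: c5_def)
  moreover have "c9 a (ac 0) (ac N) (alb N) (chi0 N ac) \<ge> 0" using b_bounds(1) by (simp add: c9_def c5_def)
  moreover have "2 * c3 a (ac N) * (32 * c3 a (ac N) / b) powr (1 - a) \<ge> 0" using c3_pos by simp
  ultimately show C11: "C11 \<ge> 8 powr (1 - a) * b / 2 + b / 4" by (simp add: c11_def c10_def)
  show "C13 \<ge> 3 * C12 + 2 * C11 + 1" using C12 by (simp add: c13_def)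
  moreover have "C11 \<ge> 0" using C11 b_bounds(1) by (smt (verit) divide_nonneg_nonneg mult_nonneg_nonneg powr_ge_zero)
  ultimately show "C13 > 0" using C12 by linarith
qed

text \<open>The gradient of \<open>u\<close> splits as \<open>\<nabla>(u - \<Psi>) + \<nabla>\<Psi>\<close>; the flux dissipates the first part and
  the second joins the gravity and centrifugal terms as a source.\<close>
lemma pointwise_energy_bound:
  fixes M T :: real and Y D X :: "real^3"
  assumes M: "M \<ge> 1" "M \<ge> 2 * C11" "M \<ge> 4 * C12 + C11"
    and x: "x \<in> U" and z: "z \<ge> 0" "z \<le> w + v" "w \<ge> 0" "v \<ge> 0" and T: "T \<ge> 0"
    and X: "X = Xmap N alb ac Rs k z (Y + D + z\<^sup>2 *\<^sub>R Zfield G Om k e0 x t)"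
  defines "p \<equiv> alpha + 4 * (1 - a)"
  shows "- (w powr (alpha - 2) * (X \<bullet> Y)) + T * w powr (alpha - 1) / (alpha - 1)
    \<le> - (b / 4 / \<kappa>) * ((1 + z) powr (- 2) * norm Y powr (2 - a) * w powr (alpha - 2))
      + (C13 * \<kappa> powr (3 - 2 * a) * w powr p
      + (M * \<kappa> powr (3 - 2 * a) * (2 powr (p - 1) * v powr p + 2 powr (p - 1) + 1 / 2)
      + (M / 4 * w powr alpha
      + (M * 2 powr (p / 2 - 1) * \<kappa> powr (1 - a) * norm D powr (p / 2)
      + M * \<kappa> powr (- (3 - 2 * a) * (alpha - 1) / (5 - 4 * a)) * T powr (p / (5 - 4 * a))))))"
proof -
  let ?Z = "D + z\<^sup>2 *\<^sub>R Zfield G Om k e0 x t"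
  let ?K = "\<kappa> * (1 + z)\<^sup>2"
  have YZ: "Y + D + z\<^sup>2 *\<^sub>R Zfield G Om k e0 x t = Y + ?Z" by simp
  note Xb = Xmap_bounds[where N = N and ac = ac and alb = alb, OF N ac_pos alb_pos alb_le k_unit kappa_weight[OF z(1)] b_bounds(1,3,4),
      of "Y + ?Z"]
  have "norm ?Z \<le> norm D + z\<^sup>2 * norm (Zfield G Om k e0 x t)"
    using norm_triangle_ineq[of D "z\<^sup>2 *\<^sub>R Zfield G Om k e0 x t"] by simp
  also have "\<dots> \<le> norm D + z\<^sup>2 * \<kappa>" using Zfield_bound[OF x] by (intro add_left_mono mult_left_mono) auto
  finally have Z: "norm ?Z \<le> \<kappa> * z\<^sup>2 + norm D" by (simp add: mult.commute)
  have "- (X \<bullet> Y) \<le> - (b/4) / ?K * norm Y powr (2 - a) + (b/4) / ?K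
     + (c3 a (ac N) * (2 * c3 a (ac N) * ?K / b) powr (1 - a) + b / (2 * ?K)) * (\<kappa> * z\<^sup>2 + norm D) powr (2 - a)"
    by (rule flux_dissipation_bound[OF a01 kappa_weight(1)[OF z(1)] b_bounds(1) c3_pos _ _ Z])
      (use Xb in \<open>simp_all add: X YZ\<close>)
  then have "- (X \<bullet> Y) * w powr (alpha - 2) \<le> (- (b/4) / ?K * norm Y powr (2 - a) + (b/4) / ?K
     + (c3 a (ac N) * (2 * c3 a (ac N) * ?K / b) powr (1 - a) + b / (2 * ?K)) * (\<kappa> * z\<^sup>2 + norm D) powr (2 - a))
     * w powr (alpha - 2)"
    by (rule mult_right_mono) simp
  also have "\<dots> = - (b/4) / ?K * norm Y powr (2 - a) * w powr (alpha - 2) +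
     ((c3 a (ac N) * (2 * c3 a (ac N) * ?K / b) powr (1 - a) + b / (2 * ?K)) * (\<kappa> * z\<^sup>2 + norm D) powr (2 - a)
      + (b/4) / ?K) * w powr (alpha - 2)"
    by (simp only: distrib_right distrib_left add_ac)
  finally have 1: "- (X \<bullet> Y) * w powr (alpha - 2) \<le> \<dots>" .
  \<comment> \<open>Here 1/K is split into 1/\<kappa> and the weight (1 + z)^(-2) of the
    dissipation.\<close>
  have 2: "- (b/4) / ?K * norm Y powr (2 - a) * w powr (alpha - 2)
     = - (b / 4 / \<kappa>) * ((1 + z) powr (- 2) * norm Y powr (2 - a) * w powr (alpha - 2))"
  proof -
    have "(1 + z) powr (- 2) = 1 / (1 + z)\<^sup>2" using z(1) powr_minus_divide[of "1 + z" 2] by simp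
    moreover have "- (c/4) / (d * e) * y * v = - (c / 4 / d) * (1 / e * y * v)" for c d e y v :: real by simp
    ultimately show ?thesis by (simp only:)
  qed
  note 3 = source_terms_bound[OF a01 exps(2) kappa_bounds(1) z(1,3,4) norm_ge_zero[of D] T z(2)
      b_bounds(1,2) c3_pos constants(1,2,3) M]
  have 4: "- (w powr (alpha - 2) * (X \<bullet> Y)) = - (X \<bullet> Y) * w powr (alpha - 2)" by simp
  have comb: "A + t \<le> P + (r1 + (r2 + (r3 + (r4 + r5))))"
    if "A \<le> P + Q" "Q + t \<le> r1 + r2 + r3 + r4 + r5" for A P Q t r1 r2 r3 r4 r5 :: real
    using that by linarith
  show ?thesis unfolding 4 p_def by (rule comb[OF 1[unfolded 2] 3])
qed

abbreviation "energy t \<equiv> 1 + (LINT x:U|lborel. \<bar>u x t - Psi x t\<bar> powr alpha)"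
abbreviation "dissipation t \<equiv> (LINT x:U|lborel. (1 + u x t) powr (- 2)
    * norm (grad3 (\<lambda>y. u y t - Psi y t) x) powr (2 - a) * \<bar>u x t - Psi x t\<bar> powr (alpha - 2))"
abbreviation "C2 \<equiv> C2c (aexp N alb) (ac 0) (ac N) (alb N) (chi0 N ac) rs alpha cbar (measure lborel U) (theta_p (aexp N alb) rs alpha)"
abbreviation "Cs \<equiv> Cstar (aexp N alb) (ac 0) (ac N) (alb N) (chi0 N ac) rs alpha cbar (measure lborel U) (theta_p (aexp N alb) rs alpha)"
abbreviation "\<gamma> \<equiv> gamma_p (aexp N alb) alpha (theta_p (aexp N alb) rs alpha)"
abbreviation "E \<equiv> Efun (chistar N ac Rs G Om U) (aexp N alb) (theta_p (aexp N alb) rs alpha) rs alpha U Psi"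

text \<open>Interpolation, absorption and the bound on the weight integral are composed. The
  constant \<open>C1c\<close> is what leaves this chain: the factor 2^((1 + r)/r) and the volume
  power come from the weight integral, the factor with \<open>cbar\<close> from the Sobolev step,
  and each carries the exponent \<theta>/(1 - \<theta>).\<close>

lemma absorbed_power_integral:
  assumes S: "open S" "closure U \<subseteq> S"
    and w: "\<And>x. x \<in> S \<Longrightarrow> (w has_derivative blinfun_apply (w' x)) (at x)" "continuous_on S w'"
    and bd: "\<And>x. x \<in> frontier U \<Longrightarrow> w x = 0"
    and z: "continuous_on (closure U) z" "\<And>x. x \<in> closure U \<Longrightarrow> z x \<ge> 0"
    and v: "continuous_on (closure U) v" and zw: "\<And>x. x \<in> U \<Longrightarrow> z x \<le> \<bar>w x\<bar> + \<bar>v x\<bar>"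
  shows "C13 * \<kappa> powr (3 - 2 * a) * (LINT x:U|lborel. \<bar>w x\<bar> powr (alpha + 4 * (1 - a)))
    \<le> b / 4 / 4 / \<kappa> * (LINT x:U|lborel. (1 + z x) powr (- 2) * norm (grad3 w x) powr (2 - a) * \<bar>w x\<bar> powr (alpha - 2))
      + C2 * \<kappa> powr mubar_p a \<theta> * (1 + (LINT x:U|lborel. \<bar>w x\<bar> powr alpha)) powr (1 + \<gamma>)
        * ((1 + 2 powr (2 * \<theta> / (1 - \<theta>))) * (1 + measure lborel U) powr (max 1 ((1 - rs) * \<theta> / (rs * (1 - \<theta>))))
           * (1 + ((LINT x:U|lborel. \<bar>v x\<bar> powr (2 * rs / (1 - rs))) powr ((1 - rs) / (2 * rs))) powr (2 * \<theta> / (1 - \<theta>))))"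
proof -
  define s \<eta> q l where "s = 2 * rs / (1 - rs)" and "\<eta> = (1 - rs) * \<theta> / (rs * (1 - \<theta>))"
    and "q = rs * (2 - a)" and "l = \<theta> * (3 - q) / (3 * rs)"
  note ex = exps[folded s_def q_def, folded \<eta>_def l_def]
  define m where "m = (alpha - a) / (2 - a)"
  define Gc where "Gc = (cbar * m) powr (2 - a)"
  define A I W J where "A = (LINT x:U|lborel. \<bar>w x\<bar> powr alpha)"
    and "I = (LINT x:U|lborel. (1 + z x) powr (- 2) * norm (grad3 w x) powr (2 - a) * \<bar>w x\<bar> powr (alpha - 2))"
    and "W = (LINT x:U|lborel. (1 + z x) powr s)" and "J = (LINT x:U|lborel. \<bar>w x\<bar> powr (alpha + 4 * (1 - a)))"
  define \<mu> V where "\<mu> = measure lborel U" and "V = 1 + A"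
  define \<sigma> where "\<sigma> = \<theta> / (1 - \<theta>)"
  define \<zeta> where "\<zeta> = (alpha * (1 - rs) - 2 * rs) / (alpha * rs)"
  have nn: "A \<ge> 0" "I \<ge> 0" "W \<ge> 0" "Gc \<ge> 0" "\<mu> \<ge> 0"
    by (auto simp: A_def I_def W_def Gc_def \<mu>_def intro!: set_integral_nonneg)
  then have V1: "V \<ge> 1" by (simp add: V_def)
  have wc: "continuous_on (closure U) w"
    using w(1) S(2) by (intro has_derivative_continuous_on) (auto intro: has_derivative_at_withinI)
  have "J \<le> A powr (1 - l) * (cbar * m) powr ((2 - a) * \<theta>) * I powr \<theta> * W powr (\<theta> * (1 - rs) / rs)"
    unfolding J_def A_def I_def W_def m_def s_def l_def q_def
    by (rule weighted_interpolation[OF U S w bd z a01 ex(1) rs(2) ex(2) cbar_pos sobolev ex(3) ex(8)[unfolded l_def q_def]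
        ex(9)[unfolded l_def q_def]])
  also have "\<dots> = A powr (1 - l) * Gc powr \<theta> * I powr \<theta> * W powr (\<eta> * (1 - \<theta>))"
    by (simp add: Gc_def powr_powr ex(13))
  finally have Jle: "J \<le> A powr (1 - l) * Gc powr \<theta> * I powr \<theta> * W powr (\<eta> * (1 - \<theta>))" .
  have \<kappa>0: "\<kappa> > 0" using kappa_bounds(1) by simp
  \<comment> \<open>The pointwise bound provides dissipation with coefficient b/4, of which a
    quarter is given up. The ratio C13/(b/16) is then 4 c13/c10, the one appearing in
    \<open>C2c\<close>.\<close>
  have \<epsilon>: "b / 4 / 4 > 0" using b_bounds(1) by simp
  have 1: "C13 * \<kappa> powr (3 - 2 * a) * J \<le> b / 4 / 4 / \<kappa> * I + C13 * (C13 / (b / 4 / 4)) powr \<sigma> * \<kappa> powr mubar_p a \<theta>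
      * A powr ((1 - l) / (1 - \<theta>)) * Gc powr \<sigma> * W powr \<eta>"
    unfolding \<sigma>_def mubar_p_def
    by (rule absorb_interpolation[OF ex(3,4) constants(4) \<epsilon> \<kappa>0 nn(2,4,3,1) Jle])
  define n where "n = ((LINT x:U|lborel. \<bar>v x\<bar> powr s) powr (1 / s)) powr (s * \<eta>)"
  define R where "R = (1 + 2 powr (s * \<eta>)) * (1 + \<mu>) powr (max 1 \<eta>) * (1 + n)"
  have R0: "R \<ge> 0" by (simp add: R_def n_def)
  have W\<eta>: "W powr \<eta> \<le> 2 powr ((s + 1) * \<eta>) * (1 + \<mu>) powr (\<eta> * (1 - s / alpha)) * V powr (s * \<eta> / alpha) * R"
    unfolding W_def V_def A_def R_def n_def \<mu>_def
    by (rule shifted_power_integral_bound[OF U wc v z(1) _ zw ex(5,6,7)]) (use z(2) closure_subset in auto)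
  have "A powr ((1 - l) / (1 - \<theta>)) \<le> V powr ((1 - l) / (1 - \<theta>))"
    using nn ex(4,8) by (intro powr_mono2) (auto simp: V_def)
  then have "C13 * (C13 / (b / 4 / 4)) powr \<sigma> * \<kappa> powr mubar_p a \<theta> * A powr ((1 - l) / (1 - \<theta>)) * Gc powr \<sigma> * W powr \<eta>
     \<le> C13 * (C13 / (b / 4 / 4)) powr \<sigma> * \<kappa> powr mubar_p a \<theta> * V powr ((1 - l) / (1 - \<theta>)) * Gc powr \<sigma>
      * (2 powr ((s + 1) * \<eta>) * (1 + \<mu>) powr (\<eta> * (1 - s / alpha)) * V powr (s * \<eta> / alpha) * R)"
    using W\<eta> constants(4) by (intro mult_mono mult_nonneg_nonneg) auto
  also have "\<dots> = (C13 * (2 powr ((s + 1) * \<eta>) * Gc powr \<sigma> * (1 + \<mu>) powr (\<eta> * (1 - s / alpha)))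
        * (C13 / (b / 4 / 4)) powr \<sigma>)
      * \<kappa> powr mubar_p a \<theta> * (V powr ((1 - l) / (1 - \<theta>)) * V powr (s * \<eta> / alpha)) * R"
    by (simp only: mult_ac)
  \<comment> \<open>In \<gamma>, the summand \<mu>/\<alpha> comes from the first exponent and
    2\<theta>/(\<alpha>(1 - \<theta>)) from the second.\<close>
  also have "V powr ((1 - l) / (1 - \<theta>)) * V powr (s * \<eta> / alpha) = V powr (1 + \<gamma>)"
    unfolding powr_add[symmetric] ex(15) ..
  also have "C13 * (2 powr ((s + 1) * \<eta>) * Gc powr \<sigma> * (1 + \<mu>) powr (\<eta> * (1 - s / alpha))) * (C13 / (b / 4 / 4)) powr \<sigma> = C2"
  proof -
    have "C13 / (b / 4 / 4) = 4 * C13 / c10 a (ac 0) (ac N) (alb N)"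
      by (simp add: c10_def)
    moreover have "2 powr ((s + 1) * \<eta>) * Gc powr \<sigma> * (1 + \<mu>) powr (\<eta> * (1 - s / alpha)) = C1c a rs alpha cbar \<mu> \<theta>"
      unfolding ex(11,12) C1c_def powr_mult \<sigma>_def[symmetric] powr_powr Gc_def m_def times_divide_eq_right[symmetric]
      by (simp add: powr_mult powr_powr)
    ultimately show ?thesis by (simp only: C2c_def \<sigma>_def[symmetric] \<mu>_def[symmetric])
  qed
  finally have 2: "C13 * (C13 / (b / 4 / 4)) powr \<sigma> * \<kappa> powr mubar_p a \<theta> * A powr ((1 - l) / (1 - \<theta>)) * Gc powr \<sigma> * W powr \<eta>
     \<le> C2 * \<kappa> powr mubar_p a \<theta> * V powr (1 + \<gamma>) * R" .
  have "C13 * \<kappa> powr (3 - 2 * a) * J \<le> b / 4 / 4 / \<kappa> * I + C2 * \<kappa> powr mubar_p a \<theta> * V powr (1 + \<gamma>) * R"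
    using 1 2 by linarith
  then show ?thesis
    unfolding R_def n_def ex(10) ex(14) unfolding J_def I_def V_def A_def \<mu>_def s_def \<eta>_def .
qed

text \<open>The pointwise bound is integrated after testing the equation. The second claim
  identifies the nonnegative inner integral of the theorem with the Lebesgue integral
  \<open>dissipation t\<close>: for t > 0 the density is continuous up to the closure, hence
  integrable.\<close>

lemma energy_inequality:
  assumes t: "t > 0"
  shows "\<exists>V'. (energy has_real_derivative V') (at t)
    \<and> V' + b / (8 * \<kappa>) * dissipation t \<le> Cs * E t * energy t powr (1 + \<gamma>)"
    and "(\<integral>\<^sup>+x\<in>U. ennreal ((1 + u x t) powr (- 2) * norm (grad3 (\<lambda>y. u y t - Psi y t) x) powr (2 - a)
        * \<bar>u x t - Psi x t\<bar> powr (alpha - 2)) \<partial>lborel) = ennreal (dissipation t)"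
proof -
  let ?X = "\<lambda>x t. flux N alb ac Rs k G Om e0 u x t"
  from sol obtain Su where Su: "open Su" "closure U \<times> {0<..} \<subseteq> Su" "C1_on Su (\<lambda>(x, t). u x t)"
    unfolding regular_solution_def by blast
  from sol obtain Sx where Sx: "open Sx" "closure U \<times> {0<..} \<subseteq> Sx" "C1_on Sx (\<lambda>(x, t). ?X x t)"
    unfolding regular_solution_def by blast
  from ext obtain Sp where Sp: "open Sp" "closure U \<times> {0..} \<subseteq> Sp" "C1_on Sp (\<lambda>(x, t). Psi x t)"
    unfolding regular_extension_def by blast
  have ucont: "continuous_on (closure U \<times> {0..}) (\<lambda>(x, t). u x t)"
    and pde: "\<And>x t. x \<in> U \<Longrightarrow> t > 0 \<Longrightarrow> tderiv u x t = div3 (\<lambda>y. ?X y t) x"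
    and ubd: "\<And>x t. x \<in> frontier U \<Longrightarrow> t > 0 \<Longrightarrow> u x t = Psi x t"
    using sol ext unfolding regular_solution_def regular_extension_def by auto
  have sub: "closure U \<times> {t} \<subseteq> Su" "closure U \<times> {t} \<subseteq> Sx" "closure U \<times> {t} \<subseteq> Sp"
    using Su(2) Sx(2) Sp(2) t by auto
  obtain S1 u' where S1: "open S1" "closure U \<subseteq> S1"
    "\<And>x. x \<in> S1 \<Longrightarrow> ((\<lambda>y. u y t) has_derivative blinfun_apply (u' x)) (at x)" "continuous_on S1 u'"
    by (rule C1_on_slice[OF Su(1) sub(1) Su(3)], blast)
  obtain S2 p' where S2: "open S2" "closure U \<subseteq> S2"
    "\<And>x. x \<in> S2 \<Longrightarrow> ((\<lambda>y. Psi y t) has_derivative blinfun_apply (p' x)) (at x)" "continuous_on S2 p'"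
    by (rule C1_on_slice[OF Sp(1) sub(3) Sp(3)], blast)
  obtain S3 X' where S3: "open S3" "closure U \<subseteq> S3"
    "\<And>x. x \<in> S3 \<Longrightarrow> ((\<lambda>y. ?X y t) has_derivative blinfun_apply (X' x)) (at x)" "continuous_on S3 X'"
    by (rule C1_on_slice[OF Sx(1) sub(2) Sx(3)], blast)
  define S where "S = S1 \<inter> S2 \<inter> S3"
  have S: "open S" "closure U \<subseteq> S" using S1 S2 S3 by (auto simp: S_def)
  define w v z X T where "w x = u x t - Psi x t" and "v x = Psi x t" and "z x = u x t"
    and "X x = ?X x t" and "T x = \<bar>tderiv Psi x t\<bar>" for x
  have z': "(z has_derivative blinfun_apply (u' x)) (at x)" and v': "(v has_derivative blinfun_apply (p' x)) (at x)"
    and X': "(X has_derivative blinfun_apply (X' x)) (at x)" if "x \<in> S" for x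
    using that S1(3) S2(3) S3(3) by (auto simp: S_def z_def[abs_def] v_def[abs_def] X_def[abs_def])
  have c': "continuous_on S u'" "continuous_on S p'" "continuous_on S X'"
    using S1(4) S2(4) S3(4) by (auto simp: S_def intro: continuous_on_subset)
  have w': "(w has_derivative blinfun_apply (u' x - p' x)) (at x)" if "x \<in> S" for x
    using has_derivative_diff[OF z'[OF that] v'[OF that]]
    by (simp add: w_def[abs_def] z_def v_def minus_blinfun.rep_eq)
  have cw': "continuous_on S (\<lambda>x. u' x - p' x)" by (intro continuous_intros c')
  have cont: "continuous_on (closure U) z" "continuous_on (closure U) v" "continuous_on (closure U) w"
    "continuous_on (closure U) X"
    by (rule has_derivative_imp_continuous_on[OF z' S(2)] has_derivative_imp_continuous_on[OF v' S(2)]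
        has_derivative_imp_continuous_on[OF w' S(2)] has_derivative_imp_continuous_on[OF X' S(2)]; assumption)+
  have gcont: "continuous_on (closure U) (grad3 w)" "continuous_on (closure U) (grad3 v)"
    using continuous_on_grad3[OF w' cw'] continuous_on_grad3[OF v' c'(2)] S(2) by (auto intro: continuous_on_subset)
  have wbd: "w x = 0" if "x \<in> frontier U" for x using ubd[OF that t] by (simp add: w_def)
  have U_cl: "x \<in> closure U" if "x \<in> U" for x using that closure_subset by auto
  have z0: "z x \<ge> 0" if "x \<in> closure U" for x using u_nonneg that t by (simp add: z_def)
  have grad: "grad3 z x = grad3 w x + grad3 v x" if "x \<in> S" for x
    unfolding grad3_eq[OF z'[OF that]] grad3_eq[OF w'[OF that]] grad3_eq[OF v'[OF that]]
    by (simp add: vec_eq_iff minus_blinfun.rep_eq)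
  have Xeq: "X x = Xmap N alb ac Rs k (z x) (grad3 w x + grad3 v x + (z x)\<^sup>2 *\<^sub>R Zfield G Om k e0 x t)" if "x \<in> U" for x
  proof -
    have "x \<in> S" using that S(2) U_cl by auto
    from grad[OF this, symmetric] show ?thesis by (simp only:) (simp add: X_def flux_def z_def[abs_def])
  qed
  obtain Fu :: "(real^3) \<times> real \<Rightarrow> ((real^3) \<times> real) \<Rightarrow>\<^sub>L real" where Fu0: "continuous_on Su Fu
    \<and> (\<forall>x t. (x, t) \<in> Su \<longrightarrow> ((\<lambda>y. u y t) has_derivative (\<lambda>h. blinfun_apply (Fu (x, t)) (h, 0))) (at x))
    \<and> (\<forall>x t. (x, t) \<in> Su \<longrightarrow> ((\<lambda>s. u x s) has_vector_derivative blinfun_apply (Fu (x, t)) (0, 1)) (at t))"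
    using C1_on_partial_derivatives[OF Su(3)] by (rule exE)
  obtain Fp :: "(real^3) \<times> real \<Rightarrow> ((real^3) \<times> real) \<Rightarrow>\<^sub>L real" where Fp0: "continuous_on Sp Fp
    \<and> (\<forall>x t. (x, t) \<in> Sp \<longrightarrow> ((\<lambda>y. Psi y t) has_derivative (\<lambda>h. blinfun_apply (Fp (x, t)) (h, 0))) (at x))
    \<and> (\<forall>x t. (x, t) \<in> Sp \<longrightarrow> ((\<lambda>s. Psi x s) has_vector_derivative blinfun_apply (Fp (x, t)) (0, 1)) (at t))"
    using C1_on_partial_derivatives[OF Sp(3)] by (rule exE)
  have ut: "((\<lambda>s. u x s) has_real_derivative Fu (x, r) (0, 1)) (at r)" if "x \<in> closure U" "r > 0" for x r
  proof -
    have "(x, r) \<in> Su" using that Su(2) by auto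
    from Fu0[THEN conjunct2, THEN conjunct2, rule_format, OF this] show ?thesis
      by (simp only: has_real_derivative_iff_has_vector_derivative)
  qed
  have pt: "((\<lambda>s. Psi x s) has_real_derivative Fp (x, r) (0, 1)) (at r)" if "x \<in> closure U" "r > 0" for x r
  proof -
    have "(x, r) \<in> Sp" using that Sp(2) by auto
    from Fp0[THEN conjunct2, THEN conjunct2, rule_format, OF this] show ?thesis
      by (simp only: has_real_derivative_iff_has_vector_derivative)
  qed
  have ptd: "tderiv Psi x t = Fp (x, t) (0, 1)" if "x \<in> closure U" for x
    using pt[OF that t] by (simp add: tderiv_def DERIV_imp_deriv)
  \<comment> \<open>The equation enters here: the time derivative of u inside U is replaced by the
    divergence of the flux.\<close>
  have utd: "Fu (x, t) (0, 1) = div3 X x" if "x \<in> U" for x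
    using pde[OF that t] DERIV_imp_deriv[OF ut[OF U_cl[OF that] t]] by (simp add: tderiv_def X_def[abs_def])
  have Fc: "continuous_on (closure U \<times> {0<..}) (\<lambda>z. Fu z (0, 1))" "continuous_on (closure U \<times> {0<..}) (\<lambda>z. Fp z (0, 1))"
  proof -
    have "closure U \<times> {0<..} \<subseteq> Sp" using Sp(2) by auto
    then show "continuous_on (closure U \<times> {0<..}) (\<lambda>z. Fu z (0, 1))" "continuous_on (closure U \<times> {0<..}) (\<lambda>z. Fp z (0, 1))"
      using continuous_on_subset[OF Fu0[THEN conjunct1] Su(2)] continuous_on_subset[OF Fp0[THEN conjunct1]]
      by (auto intro!: continuous_intros)
  qed
  have Psicont: "continuous_on (closure U \<times> {0..}) (\<lambda>(x, t). Psi x t)"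
  proof -
    from Sp(3) obtain F where "\<And>z. z \<in> Sp \<Longrightarrow> ((\<lambda>(x, t). Psi x t) has_derivative blinfun_apply (F z)) (at z)"
      unfolding C1_on_def by blast
    from has_derivative_imp_continuous_on[OF this Sp(2)] show ?thesis .
  qed
  have "((\<lambda>s. LINT x:U|lborel. \<bar>u x s - Psi x s\<bar> powr alpha) has_real_derivative
    (LINT x:U|lborel. alpha * (sgn (u x t - Psi x t) * \<bar>u x t - Psi x t\<bar> powr (alpha - 1))
      * (Fu (x, t) (0, 1) - Fp (x, t) (0, 1)))) (at t)"
  proof (rule has_real_derivative_integral_abs_powr[OF U t])
    show "continuous_on (closure U \<times> {0..}) (\<lambda>(x, s). u x s - Psi x s)"
      using continuous_on_diff[OF ucont Psicont] by (simp add: case_prod_beta)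
    show "continuous_on (closure U \<times> {0<..}) (\<lambda>(x, s). Fu (x, s) (0, 1) - Fp (x, s) (0, 1))"
      using continuous_on_diff[OF Fc] by (simp add: case_prod_beta)
    show "((\<lambda>s. u x s - Psi x s) has_real_derivative Fu (x, s) (0, 1) - Fp (x, s) (0, 1)) (at s)"
      if "x \<in> U" "s > 0" for x s
      using DERIV_diff[OF ut[OF U_cl[OF that(1)] that(2)] pt[OF U_cl[OF that(1)] that(2)]] .
  qed (use exps(2) in simp)
  then have Vd: "(energy has_real_derivative
    (LINT x:U|lborel. alpha * (sgn (w x) * \<bar>w x\<bar> powr (alpha - 1)) * (Fu (x, t) (0, 1) - Fp (x, t) (0, 1)))) (at t)"
    unfolding w_def by (auto intro!: derivative_eq_intros)
  have alpha2: "alpha > 2" "alpha > 1" using exps(2) by auto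
  note div = weighted_divergence_theorem[OF U S(2) alpha2(1) w' cw' X' c'(3) wbd]
  define V' where "V' = (LINT x:U|lborel. alpha * (sgn (w x) * \<bar>w x\<bar> powr (alpha - 1)) * (Fu (x, t) (0, 1) - Fp (x, t) (0, 1)))"
  have cT: "continuous_on (closure U) (\<lambda>x. Fp (x, t) (0, 1))"
    by (rule continuous_on_compose2[OF Fc(2), of _ "\<lambda>x. (x, t)", simplified])
      (use t in \<open>auto intro!: continuous_intros\<close>)
  have cTabs: "continuous_on (closure U) T"
    using continuous_on_rabs[OF cT] by (rule continuous_on_eq) (simp add: T_def ptd)
  have T0: "T x \<ge> 0" for x by (simp add: T_def)
  have csgn: "continuous_on (closure U) (\<lambda>x. sgn (w x) * \<bar>w x\<bar> powr (alpha - 1))"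
    by (rule continuous_on_compose2[OF continuous_at_imp_continuous_on cont(3), of UNIV "\<lambda>z. sgn z * \<bar>z\<bar> powr (alpha - 1)"])
      (use alpha2 continuous_sgn_powr in auto)
  have intF: "set_integrable lborel U (\<lambda>x. sgn (w x) * \<bar>w x\<bar> powr (alpha - 1) * Fp (x, t) (0, 1))"
    by (intro set_integrable_continuous_closure[OF U] continuous_on_mult[OF csgn cT])
  \<comment> \<open>Dividing by \<alpha> - 1 gives the \<Psi>_t term the prefactor \<alpha>(\<alpha>
    - 1) that integration by parts gives the flux term, so one pointwise bound covers both.\<close>
  define intT where "intT x = T x * \<bar>w x\<bar> powr (alpha - 1) / (alpha - 1)" for x
  have intTi: "set_integrable lborel U intT"
    unfolding intT_def
    by (intro set_integrable_continuous_closure[OF U] continuous_on_divide continuous_on_mult cTabs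
        continuous_on_powr_pos continuous_on_rabs cont continuous_on_const) (use alpha2 in auto)
  have "V' = alpha * (LINT x:U|lborel. sgn (w x) * \<bar>w x\<bar> powr (alpha - 1) * div3 X x
       - sgn (w x) * \<bar>w x\<bar> powr (alpha - 1) * Fp (x, t) (0, 1))"
    unfolding V'_def set_integral_mult_right[symmetric]
    using U by (intro set_lebesgue_integral_cong) (auto simp: utd algebra_simps)
  also have "\<dots> = alpha * (- (alpha - 1) * (LINT x:U|lborel. \<bar>w x\<bar> powr (alpha - 2) * (X x \<bullet> grad3 w x))
      - (LINT x:U|lborel. sgn (w x) * \<bar>w x\<bar> powr (alpha - 1) * Fp (x, t) (0, 1)))"
    using div intF by (simp add: set_integral_diff)
  also have "\<dots> \<le> alpha * (- (alpha - 1) * (LINT x:U|lborel. \<bar>w x\<bar> powr (alpha - 2) * (X x \<bullet> grad3 w x))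
      + (alpha - 1) * (LINT x:U|lborel. intT x))"
  proof -
    have "- (LINT x:U|lborel. sgn (w x) * \<bar>w x\<bar> powr (alpha - 1) * Fp (x, t) (0, 1))
      = (LINT x:U|lborel. - (sgn (w x) * \<bar>w x\<bar> powr (alpha - 1) * Fp (x, t) (0, 1)))"
      using intF by (simp add: set_integral_uminus)
    also have "\<dots> \<le> (LINT x:U|lborel. (alpha - 1) * intT x)"
    proof (rule set_integral_mono)
      show "set_integrable lborel U (\<lambda>x. - (sgn (w x) * \<bar>w x\<bar> powr (alpha - 1) * Fp (x, t) (0, 1)))"
        using set_integrable_mult_right[OF intF, of "- 1"] by simp
      fix x assume "x \<in> U"
      then have "(alpha - 1) * intT x = \<bar>Fp (x, t) (0, 1)\<bar> * \<bar>w x\<bar> powr (alpha - 1)"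
        using alpha2 by (simp add: intT_def T_def ptd[OF U_cl])
      moreover have "- (sgn (w x) * \<bar>w x\<bar> powr (alpha - 1) * Fp (x, t) (0, 1))
          \<le> \<bar>sgn (w x) * \<bar>w x\<bar> powr (alpha - 1) * Fp (x, t) (0, 1)\<bar>" by (rule abs_ge_minus_self)
      moreover have "\<bar>sgn (w x) * \<bar>w x\<bar> powr (alpha - 1) * Fp (x, t) (0, 1)\<bar> \<le> 1 * (\<bar>Fp (x, t) (0, 1)\<bar> * \<bar>w x\<bar> powr (alpha - 1))"
        by (simp add: abs_mult abs_sgn_eq)
      ultimately show "- (sgn (w x) * \<bar>w x\<bar> powr (alpha - 1) * Fp (x, t) (0, 1)) \<le> (alpha - 1) * intT x" by simp
    qed (use intTi in auto)
    finally show ?thesis using alpha2 by (intro mult_left_mono) auto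
  qed
  also have "\<dots> = alpha * (alpha - 1) * (LINT x:U|lborel. - (\<bar>w x\<bar> powr (alpha - 2) * (X x \<bullet> grad3 w x)) + intT x)"
  proof -
    have "(LINT x:U|lborel. - (\<bar>w x\<bar> powr (alpha - 2) * (X x \<bullet> grad3 w x)) + intT x)
      = - (LINT x:U|lborel. \<bar>w x\<bar> powr (alpha - 2) * (X x \<bullet> grad3 w x)) + (LINT x:U|lborel. intT x)"
      using set_integral_add_mult(2)[OF div(2) intTi, of "- 1"] by simp
    then show ?thesis by (simp only:) (simp add: algebra_simps)
  qed
  finally have V'1: "V' \<le> alpha * (alpha - 1) * (LINT x:U|lborel. - (\<bar>w x\<bar> powr (alpha - 2) * (X x \<bullet> grad3 w x)) + intT x)" .
  \<comment> \<open>The maximum inside \<open>C0c\<close>: C2 pays for the absorbed integral and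
    \<open>c15\<close> for the remaining pointwise terms.\<close>
  define M where "M = max C2 (c15 a (ac 0) (ac N) (alb N) (chi0 N ac))"
  have c15M: "c15 a (ac 0) (ac N) (alb N) (chi0 N ac) \<le> M" by (simp add: M_def)
  have "1 \<le> c15 a (ac 0) (ac N) (alb N) (chi0 N ac)" "2 * C11 \<le> c15 a (ac 0) (ac N) (alb N) (chi0 N ac)"
    "4 * C12 + C11 \<le> c15 a (ac 0) (ac N) (alb N) (chi0 N ac)"
    by (simp_all add: c15_def c14_def)
  from this[THEN order_trans, OF c15M] have M: "M \<ge> 1" "M \<ge> 2 * C11" "M \<ge> 4 * C12 + C11" .
  have MC2: "C2 \<le> M" by (simp add: M_def)
  define p where "p = alpha + 4 * (1 - a)"
  have p: "p > 3" using exps(2) a01 by (simp add: p_def)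
  define h where "h x = (1 + z x) powr (- 2) * norm (grad3 w x) powr (2 - a) * \<bar>w x\<bar> powr (alpha - 2)" for x
  define f1 f2 f3 f4 f5 where "f1 x = \<bar>w x\<bar> powr p" and "f2 x = \<bar>v x\<bar> powr p" and "f3 x = \<bar>w x\<bar> powr alpha"
    and "f4 x = norm (grad3 v x) powr (p / 2)" and "f5 x = T x powr (p / (5 - 4 * a))" for x
  have pos5: "0 < p / (5 - 4 * a)" using p a01 by simp
  have ints: "set_integrable lborel U f1" "set_integrable lborel U f2" "set_integrable lborel U f3"
      "set_integrable lborel U f4" "set_integrable lborel U f5" "set_integrable lborel U h"
  proof -
    have zc: "continuous_on (closure U) (\<lambda>x. (1 + z x) powr (- 2))"
      by (intro continuous_on_powr continuous_on_add continuous_on_const cont(1)) (use z0 in \<open>auto simp: add_nonneg_eq_0_iff\<close>)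
    have abs: "continuous_on (closure U) (\<lambda>x. \<bar>w x\<bar> powr r)" "continuous_on (closure U) (\<lambda>x. \<bar>v x\<bar> powr r)"
      "continuous_on (closure U) (\<lambda>x. norm (grad3 w x) powr r)" "continuous_on (closure U) (\<lambda>x. norm (grad3 v x) powr r)"
      "continuous_on (closure U) (\<lambda>x. T x powr r)" if "r > 0" for r
      using continuous_on_powr_pos[OF continuous_on_rabs[OF cont(3)] abs_ge_zero that]
        continuous_on_powr_pos[OF continuous_on_rabs[OF cont(2)] abs_ge_zero that]
        continuous_on_powr_pos[OF continuous_on_norm[OF gcont(1)] norm_ge_zero that]
        continuous_on_powr_pos[OF continuous_on_norm[OF gcont(2)] norm_ge_zero that]
        continuous_on_powr_pos[OF cTabs T0 that] by auto
    show "set_integrable lborel U f1" "set_integrable lborel U f2" "set_integrable lborel U f3"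
      "set_integrable lborel U f4" "set_integrable lborel U f5" "set_integrable lborel U h"
      unfolding f1_def f2_def f3_def f4_def f5_def h_def
      using p pos5 alpha2 a01
      by (intro set_integrable_continuous_closure[OF U] abs continuous_on_mult zc; simp)+
  qed
  have one: "set_integrable lborel U (\<lambda>x. 1::real)" "(LINT x:U|lborel. (1::real)) = measure lborel U"
    using U emeasure_bounded_finite[OF U(2)] by (auto simp: set_integrable_def set_lebesgue_integral_def)
  define k1 k2 k3 k4 k5 where "k1 = C13 * \<kappa> powr (3 - 2 * a)" and "k2 = M * \<kappa> powr (3 - 2 * a)"
    and "k3 = M / 4" and "k4 = M * 2 powr (p / 2 - 1) * \<kappa> powr (1 - a)"
    and "k5 = M * \<kappa> powr (- (3 - 2 * a) * (alpha - 1) / (5 - 4 * a))"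
  let ?rhs = "\<lambda>x. - (b / 4 / \<kappa>) * h x + (k1 * f1 x + (k2 * (2 powr (p - 1) * f2 x + (2 powr (p - 1) + 1 / 2) * 1)
       + (k3 * f3 x + (k4 * f4 x + k5 * f5 x))))"
  have i5: "set_integrable lborel U (\<lambda>x. k5 * f5 x)" using ints(5) by simp
  have i1: "set_integrable lborel U (\<lambda>x. (2 powr (p - 1) + 1 / 2) * 1)" using one(1) by (rule set_integrable_mult_right)
  note s4 = set_integral_add_mult[OF ints(4) i5, of k4]
  note s3 = set_integral_add_mult[OF ints(3) s4(1), of k3]
  note s2' = set_integral_add_mult[OF ints(2) i1, of "2 powr (p - 1)"]
  note s2 = set_integral_add_mult[OF s2'(1) s3(1), of k2]
  note s1 = set_integral_add_mult[OF ints(1) s2(1), of k1]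
  note s0 = set_integral_add_mult[OF ints(6) s1(1), of "- (b / 4 / \<kappa>)"]
  have "(LINT x:U|lborel. - (\<bar>w x\<bar> powr (alpha - 2) * (X x \<bullet> grad3 w x)) + intT x) \<le> (LINT x:U|lborel. ?rhs x)"
  proof (rule set_integral_mono)
    show "set_integrable lborel U (\<lambda>x. - (\<bar>w x\<bar> powr (alpha - 2) * (X x \<bullet> grad3 w x)) + intT x)"
      using set_integral_add_mult(1)[OF div(2) intTi, of "- 1"] by simp
    fix x assume x: "x \<in> U"
    have "z x \<le> \<bar>w x\<bar> + \<bar>v x\<bar>" by (simp add: z_def w_def v_def)
    from pointwise_energy_bound[OF M(1-3) x z0[OF U_cl[OF x]] this abs_ge_zero abs_ge_zero _ Xeq[OF x], of "T x"]
    show "- (\<bar>w x\<bar> powr (alpha - 2) * (X x \<bullet> grad3 w x)) + intT x \<le> ?rhs x"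
      by (simp add: p_def intT_def h_def f1_def f2_def f3_def f4_def f5_def k1_def k2_def k3_def k4_def k5_def T_def add.assoc)
  qed (rule s0(1))
  also have "\<dots> = - (b / 4 / \<kappa>) * (LINT x:U|lborel. h x) + (k1 * (LINT x:U|lborel. f1 x)
      + (k2 * (2 powr (p - 1) * (LINT x:U|lborel. f2 x) + (2 powr (p - 1) + 1 / 2) * measure lborel U)
       + (k3 * (LINT x:U|lborel. f3 x) + (k4 * (LINT x:U|lborel. f4 x) + k5 * (LINT x:U|lborel. f5 x)))))"
    unfolding s0(2) s1(2) s2(2) s2'(2) s3(2) s4(2) set_integral_mult_right one(2) ..
  finally have bnd: "(LINT x:U|lborel. - (\<bar>w x\<bar> powr (alpha - 2) * (X x \<bullet> grad3 w x)) + intT x) \<le> \<dots>" .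
  have A0: "0 \<le> alpha * (alpha - 1)" using alpha2 by simp
  have V'2: "V' \<le> alpha * (alpha - 1) * (- (b / 4 / \<kappa>) * (LINT x:U|lborel. h x) + C13 * \<kappa> powr (3 - 2 * a) * (LINT x:U|lborel. f1 x)
      + M * \<kappa> powr (3 - 2 * a) * (2 powr (p - 1) * (LINT x:U|lborel. f2 x) + (2 powr (p - 1) + 1 / 2) * measure lborel U)
       + M / 4 * ((1 + (LINT x:U|lborel. f3 x)) - 1) + M * 2 powr (p / 2 - 1) * \<kappa> powr (1 - a) * (LINT x:U|lborel. f4 x)
       + M * \<kappa> powr (- (3 - 2 * a) * (alpha - 1) / (5 - 4 * a)) * (LINT x:U|lborel. f5 x))"
    unfolding add_diff_cancel_left' using order_trans[OF V'1 mult_left_mono[OF bnd A0]]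
    unfolding k1_def k2_def k3_def k4_def k5_def by (simp only: add.assoc)
  have zw: "z x \<le> \<bar>w x\<bar> + \<bar>v x\<bar>" for x by (simp add: z_def w_def v_def)
  note J = absorbed_power_integral[OF S w' cw' wbd cont(1) z0 cont(2) zw, folded p_def, folded f1_def h_def f3_def]
  have f3nn: "0 \<le> (LINT x:U|lborel. f3 x)" by (rule set_integral_nonneg) (simp add: f3_def)
  have "V' + b / 4 / 2 / \<kappa> * (LINT x:U|lborel. h x) \<le> M * (alpha * (alpha - 1))
    * (1 + 2 powr (2 * \<theta> / (1 - \<theta>)) + 2 powr (p - 1) + 2 powr (p / 2 - 1))
    * (1 + measure lborel U) powr (max 1 ((1 - rs) * \<theta> / (rs * (1 - \<theta>))))
    * (\<kappa> powr mubar_p a \<theta> * (1 + ((LINT x:U|lborel. \<bar>v x\<bar> powr (2 * rs / (1 - rs))) powr ((1 - rs) / (2 * rs))) powr (2 * \<theta> / (1 - \<theta>)))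
      + \<kappa> powr (3 - 2 * a) * (LINT x:U|lborel. f2 x) + \<kappa> powr (1 - a) * (LINT x:U|lborel. f4 x)
      + \<kappa> powr (- (3 - 2 * a) * (alpha - 1) / (5 - 4 * a)) * (LINT x:U|lborel. f5 x))
    * (1 + (LINT x:U|lborel. f3 x)) powr (1 + \<gamma>)"
  proof (rule collect_terms[OF V'2 J])
    show "1 \<le> alpha * (alpha - 1)" using mult_mono[of 1 alpha 1 "alpha - 1"] exps(2) by simp
    show "0 < b / 4" using b_bounds(1) by simp
    show "0 < \<kappa>" using kappa_bounds(1) by simp
    show "0 \<le> (LINT x:U|lborel. h x)" by (rule set_integral_nonneg) (simp add: h_def)
    \<comment> \<open>Absorption can only raise the power of \<kappa>. Hence the volume term, which
      carries \<kappa>^(3 - 2a), can be charged to the first summand of \<open>Efun\<close>.\<close>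
    have mub: "3 - 2 * a \<le> mubar_p a \<theta>" "0 \<le> mubar_p a \<theta>"
    proof -
      have "(3 - 2 * a) * (1 - \<theta>) \<le> (3 - 2 * a) * 1" using exps(3) a01 by (intro mult_left_mono) auto
      then have "(3 - 2 * a) * (1 - \<theta>) \<le> 3 - 2 * a + \<theta>" using exps(3) by simp
      then show "3 - 2 * a \<le> mubar_p a \<theta>" using exps(4) by (simp add: mubar_p_def pos_le_divide_eq)
      then show "0 \<le> mubar_p a \<theta>" using a01 by linarith
    qed
    show "\<kappa> powr (3 - 2 * a) \<le> \<kappa> powr mubar_p a \<theta>" using kappa_bounds(1) mub by (intro powr_mono) auto
    show "1 \<le> \<kappa> powr mubar_p a \<theta>" using kappa_bounds(1) mub by (intro ge_one_powr_ge_zero) auto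
    show "1 \<le> 2 powr (p - 1)" using p by (intro ge_one_powr_ge_zero) auto
    have "1 \<le> 2 powr (p / 2 - 1)" using p by (intro ge_one_powr_ge_zero) auto
    then show "1 / 2 \<le> 2 powr (p / 2 - 1)" by linarith
    show "1 \<le> 1 + (LINT x:U|lborel. f3 x)" using f3nn by simp
    have "(1 + (LINT x:U|lborel. f3 x)) powr 1 \<le> (1 + (LINT x:U|lborel. f3 x)) powr (1 + \<gamma>)"
      using f3nn exps(16) by (intro powr_mono) auto
    then show "1 + (LINT x:U|lborel. f3 x) \<le> (1 + (LINT x:U|lborel. f3 x)) powr (1 + \<gamma>)" using f3nn by simp
    have "(1 + measure lborel U) powr 1 \<le> (1 + measure lborel U) powr (max 1 ((1 - rs) * \<theta> / (rs * (1 - \<theta>))))"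
      by (intro powr_mono) (auto simp: measure_nonneg)
    then show "1 + measure lborel U \<le> (1 + measure lborel U) powr (max 1 ((1 - rs) * \<theta> / (rs * (1 - \<theta>))))"
      by (simp add: measure_nonneg add_nonneg_nonneg)
  qed (use M(1) MC2 in \<open>auto intro!: set_integral_nonneg simp: f2_def f4_def f5_def\<close>)
  also have "\<dots> = Cs * E t * energy t powr (1 + \<gamma>)"
    unfolding Cstar_def C0c_def M_def[symmetric] Efun_def f2_def f3_def f4_def f5_def p_def v_def[abs_def] w_def T_def
    by (simp only: mult.assoc)
  finally have "V' + b / (8 * \<kappa>) * dissipation t \<le> Cs * E t * energy t powr (1 + \<gamma>)"
    by (simp add: h_def z_def w_def[abs_def])
  with Vd show "\<exists>V'. (energy has_real_derivative V') (at t)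
    \<and> V' + b / (8 * \<kappa>) * dissipation t \<le> Cs * E t * energy t powr (1 + \<gamma>)" unfolding V'_def by blast
  have "(\<integral>\<^sup>+x\<in>U. ennreal (h x) \<partial>lborel) = (\<integral>\<^sup>+x. ennreal (indicator U x *\<^sub>R h x) \<partial>lborel)"
    by (intro nn_integral_cong) (auto simp: indicator_def)
  also have "\<dots> = ennreal (LINT x:U|lborel. h x)"
    using ints(6) unfolding set_lebesgue_integral_def set_integrable_def
    by (intro nn_integral_eq_integral) (auto simp: h_def)
  finally show "(\<integral>\<^sup>+x\<in>U. ennreal ((1 + u x t) powr (- 2) * norm (grad3 (\<lambda>y. u y t - Psi y t) x) powr (2 - a)
        * \<bar>u x t - Psi x t\<bar> powr (alpha - 2)) \<partial>lborel) = ennreal (dissipation t)"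
    by (simp add: h_def z_def w_def[abs_def])
qed

text \<open>The energy is differentiated at positive times only, so the comparison with the initial
  value rests on continuity up to t = 0. There u is continuous on the closed cylinder and \<Psi> is
  C1 near it.\<close>

lemma continuous_on_energy:
  "continuous_on {0..T} energy"
proof -
  from ext obtain Sp where Sp: "open Sp" "closure U \<times> {0..} \<subseteq> Sp" "C1_on Sp (\<lambda>(x, t). Psi x t)"
    unfolding regular_extension_def by blast
  from Sp(3) obtain F where F: "\<And>z. z \<in> Sp \<Longrightarrow> ((\<lambda>(x, t). Psi x t) has_derivative blinfun_apply (F z)) (at z)"
    unfolding C1_on_def by blast
  have 1: "continuous_on (closure U \<times> {0..T}) (\<lambda>(x, t). Psi x t)"
    by (rule has_derivative_imp_continuous_on[OF F]) (use Sp(2) in auto)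
  have 2: "continuous_on (closure U \<times> {0..T}) (\<lambda>(x, t). u x t)"
    using sol unfolding regular_solution_def by (auto intro: continuous_on_subset)
  have "continuous_on (closure U \<times> {0..T}) (\<lambda>(x, t). \<bar>u x t - Psi x t\<bar> powr alpha)"
    using continuous_on_powr_pos[OF continuous_on_rabs[OF continuous_on_diff[OF 2 1]], of alpha] exps(2)
    by (simp add: case_prod_beta)
  then show ?thesis
    by (intro continuous_on_add continuous_on_const continuous_on_set_integral[OF U]) auto
qed

text \<open>\<Psi> is C1 on a neighbourhood of the cylinder including t = 0, so its gradient and
  time derivative are continuous there; all powers in \<open>Efun\<close> taken of \<Psi>, its
  derivatives or their integrals have positive exponents.\<close>

lemma continuous_on_E: "continuous_on {0..T} E"
proof -
  from ext obtain Sp where Sp: "open Sp" "closure U \<times> {0..} \<subseteq> Sp" "C1_on Sp (\<lambda>(x, t). Psi x t)"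
    unfolding regular_extension_def by blast
  from Sp(3) obtain F where F: "\<And>z. z \<in> Sp \<Longrightarrow> ((\<lambda>(x, t). Psi x t) has_derivative blinfun_apply (F z)) (at z)"
    unfolding C1_on_def by blast
  let ?K = "closure U \<times> {0..T}"
  have K: "?K \<subseteq> Sp" using Sp(2) by auto
  have Pc: "continuous_on ?K (\<lambda>z. Psi (fst z) (snd z))"
    using has_derivative_imp_continuous_on[OF F K] by (simp add: case_prod_beta)
  obtain Fp :: "(real^3) \<times> real \<Rightarrow> ((real^3) \<times> real) \<Rightarrow>\<^sub>L real" where Fp: "continuous_on Sp Fp
    \<and> (\<forall>x t. (x, t) \<in> Sp \<longrightarrow> ((\<lambda>y. Psi y t) has_derivative (\<lambda>h. blinfun_apply (Fp (x, t)) (h, 0))) (at x))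
    \<and> (\<forall>x t. (x, t) \<in> Sp \<longrightarrow> ((\<lambda>s. Psi x s) has_vector_derivative blinfun_apply (Fp (x, t)) (0, 1)) (at t))"
    using C1_on_partial_derivatives[OF Sp(3)] by (rule exE)
  have Fpc: "continuous_on ?K Fp" using Fp K by (auto intro: continuous_on_subset)
  have g: "grad3 (\<lambda>y. Psi y t) x = (\<chi> i. Fp (x, t) (axis i 1, 0))" if "(x, t) \<in> Sp" for x t
    using Fp that by (intro grad3_eq) auto
  have d: "tderiv Psi x t = Fp (x, t) (0, 1)" if "(x, t) \<in> Sp" for x t
    using Fp that unfolding tderiv_def
    by (intro DERIV_imp_deriv) (simp add: has_real_derivative_iff_has_vector_derivative)
  have gc: "continuous_on ?K (\<lambda>z. grad3 (\<lambda>y. Psi y (snd z)) (fst z))"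
  proof (rule continuous_on_eq)
    show "continuous_on ?K (\<lambda>z. \<chi> i. Fp z (axis i 1, 0))" by (intro continuous_intros Fpc)
  qed (use K g in auto)
  have tc: "continuous_on ?K (\<lambda>z. tderiv Psi (fst z) (snd z))"
  proof (rule continuous_on_eq)
    show "continuous_on ?K (\<lambda>z. Fp z (0, 1))" by (intro continuous_intros Fpc)
  qed (use K d in auto)
  have int: "continuous_on {0..T} (\<lambda>t. LINT x:U|lborel. f (x, t) powr r)"
    if "continuous_on ?K f" "\<And>z. f z \<ge> 0" "r > 0" for f :: "(real^3) \<times> real \<Rightarrow> real" and r
    using continuous_on_powr_pos[OF that(1) that(2) that(3)]
    by (intro continuous_on_set_integral[OF U]) (auto simp: case_prod_beta)
  have s0: "0 < 2 * rs / (1 - rs)" "0 < (1 - rs) / (2 * rs)" "0 < 2 * \<theta> / (1 - \<theta>)"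
    using exps(1,3,4) rs by simp_all
  have p0: "0 < alpha + 4 * (1 - a)" "0 < (alpha + 4 * (1 - a)) / 2" "0 < (alpha + 4 * (1 - a)) / (5 - 4 * a)"
    using exps(2) a01 by simp_all
  show ?thesis unfolding Efun_def[abs_def]
    using int[OF continuous_on_rabs[OF Pc] abs_ge_zero s0(1)] int[OF continuous_on_rabs[OF Pc] abs_ge_zero p0(1)]
      int[OF continuous_on_norm[OF gc] norm_ge_zero p0(2)] int[OF continuous_on_rabs[OF tc] abs_ge_zero p0(3)]
    by (intro continuous_on_add continuous_on_mult continuous_on_const continuous_on_powr_pos)
      (use s0 in \<open>auto intro!: set_integral_nonneg\<close>)
qed

lemma E_nonneg: "E t \<ge> 0"
  unfolding Efun_def by (intro add_nonneg_nonneg mult_nonneg_nonneg set_integral_nonneg) auto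

lemma Cs_pos: "Cs > 0"
proof -
  have "1 \<le> c15 a (ac 0) (ac N) (alb N) (chi0 N ac)" by (simp add: c15_def)
  then have "0 < C0c a (ac 0) (ac N) (alb N) (chi0 N ac) rs alpha cbar (measure lborel U) \<theta>"
    using exps(2) by (simp add: C0c_def less_max_iff_disj)
  moreover have "(1 + measure lborel U) \<noteq> 0" by (smt (verit) measure_nonneg)
  ultimately show ?thesis
    unfolding Cstar_def by (intro mult_pos_pos add_pos_nonneg) auto
qed

end

section \<open>From the energy inequality to the a priori bounds\<close>

theorem theorem3p2:
  fixes N :: nat and alb ac :: "nat \<Rightarrow> real" and Rs G Om :: real and k :: "real^3"
    and e0 :: "real \<Rightarrow> real^3" and U :: "(real^3) set" and cbar rs alpha T B :: real
    and u0 :: "real^3 \<Rightarrow> real" and psi Psi u :: "real^3 \<Rightarrow> real \<Rightarrow> real"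
  defines "a \<equiv> aexp N alb"
    and "chis \<equiv> chistar N ac Rs G Om U"
    and "th \<equiv> theta_p (aexp N alb) rs alpha"
    and "q \<equiv> rs * (2 - aexp N alb)"
    and "ubar \<equiv> (\<lambda>x t. u x t - Psi x t)"
    and "V0 \<equiv> 1 + (LINT x:U|lborel. \<bar>u0 x - Psi x 0\<bar> powr alpha)"
    and "V \<equiv> (\<lambda>t. 1 + (LINT x:U|lborel. \<bar>u x t - Psi x t\<bar> powr alpha))"
    and "gam \<equiv> gamma_p (aexp N alb) alpha (theta_p (aexp N alb) rs alpha)"
    and "E \<equiv> Efun (chistar N ac Rs G Om U) (aexp N alb) (theta_p (aexp N alb) rs alpha) rs alpha U Psi"
    and "Cs \<equiv> Cstar (aexp N alb) (ac 0) (ac N) (alb N) (chi0 N ac) rs alpha cbar (measure lborel U)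
                    (theta_p (aexp N alb) rs alpha)"
  assumes N: "N \<ge> 1"
    and alb0: "alb 0 = 0" and alb_mono: "\<forall>i j. i < j \<and> j \<le> N \<longrightarrow> alb i < alb j"
    and ac_pos: "\<forall>i\<le>N. ac i > 0"
    and k_unit: "norm k = 1" and Rs: "Rs \<ge> 0"
    and G: "G > 0" and Om: "Om \<ge> 0"
    and e0_smooth: "smooth_curve e0" and e0_unit: "\<forall>t. norm (e0 t) = 1"
    and U_open: "open U" and U_bdd: "bounded U" and U_ne: "U \<noteq> {}" and U_C1: "C1_boundary U"
    and cbar_pos: "cbar > 0"
    and sobolev: "\<forall>f. (\<exists>S. open S \<and> closure U \<subseteq> S \<and> C1_on S f) \<and> (\<forall>x\<in>frontier U. f x = 0) \<longrightarrow>
        (LINT x:U|lborel. \<bar>f x\<bar> powr (3 * q / (3 - q))) powr ((3 - q) / (3 * q))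
          \<le> cbar * (LINT x:U|lborel. norm (grad3 f x) powr q) powr (1 / q)"
    and rs1: "3 / (5 - a) < rs" and rs2: "rs < 1" and rs3: "rs \<ge> 1 / (2 - a)"
    and alpha1: "alpha \<ge> 2 * rs / (1 - rs)"
    and alpha2: "alpha > 3 * rs * (4 - 3 * a) / (rs * (5 - a) - 3)"
    and sol: "regular_solution N alb ac Rs k G Om e0 U u0 psi u"
    and u_nonneg: "\<forall>x\<in>closure U. \<forall>t\<ge>0. u x t \<ge> 0"
    and ext: "regular_extension U psi Psi"
    and T: "T > 0" and B: "0 < B" "B < 1"
    and hyp: "gam * Cs * V0 powr gam * (LINT \<tau>:{0..T}|lborel. E \<tau>) \<le> B"
  shows "(\<forall>t\<in>{0..T}. V t \<le> V0 * (1 - gam * Cs * V0 powr gam * (LINT \<tau>:{0..t}|lborel. E \<tau>)) powr (- 1 / gam)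
                      \<and> V t \<le> V0 * (1 - B) powr (- 1 / gam))
    \<and> (\<integral>\<^sup>+ t \<in> {0..T}. (\<integral>\<^sup>+ x \<in> U.
            ennreal ((1 + u x t) powr (- 2) * norm (grad3 (\<lambda>y. ubar y t) x) powr (2 - a)
                     * \<bar>ubar x t\<bar> powr (alpha - 2)) \<partial>lborel) \<partial>lborel)
         \<le> ennreal (8 * chis / c4 a (ac 0) (ac N) (alb N) * V0
                     * (1 + B / (gam * (1 - B) powr (1 + 1 / gam))))"
proof -
  interpret F: forchheimer_flow N alb ac Rs G Om k e0 U cbar rs alpha u0 psi Psi u
  proof
    show "alb i > 0" "alb i \<le> alb N" if "i \<in> {1..N}" for i
      using that alb0 alb_mono[rule_format, of 0 i] alb_mono[rule_format, of i N]
      by (auto simp: order_le_less)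
  qed (use N ac_pos k_unit Rs G e0_unit U_open U_bdd cbar_pos sobolev rs1 rs2 alpha1 alpha2 sol u_nonneg ext
      in \<open>auto simp: a_def q_def\<close>)
  have VF: "V = F.energy" by (simp add: V_def fun_eq_iff)
  have V0: "V0 = F.energy 0"
  proof -
    have "u0 x = u x 0" if "x \<in> U" for x using sol that by (simp add: regular_solution_def)
    then show ?thesis unfolding V0_def using U_open by (intro arg_cong2[of _ _ _ _ "(+)"] set_lebesgue_integral_cong) auto
  qed
  \<comment> \<open>The energy inequality yields a derivative separately at each positive time; a
    choice assembles these into the function that the Gronwall argument takes.\<close>
  define V' where "V' t = (SOME d. (F.energy has_real_derivative d) (at t)
    \<and> d + F.b / (8 * F.\<kappa>) * F.dissipation t \<le> F.Cs * F.E t * F.energy t powr (1 + F.\<gamma>))" for t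
  have V': "(F.energy has_real_derivative V' t) (at t)"
    "V' t + F.b / (8 * F.\<kappa>) * F.dissipation t \<le> F.Cs * F.E t * F.energy t powr (1 + F.\<gamma>)" if "t > 0" for t
    using someI_ex[OF F.energy_inequality(1)[OF that]] unfolding V'_def by auto
  have dnn: "0 \<le> F.dissipation t" for t by (rule set_integral_nonneg) auto
  have e1: "1 \<le> F.energy t" for t using set_integral_nonneg[of U "\<lambda>x. \<bar>u x t - Psi x t\<bar> powr alpha" lborel] by simp
  have c: "0 < F.b / (8 * F.\<kappa>)" using F.b_bounds(1) F.kappa_bounds(1) by simp
  note gr = nonlinear_gronwall[OF T F.continuous_on_energy F.continuous_on_E V'(1) V'(2) dnn F.E_nonneg e1
      F.exps(16) c F.Cs_pos B(2) hyp[unfolded gam_def Cs_def E_def V0]]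
  have "(\<integral>\<^sup>+ t \<in> {0..T}. (\<integral>\<^sup>+ x \<in> U.
            ennreal ((1 + u x t) powr (- 2) * norm (grad3 (\<lambda>y. ubar y t) x) powr (2 - a)
                     * \<bar>ubar x t\<bar> powr (alpha - 2)) \<partial>lborel) \<partial>lborel)
      = (\<integral>\<^sup>+ t \<in> {0..T}. ennreal (F.dissipation t) \<partial>lborel)"
  proof (rule nn_integral_cong_AE)
    \<comment> \<open>At t = 0 only continuity of u is available and its gradient is uncontrolled; a
      single time is a null set for the outer integral.\<close>
    have "AE t in lborel. t \<noteq> (0::real)" by (rule AE_lborel_singleton)
    then show "AE t in lborel. (\<integral>\<^sup>+ x \<in> U.
            ennreal ((1 + u x t) powr (- 2) * norm (grad3 (\<lambda>y. ubar y t) x) powr (2 - a)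
                     * \<bar>ubar x t\<bar> powr (alpha - 2)) \<partial>lborel) * indicator {0..T} t
        = ennreal (F.dissipation t) * indicator {0..T} t"
    proof eventually_elim
      case (elim t)
      then show ?case using F.energy_inequality(2)[of t]
        by (cases "t \<in> {0..T}") (auto simp: ubar_def a_def)
    qed
  qed
  also have "\<dots> \<le> ennreal (V0 / (F.b / (8 * F.\<kappa>)) * (1 + B / (gam * (1 - B) powr (1 + 1 / gam))))"
    using gr(3) by (simp only: V0 gam_def)
  also have "V0 / (F.b / (8 * F.\<kappa>)) = 8 * chis / c4 a (ac 0) (ac N) (alb N) * V0"
    by (simp add: a_def chis_def)
  finally show ?thesis
    using gr(1,2) unfolding VF V0 gam_def Cs_def E_def by blast
qed

end
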